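(* Let $\mathcal N$ be a semifinite von Neumann algebra on a separable Hilbert space with a faithful normal semifinite trace $\tau$, let $T\in\mathcal N$, $T\ge0$, and let $p\ge1$. Suppose that $\tau(e^{-tT^{-2}})<\infty$ for all $t>0$ and that $\tau(e^{-tT^{-2}})$ has, as $t\to0^+$, an asymptotic expansion in inverse powers of $t$ with leading term $C/t^{p/2}$ for some constant $C$. Then $T\in\mathcal Z_p$ and $$\lim_{s\to p}(s-p)\,\tau(T^s)=p\,\tau_\omega(T^p)$$ (the limit being over $s>p$) for any $D_2$-invariant and $M$-invariant state $\omega$ on $L_\infty(\mathbb R_+^* )$.
   Context: For $A\in\mathcal N$ and $t\ge0$, $\mu_t(A)=\inf\{s\ge 0:\tau(E^{|A|}(s,\infty))\le t\}$, where $E^{|A|}$ is the spectral measure of $|A|$. For $T\ge 0$ and $t>0$, $e^{-tT^{-2}}$ is the operator that is zero on $\ker T$ and is defined on $(\ker T)^\perp$ by the functional calculus. The asymptotic expansion means $\tau(e^{-tT^{-2}})=Ct^{-p/2}+{}$lower order powers of $t^{-1}$ as $t\to0^+$: there are exponents $p/2>a_1>a_2>\cdots$ and constants $C_k$ such that $\tau(e^{-tT^{-2}})=Ct^{-p/2}+\sum_{k=1}^nC_kt^{-a_k}+o(t^{-a_n})$ for each $n$. $\mathcal Z_p$ is the set of positive $T\in\mathcal N$ with $\limsup_{s\downarrow p}\bigl((s-p)\tau(T^s)\bigr)^{1/s}<\infty$; for such $T$ one has $\sup_{u>1}\frac1{\log(1+u)}\int_0^u\mu_t(T^p)\,dt<\infty$.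 $\mathbb R_+^*=(0,\infty)$; $(D_2f)(x)=f(x/2)$ and $(Mg)(t)=\frac1{\log t}\int_1^tg(s)\frac{ds}s$ on $L_\infty(\mathbb R_+^* )$; invariance means $\omega\circ D_2=\omega$, $\omega\circ M=\omega$. Standing convention on states $\omega$ on $L_\infty(\mathbb R_+^* )$: (1) $\omega$ vanishes on continuous functions on $\mathbb R_+^*$ vanishing at $0$ and at $\infty$; (2) $\operatorname{ess\,liminf}_{t\to\infty}f(t)\le\omega(f)\le\operatorname{ess\,limsup}_{t\to\infty}f(t)$ for real-valued $f$; (3) $\omega(f)=0$ if $f$ has compact essential support. We write $\omega\text{-}\lim_{t\to\infty}f(t)$ for $\omega(f)$. $\tau_\omega(T^p)=\omega\text{-}\lim_{t\to\infty}\frac1{\log(1+t)}\int_0^t\mu_s(T^p)\,ds$. *)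

theory Defs
  imports "HOL-Probability.Probability"
begin

section \<open>Complex Hilbert spaces and bounded operators\<close>

text \<open>The complex inner product is conjugate-linear in its first argument; its real part is the
  real inner product of the underlying real Hilbert space, which supplies norm and topology.\<close>

class complex_hilbert = real_inner + banach +
  fixes scaleC :: "complex \<Rightarrow> 'a \<Rightarrow> 'a" (infixr \<open>*\<^sub>C\<close> 75)
    and cinner :: "'a \<Rightarrow> 'a \<Rightarrow> complex"
  assumes scaleC_add_right: "a *\<^sub>C (x + y) = a *\<^sub>C x + a *\<^sub>C y"
    and scaleC_add_left: "(a + b) *\<^sub>C x = a *\<^sub>C x + b *\<^sub>C x"
    and scaleC_scaleC: "a *\<^sub>C (b *\<^sub>C x) = (a * b) *\<^sub>C x"
    and scaleR_scaleC: "r *\<^sub>R x = complex_of_real r *\<^sub>C x"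
    and cinner_commute: "cinner x y = cnj (cinner y x)"
    and cinner_add_right: "cinner x (y + z) = cinner x y + cinner x z"
    and cinner_scaleC_right: "cinner x (a *\<^sub>C y) = a * cinner x y"
    and inner_cinner: "inner x y = Re (cinner x y)"

text \<open>Elements of \<open>'h \<Rightarrow>\<^sub>L 'h\<close> are only real-linear, so complex linearity is imposed here.\<close>

definition bop :: "('h::complex_hilbert \<Rightarrow>\<^sub>L 'h) set" where
  "bop = {A::'h \<Rightarrow>\<^sub>L 'h. \<forall>c x. A (c *\<^sub>C x) = c *\<^sub>C A x}"

definition op_adj :: "('h::complex_hilbert \<Rightarrow>\<^sub>L 'h) \<Rightarrow> ('h \<Rightarrow>\<^sub>L 'h)" where
  "op_adj A = (THE B::'h \<Rightarrow>\<^sub>L 'h. \<forall>x y. cinner (B x) y = cinner x (A y))"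

definition op_pos :: "('h::complex_hilbert \<Rightarrow>\<^sub>L 'h) \<Rightarrow> bool" where
  "op_pos A \<longleftrightarrow> A \<in> bop \<and> (\<forall>x. cinner x (A x) \<in> \<real>\<^sub>\<ge>\<^sub>0)"

definition op_le :: "('h::complex_hilbert \<Rightarrow>\<^sub>L 'h) \<Rightarrow> ('h \<Rightarrow>\<^sub>L 'h) \<Rightarrow> bool" where
  "op_le A B \<longleftrightarrow> op_pos (B - A)"

section \<open>Von Neumann algebras and traces\<close>

definition commutant :: "('h::complex_hilbert \<Rightarrow>\<^sub>L 'h) set \<Rightarrow> ('h \<Rightarrow>\<^sub>L 'h) set" where
  "commutant S = {B \<in> bop. \<forall>A\<in>S. A o\<^sub>L B = B o\<^sub>L A}"

definition von_neumann_algebra :: "('h::complex_hilbert \<Rightarrow>\<^sub>L 'h) set \<Rightarrow> bool" where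
  "von_neumann_algebra N \<longleftrightarrow>
     N \<subseteq> bop \<and> (\<forall>A\<in>N. op_adj A \<in> N) \<and> commutant (commutant N) = N"

definition pos_part :: "('h::complex_hilbert \<Rightarrow>\<^sub>L 'h) set \<Rightarrow> ('h \<Rightarrow>\<^sub>L 'h) set" where
  "pos_part N = {A \<in> N. op_pos A}"

text \<open>Only the values of a trace on \<open>pos_part N\<close> are constrained.\<close>

definition trace_on :: "('h::complex_hilbert \<Rightarrow>\<^sub>L 'h) set \<Rightarrow> (('h \<Rightarrow>\<^sub>L 'h) \<Rightarrow> ennreal) \<Rightarrow> bool" where
  "trace_on N \<tau> \<longleftrightarrow>
     (\<forall>A\<in>pos_part N. \<forall>B\<in>pos_part N. \<tau> (A + B) = \<tau> A + \<tau> B) \<and>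
     (\<forall>A\<in>pos_part N. \<forall>c\<ge>0. \<tau> (c *\<^sub>R A) = ennreal c * \<tau> A) \<and>
     (\<forall>A\<in>N. \<tau> (op_adj A o\<^sub>L A) = \<tau> (A o\<^sub>L op_adj A))"

definition faithful_trace :: "('h::complex_hilbert \<Rightarrow>\<^sub>L 'h) set \<Rightarrow> (('h \<Rightarrow>\<^sub>L 'h) \<Rightarrow> ennreal) \<Rightarrow> bool" where
  "faithful_trace N \<tau> \<longleftrightarrow> (\<forall>A\<in>pos_part N. \<tau> A = 0 \<longrightarrow> A = 0)"

text \<open>Normality is stated for upward directed families having a supremum \<open>S\<close> in the positive part;
  every bounded increasing net is covered by its range.\<close>

definition normal_trace :: "('h::complex_hilbert \<Rightarrow>\<^sub>L 'h) set \<Rightarrow> (('h \<Rightarrow>\<^sub>L 'h) \<Rightarrow> ennreal) \<Rightarrow> bool" where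
  "normal_trace N \<tau> \<longleftrightarrow>
     (\<forall>D S. D \<subseteq> pos_part N \<and> D \<noteq> {} \<and> (\<forall>A\<in>D. \<forall>B\<in>D. \<exists>C\<in>D. op_le A C \<and> op_le B C) \<and>
            S \<in> pos_part N \<and> (\<forall>A\<in>D. op_le A S) \<and>
            (\<forall>R\<in>pos_part N. (\<forall>A\<in>D. op_le A R) \<longrightarrow> op_le S R)
        \<longrightarrow> \<tau> S = (SUP A\<in>D. \<tau> A))"

definition semifinite_trace :: "('h::complex_hilbert \<Rightarrow>\<^sub>L 'h) set \<Rightarrow> (('h \<Rightarrow>\<^sub>L 'h) \<Rightarrow> ennreal) \<Rightarrow> bool" where
  "semifinite_trace N \<tau> \<longleftrightarrow>
     (\<forall>A\<in>pos_part N. A \<noteq> 0 \<longrightarrow> (\<exists>B\<in>pos_part N. B \<noteq> 0 \<and> op_le B A \<and> \<tau> B < \<infinity>))"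

section \<open>Spectral measures and functional calculus\<close>

definition pvm :: "(real set \<Rightarrow> ('h::complex_hilbert \<Rightarrow>\<^sub>L 'h)) \<Rightarrow> bool" where
  "pvm E \<longleftrightarrow>
     (\<forall>B\<in>sets borel. E B \<in> bop \<and> op_adj (E B) = E B \<and> E B o\<^sub>L E B = E B) \<and>
     E UNIV = id_blinfun \<and>
     (\<forall>B::nat \<Rightarrow> real set. range B \<subseteq> sets borel \<and> disjoint_family B
        \<longrightarrow> (\<forall>x. (\<lambda>n. E (B n) x) sums E (\<Union>n. B n) x))"

definition scalar_measure :: "(real set \<Rightarrow> ('h::complex_hilbert \<Rightarrow>\<^sub>L 'h)) \<Rightarrow> 'h \<Rightarrow> real measure" where
  "scalar_measure E x = measure_of UNIV (sets borel) (\<lambda>B. ennreal (Re (cinner x (E B x))))"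

text \<open>The spectral measure of a bounded self-adjoint operator. Its value off the Borel sets is set
  to \<open>0\<close> to make the description unique; bounded support makes the integrals converge.\<close>

definition spectral_measure :: "('h::complex_hilbert \<Rightarrow>\<^sub>L 'h) \<Rightarrow> real set \<Rightarrow> ('h \<Rightarrow>\<^sub>L 'h)" where
  "spectral_measure A = (THE E::real set \<Rightarrow> ('h \<Rightarrow>\<^sub>L 'h). pvm E \<and> (\<forall>B. B \<notin> sets borel \<longrightarrow> E B = 0) \<and>
     (\<exists>r. E {-r..r} = id_blinfun) \<and>
     (\<forall>x. cinner x (A x) = complex_of_real (\<integral>l. l \<partial>scalar_measure E x)))"

text \<open>\<open>fun_calc f A\<close> is \<open>\<integral> f dE\<close> with \<open>E\<close> the spectral measure of \<open>A\<close>; a complex-linear bounded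
  operator is determined by its quadratic form.\<close>

definition fun_calc :: "(real \<Rightarrow> real) \<Rightarrow> ('h::complex_hilbert \<Rightarrow>\<^sub>L 'h) \<Rightarrow> ('h \<Rightarrow>\<^sub>L 'h)" where
  "fun_calc f A = (THE S::'h \<Rightarrow>\<^sub>L 'h. S \<in> bop \<and>
     (\<forall>x. cinner x (S x) = complex_of_real (\<integral>l. f l \<partial>scalar_measure (spectral_measure A) x)))"

definition op_abs :: "('h::complex_hilbert \<Rightarrow>\<^sub>L 'h) \<Rightarrow> ('h \<Rightarrow>\<^sub>L 'h)" where
  "op_abs A = fun_calc sqrt (op_adj A o\<^sub>L A)"

text \<open>Powers are used for positive operators and exponents \<open>s > 0\<close> only, where \<open>0 powr s = 0\<close>.\<close>

definition op_powr :: "('h::complex_hilbert \<Rightarrow>\<^sub>L 'h) \<Rightarrow> real \<Rightarrow> ('h \<Rightarrow>\<^sub>L 'h)" where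
  "op_powr A s = fun_calc (\<lambda>l. l powr s) A"

text \<open>The operator \<open>exp (- t A\<^bsup>-2\<^esup>)\<close>: zero on the kernel of \<open>A\<close>, which is the range of the spectral
  projection of \<open>{0}\<close>, and given by the functional calculus on its orthogonal complement.\<close>

definition heat_op :: "('h::complex_hilbert \<Rightarrow>\<^sub>L 'h) \<Rightarrow> real \<Rightarrow> ('h \<Rightarrow>\<^sub>L 'h)" where
  "heat_op A t = fun_calc (\<lambda>l. if l = 0 then 0 else exp (- t * l powi (-2))) A"

definition sing_val :: "(('h::complex_hilbert \<Rightarrow>\<^sub>L 'h) \<Rightarrow> ennreal) \<Rightarrow> ('h \<Rightarrow>\<^sub>L 'h) \<Rightarrow> real \<Rightarrow> real" where
  "sing_val \<tau> A t = Inf {s. 0 \<le> s \<and> \<tau> (spectral_measure (op_abs A) {s<..}) \<le> ennreal t}"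

definition ennreal_powr :: "ennreal \<Rightarrow> real \<Rightarrow> ennreal" where
  "ennreal_powr x r = (if x = \<infinity> then \<infinity> else ennreal (enn2real x powr r))"

definition Zp :: "('h::complex_hilbert \<Rightarrow>\<^sub>L 'h) set \<Rightarrow> (('h \<Rightarrow>\<^sub>L 'h) \<Rightarrow> ennreal) \<Rightarrow> real \<Rightarrow> ('h \<Rightarrow>\<^sub>L 'h) set" where
  "Zp N \<tau> p = {T \<in> pos_part N.
     Limsup (at_right p) (\<lambda>s. ennreal_powr (ennreal (s - p) * \<tau> (op_powr T s)) (1 / s)) < \<infinity>}"

text \<open>The sequences are used from index 1 on.\<close>

definition inv_power_expansion :: "(real \<Rightarrow> real) \<Rightarrow> real \<Rightarrow> real \<Rightarrow> bool" where
  "inv_power_expansion h C q \<longleftrightarrow>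
     (\<exists>(a::nat \<Rightarrow> real) (c::nat \<Rightarrow> real). a 1 < q \<and> (\<forall>k\<ge>1. a (Suc k) < a k) \<and>
        (\<forall>n\<ge>1. (\<lambda>t. h t - (C * t powr (- q) + (\<Sum>k=1..n. c k * t powr (- a k))))
                  \<in> o[at_right 0](\<lambda>t. t powr (- a n))))"

section \<open>States on \<open>L\<^sub>\<infinity>(0,\<infinity>)\<close>\<close>

abbreviation Rpos :: "real measure" where
  "Rpos \<equiv> restrict_space lborel {0<..}"

text \<open>Elements of \<open>L\<^sub>\<infinity>\<close> are represented by Borel functions; every class contains one. Their values
  outside \<open>(0,\<infinity>)\<close> are irrelevant.\<close>

definition Linf :: "(real \<Rightarrow> complex) set" where
  "Linf = {f \<in> borel_measurable Rpos. \<exists>K. AE t in Rpos. norm (f t) \<le> K}"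

definition state_Linf :: "((real \<Rightarrow> complex) \<Rightarrow> complex) \<Rightarrow> bool" where
  "state_Linf \<omega> \<longleftrightarrow>
     (\<forall>f\<in>Linf. \<forall>g\<in>Linf. (AE t in Rpos. f t = g t) \<longrightarrow> \<omega> f = \<omega> g) \<and>
     (\<forall>f\<in>Linf. \<forall>g\<in>Linf. \<omega> (\<lambda>t. f t + g t) = \<omega> f + \<omega> g) \<and>
     (\<forall>f\<in>Linf. \<forall>c. \<omega> (\<lambda>t. c * f t) = c * \<omega> f) \<and>
     (\<forall>f\<in>Linf. (AE t in Rpos. f t \<in> \<real>\<^sub>\<ge>\<^sub>0) \<longrightarrow> \<omega> f \<in> \<real>\<^sub>\<ge>\<^sub>0) \<and>
     \<omega> (\<lambda>t. 1) = 1"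

definition ess_limsup :: "(real \<Rightarrow> real) \<Rightarrow> ereal" where
  "ess_limsup f = (INF a\<in>{0<..}. esssup (restrict_space lborel {a<..}) (\<lambda>t. ereal (f t)))"

definition ess_liminf :: "(real \<Rightarrow> real) \<Rightarrow> ereal" where
  "ess_liminf f = - ess_limsup (\<lambda>t. - f t)"

definition admissible_state :: "((real \<Rightarrow> complex) \<Rightarrow> complex) \<Rightarrow> bool" where
  "admissible_state \<omega> \<longleftrightarrow> state_Linf \<omega> \<and>
     (\<forall>f. continuous_on {0<..} f \<and> (f \<longlongrightarrow> 0) (at_right 0) \<and> (f \<longlongrightarrow> 0) at_top \<longrightarrow> \<omega> f = 0) \<and>
     (\<forall>f::real \<Rightarrow> real. (\<lambda>t. complex_of_real (f t)) \<in> Linf \<longrightarrow>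
        ess_liminf f \<le> ereal (Re (\<omega> (\<lambda>t. complex_of_real (f t)))) \<and>
        ereal (Re (\<omega> (\<lambda>t. complex_of_real (f t)))) \<le> ess_limsup f) \<and>
     (\<forall>f\<in>Linf. (\<exists>K\<subseteq>{0<..}. compact K \<and> (AE t in Rpos. t \<notin> K \<longrightarrow> f t = 0)) \<longrightarrow> \<omega> f = 0)"

definition D2 :: "(real \<Rightarrow> complex) \<Rightarrow> real \<Rightarrow> complex" where
  "D2 f t = f (t / 2)"

text \<open>For \<open>t < 1\<close> the interval integral is the oriented one.\<close>

definition Mmean :: "(real \<Rightarrow> complex) \<Rightarrow> real \<Rightarrow> complex" where
  "Mmean g t = (LBINT s=ereal 1..ereal t. g s / of_real s) / of_real (ln t)"

definition invariant_under ::
    "((real \<Rightarrow> complex) \<Rightarrow> (real \<Rightarrow> complex)) \<Rightarrow> ((real \<Rightarrow> complex) \<Rightarrow> complex) \<Rightarrow> bool" where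
  "invariant_under \<Phi> \<omega> \<longleftrightarrow> (\<forall>f\<in>Linf. \<omega> (\<Phi> f) = \<omega> f)"

definition dixmier :: "(('h::complex_hilbert \<Rightarrow>\<^sub>L 'h) \<Rightarrow> ennreal) \<Rightarrow> ((real \<Rightarrow> complex) \<Rightarrow> complex)
    \<Rightarrow> ('h \<Rightarrow>\<^sub>L 'h) \<Rightarrow> complex" where
  "dixmier \<tau> \<omega> A =
     \<omega> (\<lambda>t. complex_of_real (1 / ln (1 + t) * (LBINT s=ereal 0..ereal t. sing_val \<tau> A s)))"

end

theory Submission
  imports Defs "HOL-Real_Asymp.Real_Asymp"
begin

text \<open>
  Let \<open>E\<close> be the spectral measure of \<open>T\<close> and \<open>m(B) = \<tau>(E(B \<inter> (0,\<infinity>)))\<close>. Normality of \<open>\<tau>\<close> makes \<open>m\<close> a measure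
  with \<open>\<tau>(f(T)) = \<integral> f dm\<close> for \<open>f \<ge> 0\<close>, \<open>f(0) = 0\<close>, so the heat trace, \<open>\<tau>(T\<^sup>s)\<close> and the singular values of \<open>T\<^sup>p\<close>
  are read off from \<open>m\<close>. Only the leading term of the expansion matters: by Karamata's Tauberian theorem
  it gives \<open>u\<^sup>p m(u,\<infinity>) \<rightarrow> K\<close> as \<open>u \<rightarrow> 0\<close>. A layer-cake integral then yields \<open>(s - p) \<tau>(T\<^sup>s) \<rightarrow> p K\<close>, while
  inverting the distribution function yields \<open>t \<mu>\<^sub>t(T\<^sup>p) \<rightarrow> K\<close>. Hence the logarithmic means defining
  \<open>\<tau>\<^sub>\<omega>(T\<^sup>p)\<close> converge to \<open>K\<close>, and \<open>\<omega>\<close> extends the limit at infinity.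

  The spectral measure comes from a moment problem: the numbers \<open>\<langle>x, T\<^sup>k x\<rangle>\<close> are, after scaling, the moments
  of a measure on \<open>[0,1]\<close> by the Hausdorff criterion and Helly's selection theorem, and bounded pointwise
  limits of polynomials in \<open>T\<close> produce the projections.
\<close>

section \<open>Self-adjoint operators\<close>

lemma blinfun_eqI_iff: "A = B \<longleftrightarrow> (\<forall>x. blinfun_apply A x = blinfun_apply B x)"
  by (auto intro: blinfun_eqI)

lemma cinner_eq_inner:
  "cinner x y = Complex (x \<bullet> y) (- (x \<bullet> (\<i> *\<^sub>C y)))"
  by (simp add: complex_eq_iff inner_cinner cinner_scaleC_right)

lemma scaleC_i_i [simp]: "\<i> *\<^sub>C \<i> *\<^sub>C x = - x" for x :: "'a::complex_hilbert"
proof -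
  have "(-1) *\<^sub>R x = complex_of_real (-1) *\<^sub>C x" by (rule scaleR_scaleC)
  then show ?thesis by (simp add: scaleC_scaleC)
qed

lemma inner_scaleC_i_left: "(\<i> *\<^sub>C x) \<bullet> y = - (x \<bullet> (\<i> *\<^sub>C y))"
proof -
  have "(\<i> *\<^sub>C x) \<bullet> y = Re (cinner y (\<i> *\<^sub>C x))"
    by (subst inner_commute) (rule inner_cinner)
  also have "\<dots> = - Im (cinner y x)" by (simp add: cinner_scaleC_right)
  also have "\<dots> = Im (cinner x y)" by (subst cinner_commute) simp
  also have "\<dots> = - (x \<bullet> (\<i> *\<^sub>C y))" by (simp add: cinner_eq_inner)
  finally show ?thesis .
qed

lemma scaleC_Re_Im: "c *\<^sub>C x = Re c *\<^sub>R x + Im c *\<^sub>R (\<i> *\<^sub>C x)"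
proof -
  have "c *\<^sub>C x = (complex_of_real (Re c) + complex_of_real (Im c) * \<i>) *\<^sub>C x"
    by (metis complex_eq mult.commute)
  then show ?thesis by (simp add: scaleC_add_left scaleR_scaleC scaleC_scaleC)
qed

lemma bop_iff_i: "A \<in> bop \<longleftrightarrow> (\<forall>x. A (\<i> *\<^sub>C x) = \<i> *\<^sub>C A x)"
proof
  assume *: "\<forall>x. A (\<i> *\<^sub>C x) = \<i> *\<^sub>C A x"
  have "A (c *\<^sub>C x) = c *\<^sub>C A x" for c x
    unfolding scaleC_Re_Im[of c] using * by (simp add: blinfun.add_right blinfun.scaleR_right)
  then show "A \<in> bop" by (simp add: bop_def)
qed (simp add: bop_def)

lemma bop_i: "A \<in> bop \<Longrightarrow> A (\<i> *\<^sub>C x) = \<i> *\<^sub>C A x"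
  by (simp add: bop_iff_i)

lemma norm_scaleC_i [simp]: "norm (\<i> *\<^sub>C x) = norm x"
  by (simp add: norm_eq_sqrt_inner inner_scaleC_i_left)

lemma scaleC_i_diff: "\<i> *\<^sub>C (x - y) = \<i> *\<^sub>C x - \<i> *\<^sub>C (y::'a::complex_hilbert)"
  by (metis (no_types, lifting) add_diff_cancel diff_add_cancel scaleC_add_right)

lemma scaleC_i_scaleR: "\<i> *\<^sub>C (r *\<^sub>R x) = r *\<^sub>R (\<i> *\<^sub>C (x::'a::complex_hilbert))"
  by (simp add: scaleR_scaleC scaleC_scaleC mult.commute)

lemma bounded_linear_scaleC_i: "bounded_linear (\<lambda>x::'a::complex_hilbert. \<i> *\<^sub>C x)"
  by (rule bounded_linear_intro[where K=1]) (auto simp: scaleC_add_right scaleC_i_scaleR)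

lemma bop_0 [simp]: "0 \<in> bop" and bop_id [simp]: "id_blinfun \<in> bop"
  by (auto simp: bop_iff_i linear_simps(3)[OF bounded_linear_scaleC_i])

lemma bop_add: "A \<in> bop \<Longrightarrow> B \<in> bop \<Longrightarrow> A + B \<in> bop"
  by (auto simp: bop_iff_i blinfun.add_left scaleC_add_right)

lemma bop_diff: "A \<in> bop \<Longrightarrow> B \<in> bop \<Longrightarrow> A - B \<in> bop"
  by (auto simp: bop_iff_i blinfun.diff_left scaleC_i_diff)

lemma bop_scaleR: "A \<in> bop \<Longrightarrow> r *\<^sub>R A \<in> bop"
  by (auto simp: bop_iff_i blinfun.scaleR_left scaleC_i_scaleR)

lemma bop_compose: "A \<in> bop \<Longrightarrow> B \<in> bop \<Longrightarrow> A o\<^sub>L B \<in> bop"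
  by (auto simp: bop_iff_i)

lemma bop_strong_limit:
  fixes A :: "'h::complex_hilbert \<Rightarrow>\<^sub>L 'h"
  assumes "\<And>n. S n \<in> bop" "\<And>x. (\<lambda>n. S n x) \<longlonglongrightarrow> A x"
  shows "A \<in> bop"
  unfolding bop_iff_i
proof
  fix x
  have "(\<lambda>n. S n (\<i> *\<^sub>C x)) \<longlonglongrightarrow> \<i> *\<^sub>C A x"
    using bounded_linear.tendsto[OF bounded_linear_scaleC_i assms(2)[of x]] assms(1)
    by (simp add: bop_i)
  then show "A (\<i> *\<^sub>C x) = \<i> *\<^sub>C A x"
    using assms(2) LIMSEQ_unique by blast
qed

definition sa_op :: "('h::complex_hilbert \<Rightarrow>\<^sub>L 'h) \<Rightarrow> bool" where
  "sa_op A \<longleftrightarrow> A \<in> bop \<and> (\<forall>x y. A x \<bullet> y = x \<bullet> A y)"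

lemma sa_opD: "sa_op A \<Longrightarrow> A \<in> bop" "sa_op A \<Longrightarrow> A x \<bullet> y = x \<bullet> A y"
  by (auto simp: sa_op_def)

lemma sa_op_0 [simp]: "sa_op 0" and sa_op_id [simp]: "sa_op id_blinfun"
  by (auto simp: sa_op_def)

lemma sa_op_add: "sa_op A \<Longrightarrow> sa_op B \<Longrightarrow> sa_op (A + B)"
  by (auto simp: sa_op_def bop_add blinfun.add_left inner_add)

lemma sa_op_diff: "sa_op A \<Longrightarrow> sa_op B \<Longrightarrow> sa_op (A - B)"
  by (auto simp: sa_op_def bop_diff blinfun.diff_left inner_diff)

lemma sa_op_scaleR: "sa_op A \<Longrightarrow> sa_op (r *\<^sub>R A)"
  by (auto simp: sa_op_def bop_scaleR blinfun.scaleR_left)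

lemma sa_op_compose: "sa_op A \<Longrightarrow> sa_op B \<Longrightarrow> A o\<^sub>L B = B o\<^sub>L A \<Longrightarrow> sa_op (A o\<^sub>L B)"
  by (auto simp: sa_op_def bop_compose) (metis blinfun_apply_blinfun_compose)

lemma sa_op_strong_limit:
  fixes A :: "'h::complex_hilbert \<Rightarrow>\<^sub>L 'h"
  assumes "\<And>n. sa_op (S n)" "\<And>x. (\<lambda>n. S n x) \<longlonglongrightarrow> A x"
  shows "sa_op A"
  unfolding sa_op_def
proof (intro conjI allI)
  show "A \<in> bop" by (rule bop_strong_limit[OF _ assms(2)]) (rule sa_opD(1)[OF assms(1)])
  fix x y
  have "(\<lambda>n. S n x \<bullet> y) \<longlonglongrightarrow> A x \<bullet> y" "(\<lambda>n. x \<bullet> S n y) \<longlonglongrightarrow> x \<bullet> A y"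
    by (intro tendsto_intros assms)+
  then show "A x \<bullet> y = x \<bullet> A y"
    using LIMSEQ_unique by (simp add: sa_opD(2)[OF assms(1)])
qed

lemma sa_op_cinner: assumes "sa_op A" shows "cinner (A x) y = cinner x (A y)"
proof -
  have "A x \<bullet> (\<i> *\<^sub>C y) = x \<bullet> (\<i> *\<^sub>C A y)"
    using assms by (simp add: sa_op_def bop_i)
  then show ?thesis using assms by (simp add: cinner_eq_inner sa_opD)
qed

lemma cinner_sa_op: assumes "sa_op A" shows "cinner x (A x) = complex_of_real (x \<bullet> A x)"
proof -
  have "x \<bullet> (\<i> *\<^sub>C A x) = - (x \<bullet> (\<i> *\<^sub>C A x))"
  proof -
    have "x \<bullet> (\<i> *\<^sub>C A x) = - ((\<i> *\<^sub>C x) \<bullet> A x)" by (simp add: inner_scaleC_i_left)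
    also have "\<dots> = - (A (\<i> *\<^sub>C x) \<bullet> x)" using assms by (simp add: sa_opD(2))
    also have "\<dots> = - (x \<bullet> (\<i> *\<^sub>C A x))"
      using assms by (simp add: sa_op_def bop_i inner_commute)
    finally show ?thesis .
  qed
  then show ?thesis by (simp add: cinner_eq_inner complex_eq_iff)
qed

lemma sa_op_if_real_form:
  assumes A: "A \<in> bop" and im: "\<And>x. Im (cinner x (A x)) = 0"
  shows "sa_op A"
proof -
  have z: "x \<bullet> (\<i> *\<^sub>C A x) = 0" for x using im[of x] by (simp add: cinner_eq_inner)
  have *: "x \<bullet> (\<i> *\<^sub>C A y) + y \<bullet> (\<i> *\<^sub>C A x) = 0" for x y
    using z[of "x + y"] z[of x] z[of y] A
    by (simp add: blinfun.add_right scaleC_add_right inner_add)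
  have "A x \<bullet> y = x \<bullet> A y" for x y
    using *[of x "\<i> *\<^sub>C y"] A inner_commute[of y "A x"]
    by (simp add: bop_i inner_scaleC_i_left)
  with A show ?thesis by (simp add: sa_op_def)
qed

lemma sa_op_pos_iff: "op_pos A \<longleftrightarrow> sa_op A \<and> (\<forall>x. 0 \<le> x \<bullet> A x)"
proof
  assume "op_pos A"
  then have A: "A \<in> bop" "\<And>x. cinner x (A x) \<in> \<real>\<^sub>\<ge>\<^sub>0" by (auto simp: op_pos_def)
  then have "sa_op A" by (intro sa_op_if_real_form) (auto simp: complex_nonneg_Reals_iff)
  with A show "sa_op A \<and> (\<forall>x. 0 \<le> x \<bullet> A x)"
    by (auto simp: complex_nonneg_Reals_iff inner_cinner)
qed (auto simp: op_pos_def sa_opD cinner_sa_op)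

lemma sa_op_eqI:
  assumes "sa_op A" "sa_op B" "\<And>x. x \<bullet> A x = x \<bullet> B x"
  shows "A = B"
proof (rule blinfun_eqI)
  fix x
  let ?D = "A - B"
  have D: "sa_op ?D" using assms by (intro sa_op_diff)
  have z: "x \<bullet> ?D x = 0" for x using assms(3)[of x] by (simp add: blinfun.diff_left inner_diff)
  have "?D x \<bullet> y = 0" for x y
    using z[of "x + y"] z[of x] z[of y] sa_opD(2)[OF D, of x y]
    by (simp add: blinfun.add_right inner_add inner_commute[of "?D x" y])
  from this[of x "?D x"] show "A x = B x" by (simp add: blinfun.diff_left)
qed

lemma bop_eq_sa_op:
  assumes "sa_op A" "B \<in> bop" "\<And>x. cinner x (B x) = complex_of_real (x \<bullet> A x)"
  shows "B = A"
proof (rule sa_op_eqI)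
  show "sa_op B" using assms by (intro sa_op_if_real_form) auto
  show "x \<bullet> B x = x \<bullet> A x" for x using assms(3)[of x] by (simp add: inner_cinner)
qed (use assms in auto)

section \<open>Adjoints\<close>

lemma Cauchy_square_bound:
  fixes X :: "nat \<Rightarrow> 'a::real_normed_vector"
  assumes b: "\<And>m n. (norm (X m - X n))\<^sup>2 \<le> 2 * e m + 2 * e n" and e: "e \<longlonglongrightarrow> (0::real)"
  shows "Cauchy X"
proof (rule CauchyI)
  fix d :: real assume d: "0 < d"
  then have "\<forall>\<^sub>F n in sequentially. e n < d\<^sup>2 / 4" using e by (intro order_tendstoD) auto
  then obtain M where M: "\<And>n. n \<ge> M \<Longrightarrow> e n < d\<^sup>2 / 4"
    by (auto simp: eventually_sequentially)
  have "norm (X m - X n) < d" if "m \<ge> M" "n \<ge> M" for m n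
  proof -
    have "(norm (X m - X n))\<^sup>2 < d\<^sup>2" using b[of m n] M[OF that(1)] M[OF that(2)] by simp
    then show ?thesis using d by (meson less_imp_le power_less_imp_less_base)
  qed
  then show "\<exists>M. \<forall>m\<ge>M. \<forall>n\<ge>M. norm (X m - X n) < d" by blast
qed

text \<open>The representing vector minimises \<open>\<lambda>x. x \<bullet> x - 2 * f x\<close>.\<close>

lemma riesz_representation:
  fixes f :: "'a::{real_inner, banach} \<Rightarrow> real"
  assumes f: "bounded_linear f"
  obtains z where "\<And>y. f y = z \<bullet> y"
proof -
  interpret f: bounded_linear f by fact
  define J where "J x = x \<bullet> x - 2 * f x" for x
  obtain K where K: "\<And>x. \<bar>f x\<bar> \<le> norm x * K" using f.bounded by (auto simp del: mult.commute)
  have lb: "- (K^2) \<le> J x" for x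
  proof -
    have "0 \<le> (norm x - K)^2" by simp
    also have "\<dots> = norm x ^ 2 - 2 * (norm x * K) + K^2" by (simp add: power2_diff)
    also have "\<dots> \<le> x \<bullet> x - 2 * f x + K^2"
      using K[of x] by (simp add: power2_norm_eq_inner abs_le_iff)
    finally show ?thesis by (simp add: J_def)
  qed
  define d where "d = (INF x. J x)"
  have bdd: "bdd_below (range J)" using lb by (intro bdd_belowI) auto
  have d: "d \<le> J x" for x unfolding d_def by (rule cINF_lower[OF bdd]) simp
  have "\<exists>x. J x < d + 1 / (Suc n)" for n
  proof -
    have "Inf (range J) < d + 1 / (Suc n)" by (simp add: d_def)
    then show ?thesis using cInf_lessD[of "range J"] by auto
  qed
  then obtain X where X: "\<And>n. J (X n) < d + 1 / (Suc n)" by metis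
  have par: "(norm (x - y))^2 \<le> 2 * (J x - d) + 2 * (J y - d)" for x y
  proof -
    have "(norm (x - y))^2 = 2 * J x + 2 * J y - 4 * J ((1/2) *\<^sub>R (x + y))"
      by (simp add: J_def power2_norm_eq_inner inner_add inner_diff f.scaleR f.add inner_commute algebra_simps)
    also have "\<dots> \<le> 2 * J x + 2 * J y - 4 * d"
      by (intro diff_left_mono mult_left_mono d) simp
    finally show ?thesis by simp
  qed
  have "Cauchy X"
  proof (rule Cauchy_square_bound)
    show "(norm (X m - X n))\<^sup>2 \<le> 2 * (1 / real (Suc m)) + 2 * (1 / real (Suc n))" for m n
      using par[of "X m" "X n"] X[of m] X[of n] by simp
    show "(\<lambda>n. 1 / real (Suc n)) \<longlonglongrightarrow> 0" by real_asymp
  qed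
  then obtain z where z: "X \<longlonglongrightarrow> z" by (auto simp: Cauchy_convergent_iff convergent_def)
  have "(\<lambda>n. J (X n)) \<longlonglongrightarrow> J z"
    unfolding J_def by (intro tendsto_intros z f.tendsto)
  moreover have "(\<lambda>n. d + 1 / real (Suc n)) \<longlonglongrightarrow> d"
    using LIMSEQ_inverse_real_of_nat_add[of d] by (simp add: divide_inverse)
  ultimately have Jz: "J z \<le> d"
    using X by (intro LIMSEQ_le[of _ "J z"]) (auto intro: less_imp_le)
  have "f y = z \<bullet> y" for y
  proof -
    let ?c = "z \<bullet> y - f y"
    have *: "0 \<le> t^2 * (y \<bullet> y) + 2 * t * ?c" for t
    proof -
      have "J (z + t *\<^sub>R y) = J z + (t^2 * (y \<bullet> y) + 2 * t * ?c)"
        by (simp add: J_def inner_add f.add f.scaleR inner_commute power2_eq_square algebra_simps)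
      with d[of "z + t *\<^sub>R y"] Jz show ?thesis by linarith
    qed
    show ?thesis
    proof (cases "y = 0")
      case False
      then have y: "0 < y \<bullet> y" by simp
      have "(- ?c / (y \<bullet> y))^2 * (y \<bullet> y) + 2 * (- ?c / (y \<bullet> y)) * ?c = - ((?c)^2 / (y \<bullet> y))"
        using y by (simp add: divide_simps power2_eq_square) (simp add: algebra_simps)
      with *[of "- ?c / (y \<bullet> y)"] have "0 \<le> - ((?c)^2 / (y \<bullet> y))" by simp
      then have "?c^2 \<le> 0" using y by (simp add: divide_le_0_iff)
      then show ?thesis by simp
    qed (simp add: f.zero)
  qed
  then show ?thesis using that by blast
qed

lemma op_adj_ex:
  assumes A: "A \<in> bop"
  shows "\<exists>!B. \<forall>x y. cinner (blinfun_apply B x) y = cinner x (A y)"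
proof -
  have "\<exists>z. \<forall>y. x \<bullet> A y = z \<bullet> y" for x
  proof -
    have "bounded_linear (\<lambda>y. x \<bullet> A y)"
      by (intro bounded_linear_inner_right_comp blinfun.bounded_linear_right)
    from riesz_representation[OF this] show ?thesis by (metis (no_types))
  qed
  then obtain b where b: "\<And>x y. x \<bullet> A y = b x \<bullet> y" by metis
  have eq: "u = v" if "\<And>y. u \<bullet> y = v \<bullet> y" for u v :: 'a
  proof -
    have "(u - v) \<bullet> (u - v) = 0" using that[of "u - v"] by (simp only: inner_diff_left)
    then show ?thesis by simp
  qed
  have "bounded_linear b"
  proof (rule bounded_linear_intro[where K = "norm A"])
    show "b (x + y) = b x + b y" for x y by (rule eq) (simp add: inner_add flip: b)
    show "b (r *\<^sub>R x) = r *\<^sub>R b x" for r x by (rule eq) (simp flip: b)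
    show "norm (b x) \<le> norm x * norm A" for x
    proof (cases "b x = 0")
      case False
      have "norm (b x) * norm (b x) = x \<bullet> A (b x)"
        by (simp add: b flip: power2_norm_eq_inner power2_eq_square)
      also have "\<dots> \<le> norm x * (norm A * norm (b x))"
        by (rule order_trans[OF norm_cauchy_schwarz]) (simp add: mult_left_mono norm_blinfun)
      finally show ?thesis using False by simp
    qed simp
  qed
  then have B: "blinfun_apply (Blinfun b) = b" by (rule bounded_linear_Blinfun_apply)
  have "cinner (Blinfun b x) y = cinner x (A y)" for x y
    using A by (simp add: cinner_eq_inner B flip: b bop_i)
  moreover have "B = B'" if "\<forall>x y. cinner (blinfun_apply B x) y = cinner x (A y)"
    "\<forall>x y. cinner (blinfun_apply B' x) y = cinner x (A y)" for B B'
    by (rule blinfun_eqI, rule eq) (use that in \<open>simp add: inner_cinner\<close>)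
  ultimately show ?thesis by blast
qed

lemma op_adj_cinner: "A \<in> bop \<Longrightarrow> cinner (op_adj A x) y = cinner x (A y)"
  unfolding op_adj_def using theI'[OF op_adj_ex] by blast

lemma op_adj_sa_op: "sa_op A \<Longrightarrow> op_adj A = A"
  unfolding op_adj_def using op_adj_ex[of A]
  by (intro the1_equality) (auto simp: sa_opD sa_op_cinner)

lemma sa_op_iff_adj: "sa_op A \<longleftrightarrow> A \<in> bop \<and> op_adj A = A"
  by (metis inner_cinner op_adj_cinner op_adj_sa_op sa_op_def)

section \<open>Commutants\<close>

lemma commutant_closed:
  shows "0 \<in> commutant X" "id_blinfun \<in> commutant X"
    and "A \<in> commutant X \<Longrightarrow> B \<in> commutant X \<Longrightarrow> A + B \<in> commutant X"
    and "A \<in> commutant X \<Longrightarrow> B \<in> commutant X \<Longrightarrow> A - B \<in> commutant X"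
    and "A \<in> commutant X \<Longrightarrow> r *\<^sub>R A \<in> commutant X"
    and "A \<in> commutant X \<Longrightarrow> B \<in> commutant X \<Longrightarrow> A o\<^sub>L B \<in> commutant X"
  by (auto simp: commutant_def bop_add bop_diff bop_scaleR bop_compose blinfun_eqI_iff
      blinfun.add_left blinfun.add_right blinfun.diff_left blinfun.diff_right
      blinfun.scaleR_left blinfun.scaleR_right)

lemma commutant_strong_limit:
  fixes A :: "'h::complex_hilbert \<Rightarrow>\<^sub>L 'h"
  assumes "\<And>n. S n \<in> commutant X" "\<And>x. (\<lambda>n. S n x) \<longlonglongrightarrow> A x"
  shows "A \<in> commutant X"
proof -
  have "A \<in> bop" using assms(1) by (intro bop_strong_limit[OF _ assms(2)]) (auto simp: commutant_def)
  moreover have "B (A x) = A (B x)" if "B \<in> X" for B x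
  proof -
    have "(\<lambda>n. S n (B x)) \<longlonglongrightarrow> A (B x)" by (rule assms)
    moreover have "S n (B x) = B (S n x)" for n
    proof -
      have "B o\<^sub>L S n = S n o\<^sub>L B" using assms(1)[of n] that by (auto simp: commutant_def)
      then show ?thesis by (simp add: blinfun_eqI_iff)
    qed
    moreover have "(\<lambda>n. B (S n x)) \<longlonglongrightarrow> B (A x)"
      by (intro blinfun.tendsto tendsto_const assms)
    ultimately show ?thesis using LIMSEQ_unique[of "\<lambda>n. S n (B x)" "B (A x)" "A (B x)"] by simp
  qed
  ultimately show ?thesis by (auto simp: commutant_def blinfun_eqI_iff)
qed

lemma bicommutant_mono:
  assumes "X \<subseteq> Y" shows "commutant (commutant X) \<subseteq> commutant (commutant Y)"
  using assms by (auto simp: commutant_def)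

lemma bicommutant_superset: "X \<subseteq> bop \<Longrightarrow> X \<subseteq> commutant (commutant X)"
  by (auto simp: commutant_def)

section \<open>The Hausdorff moment problem\<close>

lemma moment_difference_expansion:
  fixes w :: "nat \<Rightarrow> nat \<Rightarrow> real"
  assumes rec: "\<And>j m. w j m = w (Suc j) m + w j (Suc m)"
  shows "w j m = (\<Sum>i\<le>N. real (N choose i) * w (j + i) (m + N - i))"
proof (induction N arbitrary: j m)
  case (Suc N)
  have "w j m = w (Suc j) m + w j (Suc m)" by (rule rec)
  also have "w (Suc j) m = (\<Sum>i\<le>N. real (N choose i) * w (j + Suc i) (m + N - i))"
    using Suc[of "Suc j" m] by simp
  also have "w j (Suc m) = (\<Sum>i\<le>N. real (N choose i) * w (j + i) (m + Suc N - i))"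
    using Suc[of j "Suc m"] by simp
  also have "\<dots> = (\<Sum>i\<le>Suc N. real (N choose i) * w (j + i) (m + Suc N - i))" by simp
  also have "\<dots> = w j (m + Suc N) + (\<Sum>i\<le>N. real (N choose Suc i) * w (j + Suc i) (m + N - i))"
    by (subst sum.atMost_Suc_shift) simp
  also have "(\<Sum>i\<le>N. real (N choose i) * w (j + Suc i) (m + N - i)) +
      (w j (m + Suc N) + (\<Sum>i\<le>N. real (N choose Suc i) * w (j + Suc i) (m + N - i))) =
      w j (m + Suc N) + (\<Sum>i\<le>N. real (Suc N choose Suc i) * w (j + Suc i) (m + Suc N - Suc i))"
    by (simp add: sum.distrib algebra_simps)
  also have "\<dots> = (\<Sum>i\<le>Suc N. real (Suc N choose i) * w (j + i) (m + Suc N - i))"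
    by (simp add: sum.atMost_Suc_shift del: sum.atMost_Suc)
  finally show ?case .
qed simp

lemma binomial_falling_ratio:
  assumes "k \<le> n" "j \<le> n"
  shows "(if j < k then 0 else real ((n - k) choose (j - k))) =
    real (n choose j) * (\<Prod>i<k. (real j - real i) / (real n - real i))"
  using assms(1)
proof (induction k)
  case (Suc k)
  have k: "k < n" using Suc.prems by simp
  have "(if j < Suc k then 0 else real ((n - Suc k) choose (j - Suc k))) =
    (if j < k then 0 else real ((n - k) choose (j - k))) * ((real j - real k) / (real n - real k))"
  proof (cases "j < Suc k")
    case True
    then consider "j < k" | "j = k" by linarith
    then show ?thesis using True by cases auto
  next
    case False
    then have j: "k < j" by simp
    have "real (j - k) * real ((n - k) choose (j - k)) = real (n - k) * real ((n - k - 1) choose (j - k - 1))"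
      using times_binomial_minus1_eq[of "j - k" "n - k"] j by (metis of_nat_mult zero_less_diff)
    moreover have "real (n - k) = real n - real k" "real (j - k) = real j - real k" "real n - real k > 0"
      using j k by auto
    ultimately show ?thesis using False j by (simp add: field_simps)
  qed
  also have "(if j < k then 0 else real ((n - k) choose (j - k))) =
    real (n choose j) * (\<Prod>i<k. (real j - real i) / (real n - real i))"
    using Suc by simp
  finally show ?case by simp
qed simp

lemma falling_ratio_approx:
  assumes "2 * k \<le> n" "j \<le> n" "0 < n"
  shows "\<bar>(\<Prod>i<k. (real j - real i) / (real n - real i)) - (real j / real n) ^ k\<bar> \<le> 2 * real k ^ 2 / real n"
proof -
  have "norm ((\<Prod>i<k. (real j - real i) / (real n - real i)) - (\<Prod>i<k. real j / real n))
    \<le> (\<Sum>i<k. norm ((real j - real i) / (real n - real i) - real j / real n))"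
  proof (rule norm_prod_diff)
    fix i assume "i \<in> {..<k}"
    then have "i < k" by simp
    then have "\<bar>real j - real i\<bar> \<le> real n - real i" "real n - real i > 0" using assms by auto
    then show "norm ((real j - real i) / (real n - real i)) \<le> 1" by (simp add: divide_simps)
    show "norm (real j / real n) \<le> 1" using assms by simp
  qed
  also have "\<dots> \<le> (\<Sum>i<k. 2 * real k / real n)"
  proof (rule sum_mono)
    fix i assume "i \<in> {..<k}"
    then have i: "i < k" by simp
    have p: "real n - real i \<ge> real n / 2" "real n > 0" using i assms by auto
    then have p': "real n - real i > 0" by linarith
    have "(real j - real i) / (real n - real i) - real j / real n =
        - (real i * (real n - real j) / (real n * (real n - real i)))"
      using p p' by (simp add: divide_simps) (simp add: algebra_simps)
    then have "norm ((real j - real i) / (real n - real i) - real j / real n) =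
        real i * (real n - real j) / (real n * (real n - real i))"
      using p p' assms by (simp add: abs_mult)
    also have "\<dots> \<le> real k * real n / (real n * (real n / 2))"
      using p p' assms i by (intro frac_le mult_mono mult_pos_pos) auto
    also have "\<dots> = 2 * real k / real n" using p by simp
    finally show "norm ((real j - real i) / (real n - real i) - real j / real n) \<le> 2 * real k / real n" .
  qed
  also have "\<dots> = 2 * real k ^ 2 / real n" by (simp add: power2_eq_square)
  finally show ?thesis by simp
qed

theorem hausdorff_moment:
  fixes w :: "nat \<Rightarrow> nat \<Rightarrow> real"
  assumes nonneg: "\<And>j m. 0 \<le> w j m" and rec: "\<And>j m. w j m = w (Suc j) m + w j (Suc m)"
    and w0: "w 0 0 = 1"
  obtains M where "real_distribution M" "AE t in M. t \<in> {0..1}" "\<And>k. (\<integral>t. t ^ k \<partial>M) = w k 0"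
proof -
  define v where "v n j = real (n choose j) * w j (n - j)" for n j
  have v: "0 \<le> v n j" for n j by (simp add: v_def nonneg)
  have v1: "(\<Sum>j\<le>n. v n j) = 1" for n
    using moment_difference_expansion[of w, OF rec, of 0 0 n] w0 by (simp add: v_def)
  define M where "M n = distr (point_measure {..n} (\<lambda>j. ennreal (v n j))) borel (\<lambda>j. real j / real n)" for n
  have ps: "prob_space (point_measure {..n} (\<lambda>j. ennreal (v n j)))" for n
    by (rule prob_spaceI) (simp add: space_point_measure emeasure_point_measure_finite v v1 sum_ennreal)
  have M: "real_distribution (M n)" for n
    unfolding M_def by (rule prob_space.real_distribution_distr[OF ps]) simp
  have int: "(\<integral>t. f t \<partial>M n) = (\<Sum>j\<le>n. v n j * f (real j / real n))" if "f \<in> borel_measurable borel"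
    for f :: "real \<Rightarrow> real" and n
    unfolding M_def
    by (subst integral_distr) (auto simp: that lebesgue_integral_point_measure_finite v)
  have unit: "real j / real n \<in> {0..1}" if "j \<le> n" for j n
    using that by (cases "n = 0") auto
  have "tight M"
    unfolding tight_def
  proof (intro conjI allI impI M)
    fix e :: real assume "0 < e"
    have "measure (M n) {-1<..2} = 1" for n
    proof -
      interpret real_distribution "M n" by (rule M)
      have "measure (M n) {-1<..2} = (\<integral>t. indicator {-1<..2} t \<partial>M n)" by simp
      also have "\<dots> = (\<Sum>j\<le>n. v n j * indicator {-1<..2} (real j / real n))" by (rule int) simp
      also have "\<dots> = (\<Sum>j\<le>n. v n j)" 
      proof (intro sum.cong refl)
        fix j assume "j \<in> {..n}"
        then have "j \<le> n" by simp
        then have "0 \<le> real j / real n" "real j / real n \<le> 1" using unit[of j n] by simp_all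
        then have "real j / real n \<in> {-1<..2}" unfolding greaterThanAtMost_iff by linarith
        then show "v n j * indicator {-1<..2} (real j / real n) = v n j" by simp
      qed
      finally show ?thesis by (simp add: v1)
    qed
    then show "\<exists>a b. a < b \<and> (\<forall>n. 1 - e < measure (M n) {a<..b})"
      using \<open>0 < e\<close> by (intro exI[of _ "-1"] exI[of _ 2]) simp
  qed
  from tight_imp_convergent_subsubsequence[OF this strict_mono_id]
  obtain r L where r: "strict_mono (r :: nat \<Rightarrow> nat)" and L: "real_distribution L" and "weak_conv_m (M \<circ> id \<circ> r) L"
    by blast
  then have wc: "weak_conv_m (\<lambda>n. M (r n)) L" by (simp add: comp_def)
  interpret L: real_distribution L by (rule L)
  have lim: "(\<lambda>n. \<integral>t. f t \<partial>M (r n)) \<longlonglongrightarrow> (\<integral>t. f t \<partial>L)"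
    if "\<And>x. isCont f x" "\<And>x. norm (f x) \<le> 1" for f :: "real \<Rightarrow> real"
    using weak_conv_imp_integral_bdd_continuous_conv[OF M L wc that] by simp
  define cl where "cl t = max 0 (min 1 t)" for t :: real
  have cl: "continuous_on UNIV cl" unfolding cl_def by (intro continuous_intros)
  then have cl_cont: "isCont cl x" for x by (simp add: continuous_on_eq_continuous_at)
  have cl_meas [measurable]: "cl \<in> borel_measurable borel" using cl by (rule borel_measurable_continuous_onI)
  have AE_cl: "AE t in L. t = cl t"
  proof -
    define g where "g t = min 1 \<bar>t - cl t\<bar>" for t
    have gc: "isCont g x" for x unfolding g_def using cl_cont by (intro continuous_intros) auto
    have [measurable]: "g \<in> borel_measurable borel" unfolding g_def by measurable
    have g01: "0 \<le> g t" "g t \<le> 1" for t by (auto simp: g_def)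
    have "(\<integral>t. g t \<partial>M (r n)) = 0" for n
    proof -
      have "v (r n) j * g (real j / real (r n)) = 0" if "j \<in> {..r n}" for j
        using unit[of j "r n"] that by (simp add: g_def cl_def)
      then have "(\<Sum>j\<le>r n. v (r n) j * g (real j / real (r n))) = 0" by (rule sum.neutral[OF ballI])
      then show ?thesis by (simp add: int)
    qed
    then have "(\<integral>t. g t \<partial>L) = 0"
      using lim[of g] gc g01 by (simp add: LIMSEQ_const_iff)
    moreover have "integrable L g"
      by (rule L.integrable_const_bound[of _ 1]) (auto simp: g01)
    ultimately have "AE t in L. g t = 0"
      using integral_nonneg_eq_0_iff_AE[of L g] g01 by simp
    then show ?thesis by eventually_elim (auto simp: g_def min_def split: if_splits)
  qed
  show thesis
  proof (rule that[OF L])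
    show "AE t in L. t \<in> {0..1}" using AE_cl by eventually_elim (auto simp: cl_def)
    fix k
    have "(\<integral>t. t ^ k \<partial>L) = (\<integral>t. cl t ^ k \<partial>L)"
      by (rule integral_cong_AE) (use AE_cl in auto)
    moreover have "(\<lambda>n. \<integral>t. cl t ^ k \<partial>M (r n)) \<longlonglongrightarrow> (\<integral>t. cl t ^ k \<partial>L)"
    proof (rule lim)
      show "isCont (\<lambda>t. cl t ^ k) x" for x using cl_cont by (intro continuous_intros)
      show "norm (cl x ^ k) \<le> 1" for x by (auto simp: cl_def power_le_one)
    qed
    moreover have "(\<lambda>n. \<integral>t. cl t ^ k \<partial>M (r n)) \<longlonglongrightarrow> w k 0"
    proof -
      have "(\<lambda>n. \<integral>t. cl t ^ k \<partial>M n) \<longlonglongrightarrow> w k 0"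
      proof (rule LIM_zero_cancel, rule Lim_null_comparison)
        show "(\<lambda>n. 2 * real k ^ 2 / real n) \<longlonglongrightarrow> 0" by real_asymp
        show "\<forall>\<^sub>F n in sequentially. norm ((\<integral>t. cl t ^ k \<partial>M n) - w k 0) \<le> 2 * real k ^ 2 / real n"
          using eventually_ge_at_top[of "2 * k + 1"]
        proof eventually_elim
          case (elim n)
          have "w k 0 = (\<Sum>i\<le>n - k. real ((n - k) choose i) * w (k + i) (n - k - i))"
            using moment_difference_expansion[of w, OF rec, of k 0 "n - k"] by simp
          also have "\<dots> = (\<Sum>j\<in>{k..n}. real ((n - k) choose (j - k)) * w j (n - j))"
            using elim by (intro sum.reindex_bij_witness[of _ "\<lambda>j. j - k" "\<lambda>i. k + i"]) auto
          also have "\<dots> = (\<Sum>j\<le>n. (if j < k then 0 else real ((n - k) choose (j - k))) * w j (n - j))"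
            by (intro sum.mono_neutral_cong_left) auto
          also have "\<dots> = (\<Sum>j\<le>n. v n j * (\<Prod>i<k. (real j - real i) / (real n - real i)))"
            using elim by (intro sum.cong refl) (simp add: binomial_falling_ratio v_def)
          finally have wk: "w k 0 = (\<Sum>j\<le>n. v n j * (\<Prod>i<k. (real j - real i) / (real n - real i)))" .
          have "(\<integral>t. cl t ^ k \<partial>M n) = (\<Sum>j\<le>n. v n j * cl (real j / real n) ^ k)"
            by (rule int) simp
          also have "\<dots> = (\<Sum>j\<le>n. v n j * (real j / real n) ^ k)"
          proof (intro sum.cong refl)
            fix j assume "j \<in> {..n}"
            then have "cl (real j / real n) = real j / real n" using unit[of j n] by (simp add: cl_def)
            then show "v n j * cl (real j / real n) ^ k = v n j * (real j / real n) ^ k" by simp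
          qed
          finally have "norm ((\<integral>t. cl t ^ k \<partial>M n) - w k 0) =
              \<bar>\<Sum>j\<le>n. v n j * ((real j / real n) ^ k - (\<Prod>i<k. (real j - real i) / (real n - real i)))\<bar>"
            by (simp add: wk right_diff_distrib sum_subtractf)
          also have "\<dots> \<le> (\<Sum>j\<le>n. v n j * \<bar>(real j / real n) ^ k - (\<Prod>i<k. (real j - real i) / (real n - real i))\<bar>)"
            by (rule order_trans[OF sum_abs]) (simp add: abs_mult v)
          also have "\<dots> \<le> (\<Sum>j\<le>n. v n j * (2 * real k ^ 2 / real n))"
            using elim by (intro sum_mono mult_left_mono v)
              (subst abs_minus_commute, rule falling_ratio_approx, auto)
          also have "\<dots> = 2 * real k ^ 2 / real n" by (simp only: v1 mult_1 flip: sum_distrib_right)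
          finally show ?case .
        qed
      qed
      from LIMSEQ_subseq_LIMSEQ[OF this r] show ?thesis by (simp add: comp_def)
    qed
    ultimately show "(\<integral>t. t ^ k \<partial>L) = w k 0" by (auto intro: LIMSEQ_unique)
  qed
qed

section \<open>Polynomial approximation of half-lines\<close>

lemma polynomial_approx_half_line:
  fixes a r :: real
  obtains g where "\<And>n. real_polynomial_function (g n)" "\<And>n t. t \<in> {-r..r} \<Longrightarrow> \<bar>g n t\<bar> \<le> 2"
    "\<And>t. t \<in> {-r..r} \<Longrightarrow> (\<lambda>n. g n t) \<longlonglongrightarrow> indicator {a<..} t"
proof -
  define f where "f n t = min 1 (max 0 (real n * (t - a)))" for n :: nat and t
  have "\<exists>g. real_polynomial_function g \<and> (\<forall>t\<in>{-r..r}. \<bar>f n t - g t\<bar> < 1 / real (Suc n))" for n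
  proof -
    have "continuous_on {-r..r} (f n)" unfolding f_def by (intro continuous_intros)
    then obtain g where "real_polynomial_function g" "\<And>t. t \<in> {-r..r} \<Longrightarrow> \<bar>f n t - g t\<bar> < 1 / real (Suc n)"
      by (rule Stone_Weierstrass_real_polynomial_function[rotated, where e="1 / real (Suc n)"]) auto
    then show ?thesis by blast
  qed
  then obtain g where g: "\<And>n. real_polynomial_function (g n)"
    "\<And>n t. t \<in> {-r..r} \<Longrightarrow> \<bar>f n t - g n t\<bar> < 1 / real (Suc n)" by metis
  show thesis
  proof (rule that[OF g(1)])
    fix n t assume t: "t \<in> {-r..r}"
    have "\<bar>f n t\<bar> \<le> 1" by (auto simp: f_def)
    moreover have "1 / real (Suc n) \<le> 1" by simp
    ultimately show "\<bar>g n t\<bar> \<le> 2" using g(2)[OF t, of n] by linarith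
  next
    fix t assume t: "t \<in> {-r..r}"
    have "(\<lambda>n. f n t) \<longlonglongrightarrow> indicator {a<..} t"
    proof (cases "a < t")
      case True
      obtain N :: nat where N: "1 / (t - a) < real N" using reals_Archimedean2 by blast
      have "\<forall>\<^sub>F n in sequentially. f n t = 1"
        using eventually_ge_at_top[of N]
      proof eventually_elim
        case (elim n)
        have "1 \<le> real N * (t - a)" using N True by (simp add: field_simps)
        also have "\<dots> \<le> real n * (t - a)" using elim True by (intro mult_right_mono) auto
        finally show ?case by (simp add: f_def)
      qed
      then show ?thesis using True by (simp add: tendsto_eventually)
    next
      case False
      then have "real n * (t - a) \<le> 0" for n by (intro mult_nonneg_nonpos) auto
      then have "f n t = 0" for n by (simp add: f_def max_absorb1)
      then show ?thesis using False by simp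
    qed
    moreover have "(\<lambda>n. g n t - f n t) \<longlonglongrightarrow> 0"
    proof (rule Lim_null_comparison)
      show "(\<lambda>n. 1 / real (Suc n)) \<longlonglongrightarrow> 0" by real_asymp
      show "\<forall>\<^sub>F n in sequentially. norm (g n t - f n t) \<le> 1 / real (Suc n)"
        using g(2)[OF t] by (intro always_eventually allI) (simp add: abs_minus_commute less_imp_le)
    qed
    ultimately show "(\<lambda>n. g n t) \<longlonglongrightarrow> indicator {a<..} t"
      using tendsto_add[of "\<lambda>n. f n t" _ _ "\<lambda>n. g n t - f n t"] by fastforce
  qed
qed

lemma integrable_bounded_AE:
  fixes f :: "real \<Rightarrow> real"
  assumes "finite_measure M" "sets M = sets borel" "AE t in M. t \<in> {-r..r}"
    "f \<in> borel_measurable borel" "\<And>t. t \<in> {-r..r} \<Longrightarrow> \<bar>f t\<bar> \<le> K"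
  shows "integrable M f"
proof -
  interpret finite_measure M by fact
  have "f \<in> borel_measurable M" using assms(2,4) by (simp cong: measurable_cong_sets)
  moreover have "AE t in M. norm (f t) \<le> K" using assms(3) by eventually_elim (simp add: assms(5))
  ultimately show ?thesis by (intro integrable_const_bound[of f K])
qed

lemma borel_measurable_real_polynomial_function:
  fixes f :: "real \<Rightarrow> real"
  assumes "real_polynomial_function f" shows "f \<in> borel_measurable borel"
proof -
  obtain a n where "f = (\<lambda>x. \<Sum>i\<le>n. a i * x ^ i)"
    using assms real_polynomial_function_iff_sum by metis
  then show ?thesis by simp
qed

lemma integrable_power_AE:
  assumes "finite_measure M" "sets M = sets borel" "AE t in M. t \<in> {-r..r}"
  shows "integrable M (\<lambda>t::real. t ^ k)"
  using assms
  by (rule integrable_bounded_AE[where K="r^k"]) (auto simp: power_abs intro!: power_mono)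

theorem measure_eqI_moments:
  fixes M N :: "real measure"
  assumes M: "finite_measure M" "sets M = sets borel" "AE t in M. t \<in> {-r..r}"
    and N: "finite_measure N" "sets N = sets borel" "AE t in N. t \<in> {-r..r}"
    and eq: "\<And>k. (\<integral>t. t ^ k \<partial>M) = (\<integral>t. t ^ k \<partial>N)"
  shows "M = N"
proof (rule measure_eqI_lessThan[OF M(2) N(2)])
  interpret M: finite_measure M by fact
  interpret N: finite_measure N by fact
  fix a
  show "emeasure M {a<..} < \<infinity>" by (simp add: less_top[symmetric])
  obtain g where g: "\<And>n. real_polynomial_function (g n)" "\<And>n t. t \<in> {-r..r} \<Longrightarrow> \<bar>g n t\<bar> \<le> 2"
    "\<And>t. t \<in> {-r..r} \<Longrightarrow> (\<lambda>n. g n t) \<longlonglongrightarrow> indicator {a<..} t"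
    by (rule polynomial_approx_half_line[where a=a and r=r]) blast
  have lim: "(\<lambda>n. \<integral>t. g n t \<partial>P) \<longlonglongrightarrow> measure P {a<..}"
    if P: "finite_measure P" "sets P = sets borel" "AE t in P. t \<in> {-r..r}" for P
  proof -
    interpret finite_measure P by fact
    have "(\<lambda>n. \<integral>t. g n t \<partial>P) \<longlonglongrightarrow> (\<integral>t. indicator {a<..} t \<partial>P)"
    proof (rule integral_dominated_convergence[where w="\<lambda>_. 2"])
      show "AE t in P. (\<lambda>n. g n t) \<longlonglongrightarrow> indicator {a<..} t"
        using P(3) by eventually_elim (rule g(3))
      show "AE t in P. norm (g n t) \<le> 2" for n using P(3) by eventually_elim (simp add: g(2))
    qed (use borel_measurable_real_polynomial_function[OF g(1)] P(2) in \<open>auto cong: measurable_cong_sets\<close>)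
    then show ?thesis using P(2) by simp
  qed
  have "(\<integral>t. g n t \<partial>M) = (\<integral>t. g n t \<partial>N)" for n
  proof -
    obtain c m where "g n = (\<lambda>x. \<Sum>i\<le>m. c i * x ^ i)"
      using g(1) real_polynomial_function_iff_sum by metis
    then show ?thesis
      using integrable_power_AE[OF M] integrable_power_AE[OF N] by (simp add: eq)
  qed
  then have "measure M {a<..} = measure N {a<..}"
    using lim[OF M] lim[OF N] by (auto intro: LIMSEQ_unique)
  then show "emeasure M {a<..} = emeasure N {a<..}"
    by (simp add: M.emeasure_eq_measure N.emeasure_eq_measure)
qed

section \<open>Existence of the spectral measure of a positive operator\<close>

primrec opow :: "('h::complex_hilbert \<Rightarrow>\<^sub>L 'h) \<Rightarrow> nat \<Rightarrow> ('h \<Rightarrow>\<^sub>L 'h)" where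
  "opow A 0 = id_blinfun"
| "opow A (Suc n) = A o\<^sub>L opow A n"

lemma opow_commute:
  fixes A S :: "'h::complex_hilbert \<Rightarrow>\<^sub>L 'h"
  shows "(\<And>x. S (A x) = A (S x)) \<Longrightarrow> S (opow A n x) = opow A n (S x)"
  by (induction n arbitrary: x) auto

lemma opow_add: "opow A (m + n) x = opow A m (opow A n x)"
  by (induction m) auto

lemma sa_op_opow: assumes "sa_op A" shows "sa_op (opow A n)"
proof (induction n)
  case (Suc n)
  have "A o\<^sub>L opow A n = opow A n o\<^sub>L A" by (rule blinfun_eqI) (simp add: opow_commute[of A A])
  then show ?case using assms Suc by (simp add: sa_op_compose)
qed simp

lemma opow_scaleR: "opow (r *\<^sub>R A) n = r ^ n *\<^sub>R opow A n"
  by (induction n) (auto intro!: blinfun_eqI simp: blinfun.scaleR_left blinfun.scaleR_right)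

lemma opow_in_commutant: "A \<in> commutant X \<Longrightarrow> opow A n \<in> commutant X"
  by (induction n) (auto intro: commutant_closed)

lemma opow_mixed_nonneg:
  fixes B D :: "'h::complex_hilbert \<Rightarrow>\<^sub>L 'h"
  assumes B: "sa_op B" "\<And>x. 0 \<le> x \<bullet> B x" and D: "sa_op D" "\<And>x. 0 \<le> x \<bullet> D x"
    and sum: "\<And>x. B x + D x = x"
  shows "0 \<le> x \<bullet> opow B j (opow D m x)"
proof -
  have com: "B (D x) = D (B x)" for x
  proof -
    have "B (B x) + B (D x) = B (B x) + D (B x)" using sum[of "B x"] sum[of x] by (simp flip: blinfun.add_right)
    then show ?thesis by simp
  qed
  have Bc: "B (opow D m x) = opow D m (B x)" for m x by (rule opow_commute) (simp add: com)
  have Dc: "D (opow B m x) = opow B m (D x)" for m x by (rule opow_commute) (simp add: com)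
  have DD: "D (opow D m x) = opow D m (D x)" for m x by (rule opow_commute) simp
  have BB: "B (opow B m x) = opow B m (B x)" for m x by (rule opow_commute) simp
  have 11: "0 \<le> x \<bullet> B (D x)" for x
  proof -
    have "x \<bullet> B (D x) = x \<bullet> (B (D (B x)) + B (D (D x)))"
      by (simp flip: blinfun.add_right add: sum)
    also have "\<dots> = B x \<bullet> D (B x) + D x \<bullet> B (D x)"
      using sa_opD(2)[OF B(1)] sa_opD(2)[OF D(1)] com by (simp add: inner_add)
    finally show ?thesis using B(2) D(2) by simp
  qed
  have base: "0 \<le> x \<bullet> opow B j (opow D m x)" if "j \<le> 1" "m \<le> 1" for x j m
    using that B(2)[of x] D(2)[of x] 11[of x] by (cases j; cases m) auto
  have step1: "0 \<le> x \<bullet> opow B j (opow D m x)" if "m \<le> 1" for x j m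
    using that
  proof (induction j arbitrary: x rule: nat_less_induct)
    case (1 j)
    show ?case
    proof (cases "j \<le> 1")
      case False
      then obtain i where j: "j = Suc (Suc i)" by (metis One_nat_def not_less_eq_eq not0_implies_Suc le0)
      have "x \<bullet> opow B j (opow D m x) = B x \<bullet> opow B i (opow D m (B x))"
        by (simp add: j BB Bc sa_opD(2)[OF B(1)])
      then show ?thesis using 1 j by simp
    qed (use base 1 in blast)
  qed
  show ?thesis
  proof (induction m arbitrary: x rule: nat_less_induct)
    case (1 m)
    show ?case
    proof (cases "m \<le> 1")
      case False
      then obtain i where m: "m = Suc (Suc i)" by (metis One_nat_def not_less_eq_eq not0_implies_Suc le0)
      have "x \<bullet> opow B j (opow D m x) = D x \<bullet> opow B j (opow D i (D x))"
        by (simp add: m DD Dc sa_opD(2)[OF D(1)])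
      then show ?thesis using 1 m by simp
    qed (use step1 in blast)
  qed
qed

text \<open>After scaling to \<open>0 \<le> B \<le> 1\<close>, the numbers \<open>x \<bullet> B\<^sup>j (1 - B)\<^sup>m x\<close> solve the Hausdorff recursion.\<close>

lemma moment_measure:
  assumes T: "op_pos T"
  obtains r \<mu> where "0 < r" "\<And>x. finite_measure (\<mu> x)" "\<And>x. sets (\<mu> x) = sets borel"
    "\<And>x. AE t in \<mu> x. t \<in> {0..r}" "\<And>x k. (\<integral>t. t ^ k \<partial>\<mu> x) = x \<bullet> opow T k x"
proof -
  define r where "r = norm T + 1"
  have r: "0 < r" unfolding r_def by (simp add: add_nonneg_pos)
  have sT: "sa_op T" and pT: "\<And>x. 0 \<le> x \<bullet> T x" using T by (auto simp: sa_op_pos_iff)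
  define B where "B = (1 / r) *\<^sub>R T"
  define D where "D = id_blinfun - B"
  have sB: "sa_op B" and sD: "sa_op D" by (auto simp: B_def D_def sT sa_op_scaleR sa_op_diff)
  have pB: "0 \<le> x \<bullet> B x" for x using pT r by (simp add: B_def blinfun.scaleR_left)
  have pD: "0 \<le> x \<bullet> D x" for x
  proof -
    have "x \<bullet> T x \<le> norm x * (norm T * norm x)"
      by (rule order_trans[OF norm_cauchy_schwarz]) (simp add: mult_left_mono norm_blinfun)
    also have "\<dots> \<le> r * (x \<bullet> x)"
      by (simp add: r_def algebra_simps power2_norm_eq_inner[symmetric] power2_eq_square)
    finally show ?thesis
      using r by (simp add: D_def B_def blinfun.diff_left blinfun.scaleR_left inner_diff field_simps)
  qed
  have sum: "B x + D x = x" for x by (simp add: D_def blinfun.diff_left)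
  have "\<exists>M. finite_measure M \<and> sets M = sets borel \<and> (AE t in M. t \<in> {0..r}) \<and>
      (\<forall>k. (\<integral>t. t ^ k \<partial>M) = x \<bullet> opow T k x)" for x
  proof (cases "x = 0")
    case True
    then show ?thesis
      by (intro exI[of _ "null_measure borel"]) (auto intro!: finite_measureI simp: AE_iff_null null_sets_def)
  next
    case False
    define u where "u = (1 / norm x) *\<^sub>R x"
    have xu: "x = norm x *\<^sub>R u" "norm u = 1" using False by (auto simp: u_def)
    define w where "w j m = u \<bullet> opow B j (opow D m u)" for j m
    have "0 \<le> w j m" for j m unfolding w_def by (rule opow_mixed_nonneg[OF sB pB sD pD sum])
    moreover have "w j m = w (Suc j) m + w j (Suc m)" for j m
    proof -
      have "opow B j (opow D m u) = opow B j (B (opow D m u)) + opow B j (D (opow D m u))"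
        by (simp flip: blinfun.add_right add: sum)
      also have "opow B j (B (opow D m u)) = B (opow B j (opow D m u))"
        by (rule opow_commute[symmetric]) simp
      finally have "u \<bullet> opow B j (opow D m u) =
          u \<bullet> (B (opow B j (opow D m u)) + opow B j (D (opow D m u)))" by (rule arg_cong)
      then show ?thesis by (simp add: w_def inner_add)
    qed
    moreover have "w 0 0 = 1" using xu by (simp add: w_def flip: power2_norm_eq_inner)
    ultimately obtain L where L: "real_distribution L" "AE t in L. t \<in> {0..1}" "\<And>k. (\<integral>t. t ^ k \<partial>L) = w k 0"
      using hausdorff_moment[of w] by metis
    interpret real_distribution L by fact
    define c where "c = (norm x)\<^sup>2"
    define M where "M = distr (density L (\<lambda>_. ennreal c)) borel (\<lambda>t. r * t)"
    have c: "0 \<le> c" by (simp add: c_def)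
    have "finite_measure M"
      by (rule finite_measureI)
        (simp add: M_def emeasure_distr emeasure_density emeasure_space_1 ennreal_mult_eq_top_iff nn_integral_cmult_indicator)
    moreover have "sets M = sets borel" by (simp add: M_def)
    moreover have "AE t in M. t \<in> {0..r}"
      unfolding M_def
    proof (subst AE_distr_iff)
      have "AE t in L. r * t \<in> {0..r}" using L(2) by eventually_elim (use r in auto)
      then show "AE t in density L (\<lambda>_. ennreal c). r * t \<in> {0..r}"
        by (subst AE_density) auto
    qed auto
    moreover have "(\<integral>t. t ^ k \<partial>M) = x \<bullet> opow T k x" for k
    proof -
      have "(\<integral>t. t ^ k \<partial>M) = (\<integral>t. c *\<^sub>R (r * t) ^ k \<partial>L)"
        unfolding M_def by (subst integral_distr, simp, simp, subst integral_density) (auto simp: c)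
      also have "\<dots> = c * r ^ k * w k 0" by (simp add: power_mult_distrib L(3) flip: L(3))
      also have "\<dots> = x \<bullet> opow T k x"
      proof -
        have T: "T = r *\<^sub>R B" using r by (simp add: B_def)
        have "x \<bullet> opow T k x = (norm x *\<^sub>R u) \<bullet> opow T k (norm x *\<^sub>R u)"
          by (simp flip: xu(1))
        also have "\<dots> = c * r ^ k * w k 0"
          unfolding T by (simp add: opow_scaleR blinfun.scaleR_left blinfun.scaleR_right c_def w_def power2_eq_square)
        finally show ?thesis by simp
      qed
      finally show ?thesis .
    qed
    ultimately show ?thesis by blast
  qed
  then obtain \<mu> where "\<And>x. finite_measure (\<mu> x)" "\<And>x. sets (\<mu> x) = sets borel"
    "\<And>x. AE t in \<mu> x. t \<in> {0..r}" "\<And>x k. (\<integral>t. t ^ k \<partial>\<mu> x) = x \<bullet> opow T k x"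
      by metis
  with r that show thesis by blast
qed

lemma strong_limit_ex:
  fixes S :: "nat \<Rightarrow> ('a::banach \<Rightarrow>\<^sub>L 'a)"
  assumes C: "\<And>x. Cauchy (\<lambda>n. S n x)" and K: "\<And>n x. norm (S n x) \<le> K * norm x"
  obtains A :: "'a \<Rightarrow>\<^sub>L 'a" where "\<And>x. (\<lambda>n. S n x) \<longlonglongrightarrow> A x"
proof -
  define f where "f x = lim (\<lambda>n. S n x)" for x
  have f: "(\<lambda>n. S n x) \<longlonglongrightarrow> f x" for x
    using C[of x] by (simp add: Cauchy_convergent_iff convergent_LIMSEQ_iff f_def)
  have "bounded_linear f"
  proof (rule bounded_linear_intro[where K=K])
    show "f (x + y) = f x + f y" for x y
      using tendsto_add[OF f[of x] f[of y]] f[of "x + y"] by (auto simp: blinfun.add_right intro: LIMSEQ_unique)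
    show "f (r *\<^sub>R x) = r *\<^sub>R f x" for r x
      using tendsto_scaleR[OF tendsto_const f[of x]] f[of "r *\<^sub>R x"]
      by (auto simp: blinfun.scaleR_right intro: LIMSEQ_unique)
    show "norm (f x) \<le> norm x * K" for x
      using K by (intro LIMSEQ_le_const2[OF tendsto_norm[OF f]]) (auto simp: mult.commute)
  qed
  then show thesis using that[of "Blinfun f"] f by (simp add: bounded_linear_Blinfun_apply)
qed

lemma sa_op_idempotentI:
  fixes P :: "'h::complex_hilbert \<Rightarrow>\<^sub>L 'h"
  assumes "sa_op P" "\<And>x. P x \<bullet> P x = x \<bullet> P x" shows "P o\<^sub>L P = P"
  by (rule sa_op_eqI[OF sa_op_compose[OF assms(1) assms(1) refl] assms(1)])
    (simp add: assms(2) flip: sa_opD(2)[OF assms(1), of _ "P _"])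

lemma sa_op_projD:
  fixes P :: "'h::complex_hilbert \<Rightarrow>\<^sub>L 'h"
  assumes "sa_op P" "P o\<^sub>L P = P" shows "P (P x) = P x" "P x \<bullet> P x = x \<bullet> P x"
proof -
  show "P (P x) = P x" for x using assms(2) by (simp add: blinfun_eqI_iff)
  then show "P x \<bullet> P x = x \<bullet> P x" using assms(1) by (simp add: sa_opD(2))
qed

lemma proj_norm_le:
  fixes P :: "'h::complex_hilbert \<Rightarrow>\<^sub>L 'h"
  shows "sa_op P \<Longrightarrow> P o\<^sub>L P = P \<Longrightarrow> x \<bullet> P x \<le> x \<bullet> x"
  "sa_op P \<Longrightarrow> P o\<^sub>L P = P \<Longrightarrow> norm (P x) \<le> norm x"
proof -
  assume P: "sa_op P" "P o\<^sub>L P = P"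
  have "norm (P x) * norm (P x) \<le> norm x * norm (P x)"
    using norm_cauchy_schwarz[of x "P x"] sa_op_projD(2)[OF P, of x]
    by (simp flip: power2_norm_eq_inner power2_eq_square)
  then show "norm (P x) \<le> norm x" by (metis mult_right_le_imp_le norm_ge_zero not_less_iff_gr_or_eq order_le_less)
  then have "(norm (P x))\<^sup>2 \<le> (norm x)\<^sup>2" by (simp add: power_mono)
  then show "x \<bullet> P x \<le> x \<bullet> x" using sa_op_projD(2)[OF P, of x] by (simp add: power2_norm_eq_inner)
qed

lemma proj_orthogonal:
  fixes P :: "'h::complex_hilbert \<Rightarrow>\<^sub>L 'h"
  assumes P: "sa_op P" "P o\<^sub>L P = P" and Q: "sa_op Q" "Q o\<^sub>L Q = Q"
    and le: "\<And>x. x \<bullet> P x + x \<bullet> Q x \<le> x \<bullet> x"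
  shows "Q (P x) = 0"
proof -
  have "Q (P x) \<bullet> Q (P x) \<le> 0"
    using le[of "P x"] sa_op_projD[OF P] sa_op_projD(2)[OF Q, of "P x"] by simp
  then show ?thesis by (metis inner_eq_zero_iff inner_ge_zero order_antisym)
qed

lemma proj_add:
  fixes P :: "'h::complex_hilbert \<Rightarrow>\<^sub>L 'h"
  assumes P: "sa_op P" "P o\<^sub>L P = P" and Q: "sa_op Q" "Q o\<^sub>L Q = Q"
    and le: "\<And>x. x \<bullet> P x + x \<bullet> Q x \<le> x \<bullet> x"
  shows "sa_op (P + Q)" "(P + Q) o\<^sub>L (P + Q) = P + Q"
proof -
  show "sa_op (P + Q)" using P Q by (intro sa_op_add)
  have "Q (P x) = 0" "P (Q x) = 0" for x
    using proj_orthogonal[OF P Q le] proj_orthogonal[OF Q P] le by (auto simp: add.commute)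
  then show "(P + Q) o\<^sub>L (P + Q) = P + Q"
    by (intro blinfun_eqI) (simp add: blinfun.add_left blinfun.add_right sa_op_projD(1)[OF P] sa_op_projD(1)[OF Q])
qed

context
  fixes T :: "'h::complex_hilbert \<Rightarrow>\<^sub>L 'h" and r :: real and \<mu> :: "'h \<Rightarrow> real measure"
  assumes T: "sa_op T" and r: "0 < r" and fin: "\<And>x. finite_measure (\<mu> x)" and sets: "\<And>x. sets (\<mu> x) = sets borel"
    and AE_r: "\<And>x. AE t in \<mu> x. t \<in> {0..r}" and moment: "\<And>x k. (\<integral>t. t ^ k \<partial>\<mu> x) = x \<bullet> opow T k x"
begin

definition is_proj :: "real set \<Rightarrow> ('h \<Rightarrow>\<^sub>L 'h) \<Rightarrow> bool" where
  "is_proj B P \<longleftrightarrow> sa_op P \<and> P o\<^sub>L P = P \<and> P \<in> commutant (commutant {T}) \<and> (\<forall>x. x \<bullet> P x = measure (\<mu> x) B)"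

lemma AE_r': "AE t in \<mu> x. t \<in> {-r..r}"
  using AE_r[of x] by eventually_elim (use r in auto)

lemma total_mass: "measure (\<mu> x) UNIV = x \<bullet> x"
proof -
  interpret finite_measure "\<mu> x" by (rule fin)
  have "space (\<mu> x) = UNIV" using sets_eq_imp_space_eq[OF sets] by simp
  then show ?thesis using moment[of x 0] by simp
qed

lemma is_proj_unique: "is_proj B P \<Longrightarrow> is_proj B Q \<Longrightarrow> P = Q"
  by (auto simp: is_proj_def intro: sa_op_eqI)

lemma is_proj_half_line: "\<exists>P. is_proj {a<..} P"
proof -
  obtain g where g: "\<And>n. real_polynomial_function (g n)" "\<And>n t. t \<in> {-r..r} \<Longrightarrow> \<bar>g n t\<bar> \<le> 2"
    "\<And>t. t \<in> {-r..r} \<Longrightarrow> (\<lambda>n. g n t) \<longlonglongrightarrow> indicator {a<..} t"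
    by (rule polynomial_approx_half_line[where a=a and r=r]) blast
  define f :: "real \<Rightarrow> real" where "f = indicator {a<..}"
  obtain c d where gc: "\<And>n. g n = (\<lambda>t. \<Sum>i\<le>d n. c n i * t ^ i)"
    using g(1) unfolding real_polynomial_function_iff_sum by metis
  define S where "S n = (\<Sum>i\<le>d n. c n i *\<^sub>R opow T i)" for n
  have S_apply: "S n x = (\<Sum>i\<le>d n. c n i *\<^sub>R opow T i x)" for n x
    by (simp add: S_def blinfun.sum_left blinfun.scaleR_left)
  have sa: "sa_op (S n)" for n
  proof -
    have "sa_op (\<Sum>i\<in>I. c n i *\<^sub>R opow T i)" if "finite I" for I
      using that by induction (auto intro!: sa_op_add sa_op_scaleR sa_op_opow T)
    then show ?thesis by (simp add: S_def)
  qed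
  have TW: "T \<in> commutant (commutant {T})"
    using bicommutant_superset[of "{T}"] T by (auto simp: sa_op_def)
  have SW: "S n \<in> commutant (commutant {T})" for n
  proof -
    have "(\<Sum>i\<in>I. c n i *\<^sub>R opow T i) \<in> commutant (commutant {T})" if "finite I" for I
      using that by induction (auto intro!: commutant_closed opow_in_commutant[OF TW])
    then show ?thesis by (simp add: S_def)
  qed
  have int_pow: "integrable (\<mu> x) (\<lambda>t. t ^ k)" for x k
    by (rule integrable_power_AE[OF fin sets AE_r'])
  have g_meas [measurable]: "g n \<in> borel_measurable borel" for n
    by (rule borel_measurable_real_polynomial_function[OF g(1)])
  have f_meas [measurable]: "f \<in> borel_measurable borel" by (simp add: f_def)
  have meas_mu: "h \<in> borel_measurable borel \<Longrightarrow> h \<in> borel_measurable (\<mu> x)" for h :: "real \<Rightarrow> real" and x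
    using sets by (simp cong: measurable_cong_sets)
  have f01: "0 \<le> f t" "f t \<le> 1" for t by (auto simp: f_def)
  have form: "x \<bullet> S n x = (\<integral>t. g n t \<partial>\<mu> x)" for n x
    by (simp add: S_apply inner_sum_right gc int_pow moment)
  have S_inner: "S m x \<bullet> S n x = (\<integral>t. g m t * g n t \<partial>\<mu> x)" for m n x
  proof -
    have "S m x \<bullet> S n x = (\<Sum>i\<le>d m. \<Sum>j\<le>d n. c m i * (c n j * (opow T i x \<bullet> opow T j x)))"
      by (simp add: S_apply inner_sum_left inner_sum_right sum_distrib_left)
        (subst sum.swap, simp add: mult.left_commute)
    also have "\<dots> = (\<Sum>i\<le>d m. \<Sum>j\<le>d n. c m i * (c n j * (\<integral>t. t ^ (i + j) \<partial>\<mu> x)))"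
      by (simp add: moment opow_add sa_opD(2)[OF sa_op_opow[OF T]])
    also have "\<dots> = (\<integral>t. (\<Sum>i\<le>d m. \<Sum>j\<le>d n. c m i * (c n j * t ^ (i + j))) \<partial>\<mu> x)"
      by (simp add: int_pow)
    also have "\<dots> = (\<integral>t. g m t * g n t \<partial>\<mu> x)"
      by (simp add: gc sum_product power_add mult_ac)
    finally show ?thesis .
  qed
  define e where "e x n = (\<integral>t. (g n t - f t)\<^sup>2 \<partial>\<mu> x)" for x n
  have bnd: "\<bar>g n t - f t\<bar> \<le> 3" if "t \<in> {-r..r}" for n t
    using g(2)[OF that, of n] f01[of t] by linarith
  have dom: "(\<lambda>n. \<integral>t. h n t \<partial>\<mu> x) \<longlonglongrightarrow> (\<integral>t. h' t \<partial>\<mu> x)"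
    if [measurable]: "\<And>n. h n \<in> borel_measurable borel" "h' \<in> borel_measurable borel"
      and h: "\<And>n t. t \<in> {-r..r} \<Longrightarrow> \<bar>h n t\<bar> \<le> K" "\<And>t. t \<in> {-r..r} \<Longrightarrow> (\<lambda>n. h n t) \<longlonglongrightarrow> h' t"
    for h :: "nat \<Rightarrow> real \<Rightarrow> real" and h' K x
  proof (rule integral_dominated_convergence[where w="\<lambda>_. K"])
    interpret finite_measure "\<mu> x" by (rule fin)
    show "AE t in \<mu> x. (\<lambda>n. h n t) \<longlonglongrightarrow> h' t"
      using AE_r' by eventually_elim (rule h(2))
    show "AE t in \<mu> x. norm (h n t) \<le> K" for n using AE_r' by eventually_elim (simp add: h(1))
    show "integrable (\<mu> x) (\<lambda>_. K)" by simp
  qed (auto intro!: meas_mu)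
  have e: "(\<lambda>n. e x n) \<longlonglongrightarrow> 0" for x
  proof -
    have "(\<lambda>n. e x n) \<longlonglongrightarrow> (\<integral>t. 0 \<partial>\<mu> x)"
      unfolding e_def
    proof (rule dom)
      show "\<bar>(g n t - f t)\<^sup>2\<bar> \<le> 3\<^sup>2" if "t \<in> {-r..r}" for n t
        using power_mono[OF bnd[OF that, of n], of 2] by simp
      show "(\<lambda>n. (g n t - f t)\<^sup>2) \<longlonglongrightarrow> 0" if "t \<in> {-r..r}" for t
        using tendsto_power[OF tendsto_diff[OF g(3)[OF that] tendsto_const[of "f t"]], of 2] by (simp add: f_def)
    qed auto
    then show ?thesis by simp
  qed
  have int_b: "integrable (\<mu> x) h" if "h \<in> borel_measurable borel" "\<And>t. t \<in> {-r..r} \<Longrightarrow> \<bar>h t\<bar> \<le> K"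
    for h :: "real \<Rightarrow> real" and K x
    by (rule integrable_bounded_AE[where K=K, OF fin sets AE_r' that(1)]) (rule that(2))
  have diff: "(norm (S m x - S n x))\<^sup>2 \<le> 2 * e x m + 2 * e x n" for m n x
  proof -
    have i2: "integrable (\<mu> x) (\<lambda>t. g m t * g n t)" for m n
    proof (rule int_b)
      show "\<bar>g m t * g n t\<bar> \<le> 2 * 2" if "t \<in> {-r..r}" for t
        using g(2)[OF that] unfolding abs_mult by (intro mult_mono) auto
    qed simp
    have ie: "integrable (\<mu> x) (\<lambda>t. (g n t - f t)\<^sup>2)" for n
    proof (rule int_b)
      show "\<bar>(g n t - f t)\<^sup>2\<bar> \<le> 3\<^sup>2" if "t \<in> {-r..r}" for t
        using power_mono[OF bnd[OF that, of n], of 2] by simp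
    qed simp
    have "(norm (S m x - S n x))\<^sup>2 = S m x \<bullet> S m x - 2 * (S m x \<bullet> S n x) + S n x \<bullet> S n x"
      by (simp add: power2_norm_eq_inner inner_diff inner_commute)
    also have "\<dots> = (\<integral>t. g m t * g m t - 2 * (g m t * g n t) + g n t * g n t \<partial>\<mu> x)"
      by (simp add: S_inner i2)
    also have "\<dots> \<le> (\<integral>t. 2 * (g m t - f t)\<^sup>2 + 2 * (g n t - f t)\<^sup>2 \<partial>\<mu> x)"
    proof (rule integral_mono)
      fix t
      have "0 \<le> ((g m t - f t) + (g n t - f t))\<^sup>2" by simp
      then show "g m t * g m t - 2 * (g m t * g n t) + g n t * g n t \<le> 2 * (g m t - f t)\<^sup>2 + 2 * (g n t - f t)\<^sup>2"
        by (simp add: power2_eq_square algebra_simps)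
    qed (simp_all add: i2 ie)
    finally show ?thesis by (simp add: e_def ie)
  qed
  have bound: "norm (S n x) \<le> 2 * norm x" for n x
  proof -
    have "(norm (S n x))\<^sup>2 = (\<integral>t. g n t * g n t \<partial>\<mu> x)"
      by (simp add: power2_norm_eq_inner S_inner)
    also have "\<dots> \<le> (\<integral>t. 4 \<partial>\<mu> x)"
    proof (rule integral_mono_AE)
      have *: "\<bar>g n t * g n t\<bar> \<le> 4" if "t \<in> {-r..r}" for t
        using g(2)[OF that, of n] mult_mono[of "\<bar>g n t\<bar>" 2 "\<bar>g n t\<bar>" 2] unfolding abs_mult by simp
      show "integrable (\<mu> x) (\<lambda>t. g n t * g n t)" by (rule int_b[OF _ *]) auto
      show "AE t in \<mu> x. g n t * g n t \<le> 4"
        using AE_r' by eventually_elim (use * in \<open>simp add: abs_le_iff\<close>)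
      interpret finite_measure "\<mu> x" by (rule fin)
      show "integrable (\<mu> x) (\<lambda>_. 4)" by simp
    qed
    also have "\<dots> = (2 * norm x)\<^sup>2"
      using moment[of x 0] by (simp add: power_mult_distrib power2_norm_eq_inner)
    finally show ?thesis by (rule power2_le_imp_le) simp
  qed
  obtain P :: "'h \<Rightarrow>\<^sub>L 'h" where P: "\<And>x. (\<lambda>n. S n x) \<longlonglongrightarrow> P x"
    by (rule strong_limit_ex[of S 2]) (use Cauchy_square_bound[OF diff e] bound in auto)
  have Pf: "x \<bullet> P x = (\<integral>t. f t \<partial>\<mu> x)" for x
  proof -
    have "(\<lambda>n. x \<bullet> S n x) \<longlonglongrightarrow> x \<bullet> P x" by (intro tendsto_intros P)
    moreover have "(\<lambda>n. x \<bullet> S n x) \<longlonglongrightarrow> (\<integral>t. f t \<partial>\<mu> x)"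
      unfolding form by (rule dom[OF _ _ g(2)]) (use g(3) in \<open>auto simp: f_def\<close>)
    ultimately show ?thesis by (rule LIMSEQ_unique)
  qed
  have P2: "P x \<bullet> P x = (\<integral>t. f t * f t \<partial>\<mu> x)" for x
  proof -
    have "(\<lambda>n. S n x \<bullet> S n x) \<longlonglongrightarrow> P x \<bullet> P x" by (intro tendsto_intros P)
    moreover have "(\<lambda>n. S n x \<bullet> S n x) \<longlonglongrightarrow> (\<integral>t. f t * f t \<partial>\<mu> x)"
      unfolding S_inner
    proof (rule dom)
      show "\<bar>g n t * g n t\<bar> \<le> 2 * 2" if "t \<in> {-r..r}" for n t
        using g(2)[OF that] unfolding abs_mult by (intro mult_mono) auto
      show "(\<lambda>n. g n t * g n t) \<longlonglongrightarrow> f t * f t" if "t \<in> {-r..r}" for t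
        unfolding f_def using g(3)[OF that] by (intro tendsto_mult)
    qed auto
    ultimately show ?thesis by (rule LIMSEQ_unique)
  qed
  have saP: "sa_op P" by (rule sa_op_strong_limit[OF sa P])
  have ff: "f t * f t = f t" for t by (simp add: f_def indicator_def)
  have "P o\<^sub>L P = P" by (rule sa_op_idempotentI[OF saP]) (simp add: P2 Pf ff)
  moreover have "P \<in> commutant (commutant {T})" by (rule commutant_strong_limit[OF SW P])
  moreover have "x \<bullet> P x = measure (\<mu> x) {a<..}" for x
    using Pf[of x] sets by (simp add: f_def)
  ultimately show ?thesis using saP by (auto simp: is_proj_def)
qed

lemma is_proj_disjoint_Un:
  assumes "is_proj B P" "is_proj C Q" "B \<inter> C = {}" "B \<in> sets borel" "C \<in> sets borel"
  shows "is_proj (B \<union> C) (P + Q)"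
proof -
  have m: "measure (\<mu> x) (B \<union> C) = x \<bullet> P x + x \<bullet> Q x" for x
  proof -
    interpret finite_measure "\<mu> x" by (rule fin)
    show ?thesis using assms finite_measure_Union[of B C] by (simp add: is_proj_def sets)
  qed
  have "measure (\<mu> x) (B \<union> C) \<le> x \<bullet> x" for x
  proof -
    interpret finite_measure "\<mu> x" by (rule fin)
    have "measure (\<mu> x) (B \<union> C) \<le> measure (\<mu> x) UNIV"
      using assms sets by (intro finite_measure_mono) auto
    then show ?thesis by (simp add: total_mass)
  qed
  then have "x \<bullet> P x + x \<bullet> Q x \<le> x \<bullet> x" for x by (simp add: m)
  then show ?thesis
    using assms proj_add[of P Q] m
    by (auto simp: is_proj_def inner_add blinfun.add_left intro: commutant_closed)
qed

lemma is_proj_empty: "is_proj {} 0"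
  by (auto simp: is_proj_def commutant_closed intro: blinfun_eqI)

lemma is_proj_Compl:
  assumes "is_proj B P" "B \<in> sets borel" shows "is_proj (UNIV - B) (id_blinfun - P)"
proof -
  have "measure (\<mu> x) (UNIV - B) = x \<bullet> x - x \<bullet> P x" for x
  proof -
    interpret finite_measure "\<mu> x" by (rule fin)
    have "space (\<mu> x) = UNIV" using sets_eq_imp_space_eq[OF sets] by simp
    then show ?thesis using finite_measure_compl[of B] assms total_mass[of x] by (simp add: is_proj_def sets)
  qed
  moreover have "(id_blinfun - P) o\<^sub>L (id_blinfun - P) = id_blinfun - P"
    using assms sa_op_projD(1)[of P] by (intro blinfun_eqI) (simp add: is_proj_def blinfun.diff_left blinfun.diff_right)
  ultimately show ?thesis using assms
    by (auto simp: is_proj_def inner_diff blinfun.diff_left sa_op_diff commutant_closed)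
qed

lemma is_proj_UN:
  fixes B :: "nat \<Rightarrow> real set"
  assumes B: "range B \<subseteq> sets borel" "disjoint_family B" and P: "\<And>i. is_proj (B i) (P i)"
  obtains Q where "is_proj (\<Union>i. B i) Q" "\<And>x. (\<lambda>i. P i x) sums Q x"
proof -
  have fin_UN: "is_proj (\<Union>i\<in>I. B i) (\<Sum>i\<in>I. P i)" if "finite I" for I
    using that
  proof induction
    case (insert i I)
    have "is_proj (B i \<union> (\<Union>i\<in>I. B i)) (P i + (\<Sum>i\<in>I. P i))"
    proof (rule is_proj_disjoint_Un[OF P insert.IH])
      have "B i \<inter> B j = {}" if "j \<in> I" for j
        using that insert.hyps by (intro disjoint_family_onD[OF B(2)]) auto
      then show "B i \<inter> (\<Union>i\<in>I. B i) = {}" by auto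
    qed (use B(1) insert.hyps in auto)
    then show ?case using insert.hyps by simp
  qed (simp add: is_proj_empty)
  define S where "S n = (\<Sum>i<n. P i)" for n
  define s where "s x n = (\<Sum>i<n. measure (\<mu> x) (B i))" for x n
  have meas_sum: "measure (\<mu> x) (\<Union>i\<in>I. B i) = (\<Sum>i\<in>I. measure (\<mu> x) (B i))" if "finite I" for I x
  proof -
    interpret finite_measure "\<mu> x" by (rule fin)
    show ?thesis using B that
      by (intro finite_measure_finite_Union) (auto simp: sets disjoint_family_on_def)
  qed
  have s_lim: "s x \<longlonglongrightarrow> measure (\<mu> x) (\<Union>i. B i)" for x
  proof -
    interpret finite_measure "\<mu> x" by (rule fin)
    show ?thesis using finite_measure_UNION[of B] B by (simp add: sets sums_def s_def[abs_def])
  qed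
  have pS: "is_proj (\<Union>i<n. B i) (S n)" for n unfolding S_def by (rule fin_UN) simp
  have S_norm: "(norm (S m x - S n x))\<^sup>2 = s x m - s x n" if "n \<le> m" for m n x
  proof -
    have "S m = S n + (\<Sum>i\<in>{n..<m}. P i)" and s: "s x m = s x n + (\<Sum>i\<in>{n..<m}. measure (\<mu> x) (B i))"
      using that unfolding S_def s_def lessThan_atLeast0 by (simp_all add: sum.atLeastLessThan_concat)
    then have d: "S m x - S n x = (\<Sum>i\<in>{n..<m}. P i) x" by (simp add: blinfun.add_left)
    have "is_proj (\<Union>i\<in>{n..<m}. B i) (\<Sum>i\<in>{n..<m}. P i)" by (rule fin_UN) simp
    then have "(norm (S m x - S n x))\<^sup>2 = measure (\<mu> x) (\<Union>i\<in>{n..<m}. B i)"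
      unfolding d power2_norm_eq_inner by (simp add: is_proj_def sa_op_projD(2))
    then show ?thesis using s by (simp add: meas_sum)
  qed
  have abs: "a - b \<le> 2 * \<bar>a - c\<bar> + 2 * \<bar>b - c\<bar>" for a b c :: real
    by (auto simp: abs_if)
  have "Cauchy (\<lambda>n. S n x)" for x
  proof (rule Cauchy_square_bound)
    let ?e = "\<lambda>n. \<bar>s x n - measure (\<mu> x) (\<Union>i. B i)\<bar>"
    show "?e \<longlonglongrightarrow> 0" using s_lim[of x] by (intro tendsto_rabs_zero LIM_zero)
    show "(norm (S m x - S n x))\<^sup>2 \<le> 2 * ?e m + 2 * ?e n" for m n
    proof (cases "n \<le> m")
      case True
      show ?thesis unfolding S_norm[OF True] by (rule abs)
    next
      case False
      then have "m \<le> n" by simp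
      show ?thesis unfolding norm_minus_commute[of "S m x"] S_norm[OF \<open>m \<le> n\<close>]
        by (subst add.commute) (rule abs)
    qed
  qed
  moreover have Sn: "norm (S n x) \<le> 1 * norm x" for n x
    using pS[of n] proj_norm_le(2)[of "S n" x] by (simp add: is_proj_def)
  ultimately obtain Q :: "'h \<Rightarrow>\<^sub>L 'h" where Q: "\<And>x. (\<lambda>n. S n x) \<longlonglongrightarrow> Q x"
    using strong_limit_ex[of S 1] by metis
  have saQ: "sa_op Q" using pS by (intro sa_op_strong_limit[OF _ Q]) (simp add: is_proj_def)
  have "Q \<in> commutant (commutant {T})" using pS by (intro commutant_strong_limit[OF _ Q]) (simp add: is_proj_def)
  have l1: "(\<lambda>n. x \<bullet> S n x) \<longlonglongrightarrow> x \<bullet> Q x" and l2: "(\<lambda>n. S n x \<bullet> S n x) \<longlonglongrightarrow> Q x \<bullet> Q x" for x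
    by (intro tendsto_intros Q)+
  have "x \<bullet> S n x = s x n" "S n x \<bullet> S n x = s x n" for x n
    using pS[of n] by (auto simp: is_proj_def meas_sum s_def sa_op_projD(2))
  then have *: "x \<bullet> Q x = measure (\<mu> x) (\<Union>i. B i)" "Q x \<bullet> Q x = measure (\<mu> x) (\<Union>i. B i)" for x
    using l1[of x] l2[of x] s_lim[of x] by (auto intro: LIMSEQ_unique)
  have "is_proj (\<Union>i. B i) Q"
    using saQ \<open>Q \<in> _\<close> * sa_op_idempotentI[OF saQ] by (simp add: is_proj_def)
  moreover have "(\<lambda>i. P i x) sums Q x" for x
    using Q[of x] by (simp add: sums_def S_def blinfun.sum_left)
  ultimately show thesis by (rule that)
qed

lemma is_proj_ex:
  assumes "B \<in> sets borel" shows "\<exists>P. is_proj B P"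
proof -
  have B: "B \<in> sigma_sets UNIV (range greaterThan)" using assms by (simp add: borel_Ioi)
  have Int: "Int_stable (range greaterThan :: real set set)"
  proof (rule Int_stableI)
    fix A B :: "real set" assume "A \<in> range greaterThan" "B \<in> range greaterThan"
    then obtain a b where "A = {a<..}" "B = {b<..}" by auto
    then have "A \<inter> B = {max a b<..}" by auto
    then show "A \<inter> B \<in> range greaterThan" by simp
  qed
  have borelI: "A \<in> sets borel" if "A \<in> sigma_sets UNIV (range greaterThan :: real set set)" for A
    using that by (simp add: borel_Ioi)
  have sub: "range greaterThan \<subseteq> Pow (UNIV :: real set)" by simp
  show ?thesis
    using Int sub B
  proof (induction rule: sigma_sets_induct_disjoint)
    case (basic A)
    then show ?case using is_proj_half_line by auto
  next
    case empty
    then show ?case using is_proj_empty by blast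
  next
    case (compl A)
    then show ?case using is_proj_Compl borelI by blast
  next
    case (union A)
    then obtain P where "\<And>i. is_proj (A i) (P i)" by metis
    moreover have "range A \<subseteq> sets borel" using union borelI by blast
    ultimately show ?case using is_proj_UN union by metis
  qed
qed

end

section \<open>Integration with respect to a projection-valued measure\<close>

lemma pvm_proj:
  assumes "pvm E" "B \<in> sets borel"
  shows "sa_op (E B)" "E B o\<^sub>L E B = E B"
  using assms by (auto simp: pvm_def sa_op_iff_adj)

lemma pvm_UNIV: "pvm E \<Longrightarrow> E UNIV = id_blinfun"
  by (simp add: pvm_def)

lemma pvm_sums:
  "pvm E \<Longrightarrow> range B \<subseteq> sets borel \<Longrightarrow> disjoint_family B \<Longrightarrow> (\<lambda>n. E (B n) x) sums E (\<Union>n::nat. B n) x"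
  by (simp add: pvm_def)

lemma pvm_empty: assumes "pvm E" shows "E {} = 0"
proof (rule blinfun_eqI)
  fix x
  have "(\<lambda>n::nat. E {} x) sums E {} x"
    using pvm_sums[OF assms, of "\<lambda>_. {}" x] by (simp add: disjoint_family_on_def)
  then have "summable (\<lambda>n::nat. E {} x)" by (simp add: sums_iff)
  then have "(\<lambda>n::nat. E {} x) \<longlonglongrightarrow> 0" by (rule summable_LIMSEQ_zero)
  then show "E {} x = blinfun_apply 0 x" by (simp add: LIMSEQ_const_iff)
qed

lemma pvm_Un:
  assumes "pvm E" "B \<in> sets borel" "C \<in> sets borel" "B \<inter> C = {}"
  shows "E (B \<union> C) x = E B x + E C x"
proof -
  have "(\<lambda>n. E (binaryset B C n) x) sums E (\<Union>n. binaryset B C n) x"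
    using assms by (intro pvm_sums) (auto simp: range_binaryset_eq disjoint_family_on_def binaryset_def)
  moreover have "(\<lambda>n. E (binaryset B C n) x) sums (E B x + E C x)"
    using sums_finite[of "{0, 1}" "\<lambda>n. E (binaryset B C n) x"] pvm_empty[OF assms(1)]
    by (simp add: binaryset_def)
  ultimately show ?thesis by (simp add: UN_binaryset_eq sums_unique2)
qed

lemma pvm_disjoint:
  assumes E: "pvm E" "B \<in> sets borel" "C \<in> sets borel" "B \<inter> C = {}"
  shows "E B (E C x) = 0"
proof (rule proj_orthogonal[OF pvm_proj[OF E(1,3)] pvm_proj[OF E(1,2)]])
  fix x
  have "x \<bullet> E (B \<union> C) x \<le> x \<bullet> x" using E by (intro proj_norm_le pvm_proj) auto
  then show "x \<bullet> E C x + x \<bullet> E B x \<le> x \<bullet> x" by (simp add: pvm_Un[OF E] inner_add)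
qed

lemma pvm_Int:
  assumes E: "pvm E" "B \<in> sets borel" "C \<in> sets borel"
  shows "E B (E C x) = E (B \<inter> C) x"
proof -
  have split: "E A y = E (A \<inter> D) y + E (A - D) y" if "A \<in> sets borel" "D \<in> sets borel" for A D y
  proof -
    have "E ((A \<inter> D) \<union> (A - D)) y = E (A \<inter> D) y + E (A - D) y"
      using that by (intro pvm_Un E) auto
    then show ?thesis by (simp add: Int_Diff_Un)
  qed
  have "E B (E C x) = E (B \<inter> C) (E (C \<inter> B) x) + E (B \<inter> C) (E (C - B) x)
      + (E (B - C) (E (C \<inter> B) x) + E (B - C) (E (C - B) x))"
    using split[of B C] split[of C B] E by (simp add: blinfun.add_right)
  also have "\<dots> = E (B \<inter> C) (E (B \<inter> C) x)"
  proof -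
    have "E (B \<inter> C) (E (C - B) x) = 0" "E (B - C) (E (C \<inter> B) x) = 0" "E (B - C) (E (C - B) x) = 0"
      using E by (auto intro!: pvm_disjoint)
    then show ?thesis by (simp add: Int_commute)
  qed
  also have "\<dots> = E (B \<inter> C) x" using E by (intro sa_op_projD(1) pvm_proj) auto
  finally show ?thesis .
qed

lemma pvm_nonneg: assumes "pvm E" "B \<in> sets borel" shows "0 \<le> x \<bullet> E B x"
  using sa_op_projD(2)[OF pvm_proj[OF assms], of x, symmetric] by simp

lemma sets_scalar_measure [simp, measurable_cong]: "sets (scalar_measure E x) = sets borel"
  using sets.sigma_sets_eq[of "borel :: real measure"] by (simp add: scalar_measure_def)

lemma space_scalar_measure [simp]: "space (scalar_measure E x) = UNIV"
  by (simp add: scalar_measure_def)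

lemma emeasure_scalar_measure:
  assumes E: "pvm E" and B: "B \<in> sets borel"
  shows "emeasure (scalar_measure E x) B = ennreal (x \<bullet> E B x)"
proof -
  have eq: "Re (cinner x (E B x)) = x \<bullet> E B x" for B by (simp add: inner_cinner)
  show ?thesis
    unfolding scalar_measure_def eq
  proof (rule emeasure_measure_of_sigma)
    show "sigma_algebra UNIV (sets (borel :: real measure))"
      using sets.sigma_algebra_axioms[of "borel :: real measure"] by simp
    show "positive (sets borel) (\<lambda>B. ennreal (x \<bullet> E B x))"
      by (simp add: positive_def pvm_empty[OF E])
    show "countably_additive (sets borel) (\<lambda>B. ennreal (x \<bullet> E B x))"
    proof (rule countably_additiveI)
      fix B :: "nat \<Rightarrow> real set"
      assume B: "range B \<subseteq> sets borel" "disjoint_family B"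
      have "(\<lambda>n. x \<bullet> E (B n) x) sums (x \<bullet> E (\<Union>n. B n) x)"
        by (intro bounded_linear.sums[OF bounded_linear_inner_right] pvm_sums E B)
      then show "(\<Sum>i. ennreal (x \<bullet> E (B i) x)) = ennreal (x \<bullet> E (\<Union>i. B i) x)"
        using B by (intro suminf_ennreal_eq pvm_nonneg[OF E]) auto
    qed
  qed (rule B)
qed

lemma finite_scalar_measure: "pvm E \<Longrightarrow> finite_measure (scalar_measure E x)"
  by (rule finite_measureI) (simp add: emeasure_scalar_measure)

lemma measure_scalar_measure:
  "pvm E \<Longrightarrow> B \<in> sets borel \<Longrightarrow> measure (scalar_measure E x) B = x \<bullet> E B x"
  by (simp add: measure_def emeasure_scalar_measure pvm_nonneg)

lemma integrable_scalar_measure: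
  fixes f :: "real \<Rightarrow> real"
  assumes "pvm E" "f \<in> borel_measurable borel" "\<And>t. \<bar>f t\<bar> \<le> K"
  shows "integrable (scalar_measure E x) f"
proof -
  interpret finite_measure "scalar_measure E x" using assms(1) by (rule finite_scalar_measure)
  show ?thesis using assms(2,3) by (intro integrable_const_bound[of f K]) auto
qed

lemma AE_scalar_measure:
  assumes E: "pvm E" "E B = id_blinfun" "B \<in> sets borel"
  shows "AE t in scalar_measure E x. t \<in> B"
proof -
  interpret finite_measure "scalar_measure E x" using E(1) by (rule finite_scalar_measure)
  have "measure (scalar_measure E x) (UNIV - B) = 0"
    using finite_measure_compl[of B] E by (simp add: measure_scalar_measure pvm_UNIV)
  then have "UNIV - B \<in> null_sets (scalar_measure E x)"
    using E(3) by (auto simp: null_sets_def emeasure_eq_measure)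
  from AE_not_in[OF this] show ?thesis by eventually_elim auto
qed

lemma integral_uniform_limit:
  fixes f :: "'a \<Rightarrow> real"
  assumes M: "finite_measure M" and F: "\<And>n. integrable M (F n)" and f: "integrable M f"
    and lim: "uniform_limit UNIV F f sequentially"
  shows "(\<lambda>n. \<integral>t. F n t \<partial>M) \<longlonglongrightarrow> (\<integral>t. f t \<partial>M)"
proof (rule LIMSEQ_I)
  interpret finite_measure M by (rule M)
  fix e :: real assume e: "0 < e"
  define d where "d = e / (measure M (space M) + 1)"
  have pos: "0 < measure M (space M) + 1" by (simp add: add_nonneg_pos)
  then have "0 < d" using e by (simp add: d_def)
  then obtain N where N: "\<And>n t. n \<ge> N \<Longrightarrow> \<bar>F n t - f t\<bar> < d"
    using uniform_limitD[OF lim] unfolding eventually_sequentially dist_real_def by blast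
  have "norm ((\<integral>t. F n t \<partial>M) - (\<integral>t. f t \<partial>M)) < e" if "n \<ge> N" for n
  proof -
    have "norm ((\<integral>t. F n t \<partial>M) - (\<integral>t. f t \<partial>M)) = norm (\<integral>t. F n t - f t \<partial>M)"
      by (simp add: F f)
    also have "\<dots> \<le> (\<integral>t. norm (F n t - f t) \<partial>M)" by (rule integral_norm_bound)
    also have "\<dots> \<le> (\<integral>t. d \<partial>M)"
      using N[OF that] F f by (intro integral_mono) (auto intro: less_imp_le)
    also have "\<dots> = d * measure M (space M)" by simp
    also have "\<dots> < d * (measure M (space M) + 1)" using \<open>0 < d\<close> by simp
    also have "\<dots> = e" using pos by (simp add: d_def)
    finally show ?thesis .
  qed
  then show "\<exists>N. \<forall>n\<ge>N. norm ((\<integral>t. F n t \<partial>M) - (\<integral>t. f t \<partial>M)) < e"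
    by blast
qed

inductive op_integral :: "(real set \<Rightarrow> ('h::complex_hilbert \<Rightarrow>\<^sub>L 'h)) \<Rightarrow> (real \<Rightarrow> real) \<Rightarrow> ('h \<Rightarrow>\<^sub>L 'h) \<Rightarrow> bool"
  for E where
  op_integral_indicator: "B \<in> sets borel \<Longrightarrow> op_integral E (indicator B) (E B)"
| op_integral_add: "op_integral E f S \<Longrightarrow> op_integral E g R \<Longrightarrow> op_integral E (\<lambda>t. f t + g t) (S + R)"
| op_integral_scale: "op_integral E f S \<Longrightarrow> op_integral E (\<lambda>t. c * f t) (c *\<^sub>R S)"
| op_integral_lim: "(\<And>n. op_integral E (F n) (S n)) \<Longrightarrow> uniform_limit UNIV F f sequentially \<Longrightarrow> S \<longlonglongrightarrow> A
    \<Longrightarrow> op_integral E f A"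

lemma blinfun_tendsto_apply: "S \<longlonglongrightarrow> A \<Longrightarrow> (\<lambda>n. blinfun_apply (S n) x) \<longlonglongrightarrow> A x"
  by (intro blinfun.tendsto tendsto_const)

lemma op_integral_bounded_borel:
  "op_integral E f S \<Longrightarrow> f \<in> borel_measurable borel \<and> bounded (range f)"
proof (induction rule: op_integral.induct)
  case (op_integral_indicator B)
  have "\<bar>indicator B t :: real\<bar> \<le> 1" for t by (simp add: indicator_def)
  then show ?case using op_integral_indicator by (auto simp: bounded_iff)
next
  case (op_integral_add f S g R)
  then obtain a b where "\<And>t. \<bar>f t\<bar> \<le> a" "\<And>t. \<bar>g t\<bar> \<le> b"
    by (auto simp: bounded_iff)
  then have "\<bar>f t + g t\<bar> \<le> a + b" for t
    using abs_triangle_ineq[of "f t" "g t"] by (meson add_mono order_trans)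
  then show ?case using op_integral_add by (auto simp: bounded_iff)
next
  case (op_integral_scale f S c)
  then obtain a where "\<And>t. \<bar>f t\<bar> \<le> a" by (auto simp: bounded_iff)
  then have "\<bar>c * f t\<bar> \<le> \<bar>c\<bar> * a" for t by (simp add: abs_mult mult_left_mono)
  then show ?case using op_integral_scale by (auto simp: bounded_iff)
next
  case (op_integral_lim F S f A)
  have p: "(\<lambda>n. F n t) \<longlonglongrightarrow> f t" for t
    using op_integral_lim(2) by (rule tendsto_uniform_limitI) simp
  have "f \<in> borel_measurable borel"
    by (rule borel_measurable_LIMSEQ_real[where u=F]) (use p op_integral_lim.IH in simp_all)
  moreover obtain n where n: "\<And>t. \<bar>F n t - f t\<bar> < 1"
    using uniform_limitD[OF op_integral_lim(2), of 1] unfolding eventually_sequentially dist_real_def by auto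
  moreover obtain a where a: "\<And>t. \<bar>F n t\<bar> \<le> a"
    using op_integral_lim.IH[of n] by (auto simp: bounded_iff)
  have "\<bar>f t\<bar> \<le> a + 1" for t using n[of t] a[of t] by (auto simp: abs_if split: if_splits)
  ultimately show ?case by (auto simp: bounded_iff)
qed

lemma op_integralD:
  assumes "op_integral E f S"
  shows "f \<in> borel_measurable borel" "bounded (range f)"
  using op_integral_bounded_borel[OF assms] by auto

lemma op_integral_commutant:
  assumes "op_integral E f S" "\<And>B. B \<in> sets borel \<Longrightarrow> E B \<in> commutant X"
  shows "S \<in> commutant X"
  using assms(1)
proof induction
  case (op_integral_lim F S f A)
  show ?case by (rule commutant_strong_limit[OF op_integral_lim.IH blinfun_tendsto_apply[OF op_integral_lim(3)]])
qed (auto intro: commutant_closed assms(2))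

lemma op_integral_sa_op:
  assumes "op_integral E f S" "pvm E" shows "sa_op S"
  using assms(1)
proof induction
  case (op_integral_lim F S f A)
  show ?case by (rule sa_op_strong_limit[OF op_integral_lim.IH blinfun_tendsto_apply[OF op_integral_lim(3)]])
qed (auto intro: sa_op_add sa_op_scaleR pvm_proj assms(2))

lemma integrable_bounded_scalar_measure:
  fixes f :: "real \<Rightarrow> real"
  assumes "pvm E" "f \<in> borel_measurable borel" "bounded (range f)"
  shows "integrable (scalar_measure E x) f"
proof -
  obtain K where "\<And>t. \<bar>f t\<bar> \<le> K" using assms(3) by (auto simp: bounded_iff)
  then show ?thesis using assms by (intro integrable_scalar_measure)
qed

lemma bounded_range_mult:
  fixes f g :: "'a \<Rightarrow> real"
  assumes "bounded (range f)" "bounded (range g)" shows "bounded (range (\<lambda>t. f t * g t))"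
proof -
  obtain a b where "\<And>t. \<bar>f t\<bar> \<le> a" "\<And>t. \<bar>g t\<bar> \<le> b"
    using assms by (auto simp: bounded_iff)
  moreover have "0 \<le> a" using \<open>\<And>t. \<bar>f t\<bar> \<le> a\<close> by (meson abs_ge_zero order_trans)
  ultimately have "\<bar>f t * g t\<bar> \<le> a * b" for t unfolding abs_mult by (intro mult_mono) auto
  then show ?thesis by (auto simp: bounded_iff)
qed

lemma op_integral_mult_form:
  assumes E: "pvm E" and f: "op_integral E f S" and g: "op_integral E g R"
  shows "x \<bullet> S (R x) = (\<integral>t. f t * g t \<partial>scalar_measure E x)"
proof -
  have int: "integrable (scalar_measure E x) (\<lambda>t. u t * v t)"
    if "op_integral E u A" "op_integral E v B" for u v A B
    using that by (intro integrable_bounded_scalar_measure[OF E] bounded_range_mult borel_measurable_times op_integralD)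
  have ind_int: "integrable (scalar_measure E x) (\<lambda>t. indicator B t * v t)"
    if "B \<in> sets borel" "op_integral E v A" for v A B
    by (rule int[OF op_integral.op_integral_indicator[OF that(1)] that(2)])
  have ind: "x \<bullet> E B (R x) = (\<integral>t. indicator B t * g t \<partial>scalar_measure E x)" if B: "B \<in> sets borel" for B
    using g
  proof induction
    case (op_integral_indicator C)
    then show ?case
      using B E by (simp add: pvm_Int measure_scalar_measure flip: indicator_inter_arith)
  next
    case (op_integral_add f S g R)
    then show ?case
      by (simp add: blinfun.add_left blinfun.add_right inner_add distrib_left ind_int[OF B])
  next
    case (op_integral_scale f S c)
    then show ?case
      by (simp add: blinfun.scaleR_left blinfun.scaleR_right mult.left_commute[of _ c])
  next
    case (op_integral_lim F S f A)
    have "(\<lambda>n. x \<bullet> E B (S n x)) \<longlonglongrightarrow> x \<bullet> E B (A x)"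
      by (intro tendsto_intros blinfun.tendsto op_integral_lim.hyps)
    moreover have "(\<lambda>n. x \<bullet> E B (S n x)) \<longlonglongrightarrow> (\<integral>t. indicator B t * f t \<partial>scalar_measure E x)"
      unfolding op_integral_lim.IH
    proof (rule integral_uniform_limit[OF finite_scalar_measure[OF E]])
      have "op_integral E f A" by (rule op_integral.op_integral_lim[OF op_integral_lim.hyps])
      then show "integrable (scalar_measure E x) (\<lambda>t. indicator B t * f t)" by (rule ind_int[OF B])
      show "integrable (scalar_measure E x) (\<lambda>t. indicator B t * F n t)" for n
        using op_integral_lim.hyps(1) by (rule ind_int[OF B])
      show "uniform_limit UNIV (\<lambda>n t. indicator B t * F n t) (\<lambda>t. indicator B t * f t) sequentially"
        using op_integralD(2)[OF op_integral.op_integral_indicator[OF B]] op_integralD(2)[OF \<open>op_integral E f A\<close>]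
        by (intro uniform_lim_mult op_integral_lim.hyps(2) uniform_limit_const)
    qed
    ultimately show ?case by (rule LIMSEQ_unique)
  qed
  show ?thesis
    using f
  proof induction
    case (op_integral_indicator B)
    then show ?case by (rule ind)
  next
    case (op_integral_add f1 S f2 R')
    then show ?case by (simp add: blinfun.add_left inner_add distrib_right int[OF _ g])
  next
    case (op_integral_scale f S c)
    then show ?case by (simp add: blinfun.scaleR_left mult.assoc)
  next
    case (op_integral_lim F S f A)
    have "(\<lambda>n. x \<bullet> S n (R x)) \<longlonglongrightarrow> x \<bullet> A (R x)"
      by (intro tendsto_intros blinfun.tendsto op_integral_lim.hyps)
    moreover have "(\<lambda>n. x \<bullet> S n (R x)) \<longlonglongrightarrow> (\<integral>t. f t * g t \<partial>scalar_measure E x)"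
      unfolding op_integral_lim.IH
    proof (rule integral_uniform_limit[OF finite_scalar_measure[OF E]])
      have "op_integral E f A" by (rule op_integral.op_integral_lim[OF op_integral_lim.hyps])
      then show "integrable (scalar_measure E x) (\<lambda>t. f t * g t)" by (rule int[OF _ g])
      show "integrable (scalar_measure E x) (\<lambda>t. F n t * g t)" for n
        using op_integral_lim.hyps(1) by (rule int[OF _ g])
      show "uniform_limit UNIV (\<lambda>n t. F n t * g t) (\<lambda>t. f t * g t) sequentially"
        using op_integralD(2)[OF g] op_integralD(2)[OF \<open>op_integral E f A\<close>]
        by (intro uniform_lim_mult op_integral_lim.hyps(2) uniform_limit_const)
    qed
    ultimately show ?case by (rule LIMSEQ_unique)
  qed
qed

lemma op_integral_UNIV: "pvm E \<Longrightarrow> op_integral E (\<lambda>_. 1) id_blinfun"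
  using op_integral_indicator[of UNIV E] by (simp add: pvm_UNIV)

lemma op_integral_form:
  assumes "pvm E" "op_integral E f S" shows "x \<bullet> S x = (\<integral>t. f t \<partial>scalar_measure E x)"
  using op_integral_mult_form[OF assms op_integral_UNIV[OF assms(1)], of x] by simp

lemma op_integral_norm_le:
  assumes E: "pvm E" and f: "op_integral E f S" and c: "\<And>t. \<bar>f t\<bar> \<le> c"
  shows "norm S \<le> c"
proof (rule norm_blinfun_bound)
  have c0: "0 \<le> c" using c by (meson abs_ge_zero order_trans)
  then show "0 \<le> c" .
  fix x
  interpret finite_measure "scalar_measure E x" using E by (rule finite_scalar_measure)
  have "(norm (S x))\<^sup>2 = x \<bullet> S (S x)"
    by (simp add: power2_norm_eq_inner sa_opD(2)[OF op_integral_sa_op[OF f E]])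
  also have "\<dots> = (\<integral>t. f t * f t \<partial>scalar_measure E x)"
    by (rule op_integral_mult_form[OF E f f])
  also have "\<dots> \<le> (\<integral>t. c * c \<partial>scalar_measure E x)"
  proof (rule integral_mono)
    show "integrable (scalar_measure E x) (\<lambda>t. f t * f t)"
      using f by (intro integrable_bounded_scalar_measure[OF E] bounded_range_mult borel_measurable_times op_integralD)
    show "f t * f t \<le> c * c" for t using mult_mono[OF c[of t] c[of t] c0] by (simp flip: abs_mult)
  qed simp
  also have "\<dots> = (c * norm x)\<^sup>2"
    using E by (simp add: measure_scalar_measure pvm_UNIV power_mult_distrib power2_norm_eq_inner power2_eq_square[of c])
  finally show "norm (S x) \<le> c * norm x" by (rule power2_le_imp_le) (simp add: c0)
qed

lemma op_integral_sum:
  assumes "finite I" "pvm E" "\<And>i. i \<in> I \<Longrightarrow> op_integral E (f i) (S i)"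
  shows "op_integral E (\<lambda>t. \<Sum>i\<in>I. f i t) (\<Sum>i\<in>I. S i)"
  using assms(1,3)
proof induction
  case empty
  show ?case using op_integral_scale[OF op_integral_UNIV[OF assms(2)], of 0] by simp
next
  case (insert i I)
  then show ?case by (simp add: op_integral_add)
qed

theorem op_integral_ex:
  assumes E: "pvm E" and f: "f \<in> borel_measurable borel" and K: "\<And>t. \<bar>f t\<bar> \<le> K"
  shows "\<exists>S. op_integral E f S"
proof -
  define F where "F n t = real_of_int \<lfloor>real (Suc n) * f t\<rfloor> / real (Suc n)" for n t
  have close: "\<bar>F n t - f t\<bar> \<le> 1 / real (Suc n)" for n t
  proof -
    have "\<bar>real_of_int \<lfloor>real (Suc n) * f t\<rfloor> - real (Suc n) * f t\<bar> \<le> 1" by linarith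
    then have "\<bar>real_of_int \<lfloor>real (Suc n) * f t\<rfloor> - real (Suc n) * f t\<bar> / real (Suc n) \<le> 1 / real (Suc n)"
      by (intro divide_right_mono) auto
    moreover have "F n t - f t = (real_of_int \<lfloor>real (Suc n) * f t\<rfloor> - real (Suc n) * f t) / real (Suc n)"
      by (simp add: F_def diff_divide_distrib del: of_nat_Suc)
    ultimately show ?thesis by (simp add: abs_divide del: of_nat_Suc)
  qed
  have "\<exists>S. op_integral E (F n) S" for n
  proof -
    define L where "L = \<lceil>real (Suc n) * K\<rceil> + 1"
    define B where "B k = {t. \<lfloor>real (Suc n) * f t\<rfloor> = k}" for k :: int
    have B: "B k \<in> sets borel" for k using f unfolding B_def by measurable
    have mem: "\<lfloor>real (Suc n) * f t\<rfloor> \<in> {-L..L}" for t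
    proof -
      have "\<bar>real (Suc n) * f t\<bar> \<le> real (Suc n) * K"
        unfolding abs_mult using K by (simp add: mult_left_mono del: of_nat_Suc)
      then show ?thesis unfolding L_def atLeastAtMost_iff abs_le_iff by linarith
    qed
    have "F n = (\<lambda>t. \<Sum>k\<in>{-L..L}. (real_of_int k / real (Suc n)) * indicator (B k) t)"
    proof
      fix t
      have "(\<Sum>k\<in>{-L..L}. (real_of_int k / real (Suc n)) * indicator (B k) t) =
        (\<Sum>k\<in>{-L..L}. if k = \<lfloor>real (Suc n) * f t\<rfloor> then real_of_int k / real (Suc n) else 0)"
        by (intro sum.cong) (auto simp: B_def)
      also have "\<dots> = F n t" using mem[of t] by (simp add: F_def sum.delta del: of_nat_Suc)
      finally show "F n t = (\<Sum>k\<in>{-L..L}. (real_of_int k / real (Suc n)) * indicator (B k) t)" by simp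
    qed
    moreover have "op_integral E (\<lambda>t. \<Sum>k\<in>{-L..L}. (real_of_int k / real (Suc n)) * indicator (B k) t)
        (\<Sum>k\<in>{-L..L}. (real_of_int k / real (Suc n)) *\<^sub>R E (B k))"
      by (intro op_integral_sum E op_integral_scale op_integral_indicator B) simp
    ultimately show ?thesis by metis
  qed
  then obtain S where S: "\<And>n. op_integral E (F n) (S n)" by metis
  have Sd: "norm (S m - S n) \<le> 1 / real (Suc m) + 1 / real (Suc n)" for m n
  proof -
    have "op_integral E (\<lambda>t. F m t + (-1) * F n t) (S m + (-1) *\<^sub>R S n)"
      by (intro op_integral_add op_integral_scale S)
    moreover have "\<bar>F m t + (-1) * F n t\<bar> \<le> 1 / real (Suc m) + 1 / real (Suc n)" for t
    proof -
      have "\<bar>F m t + (-1) * F n t\<bar> = \<bar>(F m t - f t) - (F n t - f t)\<bar>" by simp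
      also have "\<dots> \<le> \<bar>F m t - f t\<bar> + \<bar>F n t - f t\<bar>" by (rule abs_triangle_ineq4)
      finally show ?thesis using close[of m t] close[of n t] by linarith
    qed
    ultimately have "norm (S m + (-1) *\<^sub>R S n) \<le> 1 / real (Suc m) + 1 / real (Suc n)"
      by (rule op_integral_norm_le[OF E])
    then show ?thesis by simp
  qed
  have "Cauchy S"
  proof (rule CauchyI)
    fix e :: real assume e: "0 < e"
    obtain M where M: "inverse (real (Suc M)) < e / 2" using reals_Archimedean[of "e / 2"] e by auto
    have "norm (S m - S n) < e" if "m \<ge> M" "n \<ge> M" for m n
    proof -
      have "1 / real (Suc k) < e / 2" if "k \<ge> M" for k
      proof -
        have "1 / real (Suc k) \<le> 1 / real (Suc M)" using that by (intro divide_left_mono) auto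
        then show ?thesis using M by (simp add: inverse_eq_divide)
      qed
      from this[OF that(1)] this[OF that(2)] show ?thesis using Sd[of m n] by linarith
    qed
    then show "\<exists>M. \<forall>m\<ge>M. \<forall>n\<ge>M. norm (S m - S n) < e" by blast
  qed
  then obtain A where A: "S \<longlonglongrightarrow> A" by (auto simp: Cauchy_convergent_iff convergent_def)
  have "uniform_limit UNIV F f sequentially"
  proof (rule uniform_limitI)
    fix e :: real assume e: "0 < e"
    obtain M where M: "inverse (real (Suc M)) < e" using reals_Archimedean[of e] e by auto
    show "\<forall>\<^sub>F n in sequentially. \<forall>t\<in>UNIV. dist (F n t) (f t) < e"
      using eventually_ge_at_top[of M]
    proof eventually_elim
      case (elim n)
      have "1 / real (Suc n) \<le> 1 / real (Suc M)" using elim by (intro divide_left_mono) auto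
      then have "1 / real (Suc n) < e" using M by (simp add: inverse_eq_divide)
      then show ?case using close[of n] by (auto simp: dist_real_def intro: le_less_trans)
    qed
  qed
  then have "op_integral E f A" by (rule op_integral_lim[OF S _ A])
  then show ?thesis by blast
qed

lemma op_integral_unique:
  assumes "pvm E" "op_integral E f S" "A \<in> bop"
    "\<And>x. cinner x (A x) = complex_of_real (\<integral>t. f t \<partial>scalar_measure E x)"
  shows "A = S"
  using assms op_integral_form[OF assms(1,2)] op_integral_sa_op[OF assms(2,1)]
  by (intro bop_eq_sa_op) auto

theorem op_integral_mult:
  assumes E: "pvm E" and f: "op_integral E f S" and g: "op_integral E g R"
  shows "op_integral E (\<lambda>t. f t * g t) (S o\<^sub>L R)"
proof -
  have bop: "E B \<in> bop" if "B \<in> sets borel" for B using pvm_proj[OF E that] by (simp add: sa_op_def)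
  have "R \<in> commutant (E ` sets borel)"
  proof (rule op_integral_commutant[OF g])
    fix B :: "real set" assume B: "B \<in> sets borel"
    show "E B \<in> commutant (E ` sets borel)"
      using bop[OF B] B by (auto simp: commutant_def pvm_Int[OF E] Int_commute intro!: blinfun_eqI)
  qed
  then have "E B o\<^sub>L R = R o\<^sub>L E B" if "B \<in> sets borel" for B using that by (auto simp: commutant_def)
  then have "S \<in> commutant {R}"
    using bop by (intro op_integral_commutant[OF f]) (auto simp: commutant_def)
  then have "S o\<^sub>L R = R o\<^sub>L S" by (auto simp: commutant_def)
  then have sa: "sa_op (S o\<^sub>L R)" using f g E by (intro sa_op_compose op_integral_sa_op)
  have bm: "(\<lambda>t. f t * g t) \<in> borel_measurable borel"
    using f g by (intro borel_measurable_times op_integralD)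
  obtain K where "\<And>t. \<bar>f t * g t\<bar> \<le> K"
    using bounded_range_mult[OF op_integralD(2)[OF f] op_integralD(2)[OF g]] by (auto simp: bounded_iff)
  then obtain Q where Q: "op_integral E (\<lambda>t. f t * g t) Q" using op_integral_ex[OF E bm] by blast
  have "S o\<^sub>L R = Q"
    using op_integral_form[OF E Q] op_integral_mult_form[OF E f g]
    by (intro sa_op_eqI sa op_integral_sa_op[OF Q E]) simp
  then show ?thesis using Q by simp
qed

section \<open>The spectral measure and the functional calculus\<close>

definition is_spectral :: "('h::complex_hilbert \<Rightarrow>\<^sub>L 'h) \<Rightarrow> (real set \<Rightarrow> ('h \<Rightarrow>\<^sub>L 'h)) \<Rightarrow> bool" where
  "is_spectral A E \<longleftrightarrow> pvm E \<and> (\<forall>B. B \<notin> sets borel \<longrightarrow> E B = 0) \<and> (\<exists>r. E {-r..r} = id_blinfun) \<and>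
     (\<forall>x. cinner x (A x) = complex_of_real (\<integral>l. l \<partial>scalar_measure E x))"

lemma pvm_full_mono:
  assumes "pvm E" "E D = id_blinfun" "D \<in> sets borel" "C \<in> sets borel" "D \<subseteq> C"
  shows "E C = id_blinfun"
proof (rule blinfun_eqI)
  fix x
  have "E C x = E C (E D x)" by (simp add: assms)
  also have "\<dots> = E (C \<inter> D) x" using assms by (intro pvm_Int)
  also have "C \<inter> D = D" using assms by auto
  finally show "E C x = id_blinfun x" by (simp add: assms)
qed

lemma integral_scalar_measure_cong:
  fixes f g :: "real \<Rightarrow> real"
  assumes "pvm E" "E D = id_blinfun" "D \<in> sets borel"
    and "f \<in> borel_measurable borel" "g \<in> borel_measurable borel" "\<And>t. t \<in> D \<Longrightarrow> f t = g t"
  shows "(\<integral>t. f t \<partial>scalar_measure E x) = (\<integral>t. g t \<partial>scalar_measure E x)"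
proof (rule integral_cong_AE)
  show "AE t in scalar_measure E x. f t = g t"
    using AE_scalar_measure[OF assms(1-3)] by eventually_elim (rule assms(6))
qed (use assms(4,5) in auto)

lemma spectral_moments:
  assumes A: "A \<in> bop" and E: "is_spectral A E"
  shows "x \<bullet> opow A k x = (\<integral>t. t ^ k \<partial>scalar_measure E x)"
proof -
  have pvm: "pvm E" using E by (simp add: is_spectral_def)
  obtain r where r: "E {-r..r} = id_blinfun" using E by (auto simp: is_spectral_def)
  define f where "f t = t * indicator {-r..r} t" for t :: real
  have [measurable]: "f \<in> borel_measurable borel" unfolding f_def[abs_def] by measurable
  have "\<bar>f t\<bar> \<le> \<bar>r\<bar>" for t by (auto simp: f_def indicator_def)
  then obtain S where S: "op_integral E f S" using op_integral_ex[OF pvm, of f "\<bar>r\<bar>"] by auto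
  have "A = S"
  proof (rule op_integral_unique[OF pvm S A])
    fix y
    have "(\<integral>t. f t \<partial>scalar_measure E y) = (\<integral>t. t \<partial>scalar_measure E y)"
      by (rule integral_scalar_measure_cong[OF pvm r]) (auto simp: f_def)
    then show "cinner y (A y) = complex_of_real (\<integral>t. f t \<partial>scalar_measure E y)"
      using E by (simp add: is_spectral_def)
  qed
  then have "op_integral E (\<lambda>t. f t ^ k) (opow A k)"
    by (induction k) (auto intro: op_integral_UNIV[OF pvm] op_integral_mult[OF pvm S])
  then have "x \<bullet> opow A k x = (\<integral>t. f t ^ k \<partial>scalar_measure E x)"
    by (rule op_integral_form[OF pvm])
  also have "\<dots> = (\<integral>t. t ^ k \<partial>scalar_measure E x)"
    by (rule integral_scalar_measure_cong[OF pvm r]) (auto simp: f_def)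
  finally show ?thesis .
qed

theorem is_spectral_unique:
  assumes A: "A \<in> bop" and E: "is_spectral A E" and F: "is_spectral A F"
  shows "E = F"
proof
  have pvm: "pvm E" "pvm F" using E F by (simp_all add: is_spectral_def)
  obtain r s where r: "E {-r..r} = id_blinfun" and s: "F {-s..s} = id_blinfun"
    using E F by (auto simp: is_spectral_def)
  have "E {- max r s..max r s} = id_blinfun" "F {- max r s..max r s} = id_blinfun"
    using pvm_full_mono[OF pvm(1) r] pvm_full_mono[OF pvm(2) s] by auto
  then have "scalar_measure E x = scalar_measure F x" for x
    by (intro measure_eqI_moments[where r="max r s"] finite_scalar_measure pvm AE_scalar_measure)
      (auto simp flip: spectral_moments[OF A E] spectral_moments[OF A F])
  then have form: "x \<bullet> E B x = x \<bullet> F B x" if "B \<in> sets borel" for B x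
    using measure_scalar_measure[OF pvm(1) that, of x] measure_scalar_measure[OF pvm(2) that, of x] by simp
  fix B
  show "E B = F B"
  proof (cases "B \<in> sets borel")
    case True
    then show ?thesis using pvm form by (intro sa_op_eqI pvm_proj) auto
  next
    case False
    then show ?thesis using E F by (simp add: is_spectral_def)
  qed
qed

lemma spectral_measure_eqI: "A \<in> bop \<Longrightarrow> is_spectral A E \<Longrightarrow> spectral_measure A = E"
  unfolding spectral_measure_def using is_spectral_unique[of A]
  by (intro the_equality) (auto simp: is_spectral_def)

theorem spectral_measure_op_pos:
  assumes T: "op_pos T"
  obtains r where "0 < r" "is_spectral T (spectral_measure T)" "spectral_measure T {0..r} = id_blinfun"
    "\<And>B. B \<in> sets borel \<Longrightarrow> spectral_measure T B \<in> commutant (commutant {T})"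
proof -
  have sT: "sa_op T" using T by (simp add: sa_op_pos_iff)
  obtain r \<mu> where r: "0 < r" and fin: "\<And>x. finite_measure (\<mu> x)" and sets: "\<And>x. sets (\<mu> x) = sets borel"
    and AE: "\<And>x. AE t in \<mu> x. t \<in> {0..r}" and moment: "\<And>x k. (\<integral>t. t ^ k \<partial>\<mu> x) = x \<bullet> opow T k x"
    by (rule moment_measure[OF T]) blast
  note hyps = sT r fin sets AE moment
  have space: "space (\<mu> x) = UNIV" for x using sets_eq_imp_space_eq[OF sets] by simp
  define E where "E B = (if B \<in> sets borel then SOME P. is_proj T \<mu> B P else 0)" for B
  have E: "is_proj T \<mu> B (E B)" if "B \<in> sets borel" for B
    using someI_ex[OF is_proj_ex[OF hyps that]] that by (simp add: E_def)
  have E_eq: "E B = P" if "B \<in> sets borel" "is_proj T \<mu> B P" for B P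
    using is_proj_unique[OF hyps E[OF that(1)] that(2)] .
  have EI: "E B = id_blinfun" if "B \<in> sets borel" "{0..r} \<subseteq> B" for B
  proof (rule sa_op_eqI)
    show "sa_op (E B)" using E[OF that(1)] by (simp add: is_proj_def[OF hyps])
    fix x
    interpret finite_measure "\<mu> x" by (rule fin)
    have "AE t in \<mu> x. t \<in> B" using AE[of x] by eventually_elim (use that in auto)
    then have "measure (\<mu> x) B = measure (\<mu> x) (space (\<mu> x))"
      using that sets by (intro measure_eq_AE) (auto simp: space)
    then show "x \<bullet> E B x = x \<bullet> id_blinfun x"
      using E[OF that(1)] total_mass[OF hyps, of x] by (simp add: is_proj_def[OF hyps] space)
  qed simp
  have pvm: "pvm E"
    unfolding pvm_def
  proof (intro conjI ballI allI impI)
    fix B :: "real set" assume "B \<in> sets borel"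
    from E[OF this] show "E B \<in> bop" "op_adj (E B) = E B" "E B o\<^sub>L E B = E B"
      by (auto simp: is_proj_def[OF hyps] sa_op_iff_adj)
  next
    fix B :: "nat \<Rightarrow> real set" and x
    assume B: "range B \<subseteq> sets borel \<and> disjoint_family B"
    then have "is_proj T \<mu> (B i) (E (B i))" for i by (intro E) auto
    with B obtain Q where Q: "is_proj T \<mu> (\<Union>i. B i) Q" "\<And>x. (\<lambda>i. E (B i) x) sums Q x"
      using is_proj_UN[OF hyps, of B "\<lambda>i. E (B i)"] by metis
    moreover have "E (\<Union>i. B i) = Q" using B Q(1) by (intro E_eq) auto
    ultimately show "(\<lambda>n. E (B n) x) sums E (\<Union>n. B n) x" by simp
  qed (simp add: EI)
  have \<mu>: "scalar_measure E x = \<mu> x" for x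
  proof (rule measure_eqI)
    interpret finite_measure "\<mu> x" by (rule fin)
    fix B assume "B \<in> sets (scalar_measure E x)"
    then have "B \<in> sets borel" by simp
    then show "emeasure (scalar_measure E x) B = emeasure (\<mu> x) B"
      using E[of B] by (simp add: emeasure_scalar_measure[OF pvm] is_proj_def[OF hyps] emeasure_eq_measure)
  qed (simp add: sets)
  have spec: "is_spectral T E"
    unfolding is_spectral_def
  proof (intro conjI allI impI pvm)
    show "\<exists>r. E {-r..r} = id_blinfun" using r by (intro exI[of _ r] EI) auto
    show "cinner x (T x) = complex_of_real (\<integral>l. l \<partial>scalar_measure E x)" for x
      using moment[of x 1] by (simp add: \<mu> cinner_sa_op[OF sT])
  qed (simp add: E_def)
  have "T \<in> bop" using sT by (simp add: sa_op_def)
  then have eq: "spectral_measure T = E" using spec by (rule spectral_measure_eqI)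
  show thesis
  proof (rule that[OF r])
    show "spectral_measure T B \<in> commutant (commutant {T})" if "B \<in> sets borel" for B
      using E[OF that] by (simp add: eq is_proj_def[OF hyps])
  qed (simp_all add: eq spec EI)
qed

lemma fun_calc_eqI:
  assumes "sa_op S" "\<And>x. x \<bullet> S x = (\<integral>l. f l \<partial>scalar_measure (spectral_measure A) x)"
  shows "fun_calc f A = S"
  unfolding fun_calc_def
proof (rule the_equality)
  show "S \<in> bop \<and> (\<forall>x. cinner x (S x) = complex_of_real (\<integral>l. f l \<partial>scalar_measure (spectral_measure A) x))"
    using assms by (simp add: sa_op_def cinner_sa_op)
  show "R = S" if "R \<in> bop \<and> (\<forall>x. cinner x (R x) = complex_of_real (\<integral>l. f l \<partial>scalar_measure (spectral_measure A) x))" for R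
    using that assms by (intro bop_eq_sa_op) auto
qed

context
  fixes A :: "'h::complex_hilbert \<Rightarrow>\<^sub>L 'h" and D :: "real set"
  assumes A: "A \<in> bop" and spec: "is_spectral A (spectral_measure A)"
    and D: "D \<in> sets borel" "spectral_measure A D = id_blinfun"
begin

lemma pvm_spectral_measure: "pvm (spectral_measure A)"
  using spec by (simp add: is_spectral_def)

lemma fun_calc_op_integral:
  assumes f: "f \<in> borel_measurable borel" and K: "\<And>t. t \<in> D \<Longrightarrow> \<bar>f t\<bar> \<le> K"
  shows "op_integral (spectral_measure A) (\<lambda>t. f t * indicator D t) (fun_calc f A)"
    and "x \<bullet> fun_calc f A x = (\<integral>t. f t \<partial>scalar_measure (spectral_measure A) x)"
proof -
  have [measurable]: "D \<in> sets borel" "f \<in> borel_measurable borel" by (rule D f)+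
  have "\<bar>f t * indicator D t\<bar> \<le> \<bar>K\<bar>" for t
    using K[of t] by (auto simp: indicator_def)
  then obtain S where S: "op_integral (spectral_measure A) (\<lambda>t. f t * indicator D t) S"
    using op_integral_ex[OF pvm_spectral_measure, of "\<lambda>t. f t * indicator D t" "\<bar>K\<bar>"] by auto
  have form: "x \<bullet> S x = (\<integral>t. f t \<partial>scalar_measure (spectral_measure A) x)" for x
    unfolding op_integral_form[OF pvm_spectral_measure S]
    by (rule integral_scalar_measure_cong[OF pvm_spectral_measure D(2,1)]) auto
  have "fun_calc f A = S"
    by (rule fun_calc_eqI[OF op_integral_sa_op[OF S pvm_spectral_measure] form])
  with S form show "op_integral (spectral_measure A) (\<lambda>t. f t * indicator D t) (fun_calc f A)"
    "x \<bullet> fun_calc f A x = (\<integral>t. f t \<partial>scalar_measure (spectral_measure A) x)" by simp_all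
qed

lemma sa_op_fun_calc:
  assumes f: "f \<in> borel_measurable borel" and K: "\<And>t. t \<in> D \<Longrightarrow> \<bar>f t\<bar> \<le> K"
  shows "sa_op (fun_calc f A)"
  by (rule op_integral_sa_op[OF fun_calc_op_integral(1)[OF assms] pvm_spectral_measure])

lemma spectral_measure_fun_calc:
  assumes f: "f \<in> borel_measurable borel" and K: "\<And>t. t \<in> D \<Longrightarrow> \<bar>f t\<bar> \<le> K"
  shows "spectral_measure (fun_calc f A) = (\<lambda>B. if B \<in> sets borel then spectral_measure A (f -` B) else 0)"
    and "scalar_measure (spectral_measure (fun_calc f A)) x = distr (scalar_measure (spectral_measure A) x) borel f"
proof -
  define E where "E = spectral_measure A"
  define F where "F B = (if B \<in> sets borel then E (f -` B) else 0)" for B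
  have pvm: "pvm E" unfolding E_def by (rule pvm_spectral_measure)
  have vim: "f -` B \<in> sets borel" if "B \<in> sets borel" for B
    using measurable_sets_borel[OF f that] by simp
  have pvmF: "pvm F"
    unfolding pvm_def
  proof (intro conjI ballI allI impI)
    fix B :: "real set" assume "B \<in> sets borel"
    then show "F B \<in> bop" "op_adj (F B) = F B" "F B o\<^sub>L F B = F B"
      using pvm_proj[OF pvm vim, of B] by (auto simp: F_def sa_op_iff_adj)
  next
    show "F UNIV = id_blinfun" using pvm_UNIV[OF pvm] by (simp add: F_def)
    fix B :: "nat \<Rightarrow> real set" and x
    assume B: "range B \<subseteq> sets borel \<and> disjoint_family B"
    then have Bi: "B i \<in> sets borel" for i by auto
    have "(\<lambda>n. E (f -` B n) x) sums E (\<Union>n. f -` B n) x"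
      using B by (intro pvm_sums pvm) (auto simp: disjoint_family_on_def intro!: vim)
    then show "(\<lambda>n. F (B n) x) sums F (\<Union>n. B n) x"
      using Bi by (simp add: F_def vimage_UN)
  qed
  have distr: "scalar_measure F x = distr (scalar_measure E x) borel f" for x
  proof (rule measure_eqI)
    fix B assume "B \<in> sets (scalar_measure F x)"
    then have B: "B \<in> sets borel" by simp
    then show "emeasure (scalar_measure F x) B = emeasure (distr (scalar_measure E x) borel f) B"
      using f by (simp add: emeasure_scalar_measure[OF pvmF] emeasure_distr emeasure_scalar_measure[OF pvm] vim F_def)
  qed simp
  have "is_spectral (fun_calc f A) F"
    unfolding is_spectral_def
  proof (intro conjI allI impI pvmF)
    have "E (f -` {-K..K}) = id_blinfun"
    proof (rule pvm_full_mono[OF pvm _ D(1)])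
      show "E D = id_blinfun" by (simp add: E_def D)
      show "f -` {-K..K} \<in> sets borel" by (rule vim) simp
      show "D \<subseteq> f -` {-K..K}"
      proof
        fix t assume "t \<in> D"
        from K[OF this] show "t \<in> f -` {-K..K}" by (simp add: abs_le_iff)
      qed
    qed
    then have "F {-K..K} = id_blinfun" by (simp add: F_def)
    then show "\<exists>r. F {-r..r} = id_blinfun" by blast
    fix x
    have "(\<integral>l. l \<partial>scalar_measure F x) = x \<bullet> fun_calc f A x"
      unfolding distr using fun_calc_op_integral(2)[OF assms, of x] f
      by (subst integral_distr) (simp_all add: E_def)
    then show "cinner x (fun_calc f A x) = complex_of_real (\<integral>l. l \<partial>scalar_measure F x)"
      by (simp add: cinner_sa_op[OF sa_op_fun_calc[OF assms]])
  qed (simp add: F_def)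
  then have "spectral_measure (fun_calc f A) = F"
    using sa_op_fun_calc[OF assms] by (intro spectral_measure_eqI) (simp_all add: sa_op_def)
  then show "spectral_measure (fun_calc f A) = (\<lambda>B. if B \<in> sets borel then spectral_measure A (f -` B) else 0)"
    "scalar_measure (spectral_measure (fun_calc f A)) x = distr (scalar_measure (spectral_measure A) x) borel f"
    using distr by (auto simp: F_def[abs_def] E_def)
qed

lemma op_abs_fun_calc:
  assumes f: "f \<in> borel_measurable borel" and K: "\<And>t. t \<in> D \<Longrightarrow> \<bar>f t\<bar> \<le> K"
    and nonneg: "\<And>t. t \<in> D \<Longrightarrow> 0 \<le> f t"
  shows "op_abs (fun_calc f A) = fun_calc f A"
proof -
  let ?S = "fun_calc f A"
  note [measurable] = f
  note S = sa_op_fun_calc[OF f K]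
  have K2: "\<bar>f t * f t\<bar> \<le> \<bar>K\<bar> * \<bar>K\<bar>" if "t \<in> D" for t
    unfolding abs_mult using K[OF that] by (intro mult_mono) auto
  have m2: "(\<lambda>t. f t * f t) \<in> borel_measurable borel" by measurable
  note Q = fun_calc_op_integral[OF m2 K2]
  have "op_integral (spectral_measure A) (\<lambda>t. (f t * indicator D t) * (f t * indicator D t)) (?S o\<^sub>L ?S)"
    by (intro op_integral_mult pvm_spectral_measure fun_calc_op_integral[OF f K])
  also have "(\<lambda>t. (f t * indicator D t) * (f t * indicator D t)) = (\<lambda>t. f t * f t * indicator D t)"
    by (auto simp: indicator_def)
  finally have SS: "op_integral (spectral_measure A) (\<lambda>t. f t * f t * indicator D t) (?S o\<^sub>L ?S)" .
  have "?S o\<^sub>L ?S = fun_calc (\<lambda>t. f t * f t) A"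
    using op_integral_form[OF pvm_spectral_measure SS] op_integral_form[OF pvm_spectral_measure Q(1)]
      op_integral_sa_op[OF SS pvm_spectral_measure] op_integral_sa_op[OF Q(1) pvm_spectral_measure]
    by (intro sa_op_eqI) auto
  then have "op_abs ?S = fun_calc sqrt (fun_calc (\<lambda>t. f t * f t) A)"
    by (simp add: op_abs_def op_adj_sa_op[OF S])
  also have "\<dots> = ?S"
  proof (rule fun_calc_eqI[OF S])
    fix x
    have eq: "scalar_measure (spectral_measure (fun_calc (\<lambda>t. f t * f t) A)) x =
        distr (scalar_measure (spectral_measure A) x) borel (\<lambda>t. f t * f t)"
      by (rule spectral_measure_fun_calc(2)[OF m2 K2])
    have "(\<integral>l. sqrt l \<partial>scalar_measure (spectral_measure (fun_calc (\<lambda>t. f t * f t) A)) x) =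
        (\<integral>t. sqrt (f t * f t) \<partial>scalar_measure (spectral_measure A) x)"
      unfolding eq by (subst integral_distr) auto
    also have "\<dots> = (\<integral>t. f t \<partial>scalar_measure (spectral_measure A) x)"
      by (rule integral_scalar_measure_cong[OF pvm_spectral_measure D(2,1)]) (auto simp: nonneg)
    finally show "x \<bullet> ?S x = (\<integral>l. sqrt l \<partial>scalar_measure (spectral_measure (fun_calc (\<lambda>t. f t * f t) A)) x)"
      using fun_calc_op_integral(2)[OF f K, of x] by simp
  qed
  finally show ?thesis .
qed

end

section \<open>The trace of the functional calculus\<close>

definition trace_measure :: "(('h::complex_hilbert \<Rightarrow>\<^sub>L 'h) \<Rightarrow> ennreal) \<Rightarrow> (real set \<Rightarrow> ('h \<Rightarrow>\<^sub>L 'h)) \<Rightarrow> real measure" where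
  "trace_measure \<tau> E = measure_of UNIV (sets borel) (\<lambda>B. \<tau> (E (B \<inter> {0<..})))"

lemma sets_trace_measure [simp, measurable_cong]: "sets (trace_measure \<tau> E) = sets borel"
  using sets.sigma_sets_eq[of "borel :: real measure"] by (simp add: trace_measure_def)

lemma space_trace_measure [simp]: "space (trace_measure \<tau> E) = UNIV"
  by (simp add: trace_measure_def)

lemma pos_partI: "A \<in> N \<Longrightarrow> sa_op A \<Longrightarrow> (\<And>x. 0 \<le> x \<bullet> A x) \<Longrightarrow> A \<in> pos_part N"
  by (simp add: pos_part_def sa_op_pos_iff)

context
  fixes N :: "('h::complex_hilbert \<Rightarrow>\<^sub>L 'h) set" and \<tau> :: "('h \<Rightarrow>\<^sub>L 'h) \<Rightarrow> ennreal"
    and E :: "real set \<Rightarrow> ('h \<Rightarrow>\<^sub>L 'h)"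
  assumes vN: "von_neumann_algebra N" and trace: "trace_on N \<tau>" and normal: "normal_trace N \<tau>"
    and E: "pvm E" and EN: "\<And>B. B \<in> sets borel \<Longrightarrow> E B \<in> N"
begin

lemma N_eq: "N = commutant (commutant N)"
  using vN by (simp add: von_neumann_algebra_def)

lemma op_integral_in_N: "op_integral E f S \<Longrightarrow> S \<in> N"
  using op_integral_commutant[of E f S "commutant N"] EN N_eq by metis

lemma op_integral_pos_part:
  assumes S: "op_integral E f S" and f: "\<And>t. 0 \<le> f t"
  shows "S \<in> pos_part N"
proof (rule pos_partI[OF op_integral_in_N[OF S] op_integral_sa_op[OF S E]])
  show "0 \<le> x \<bullet> S x" for x unfolding op_integral_form[OF E S] by (simp add: f)
qed

lemma pvm_pos_part: "B \<in> sets borel \<Longrightarrow> E B \<in> pos_part N"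
  using op_integral_pos_part[OF op_integral_indicator] by simp

lemma zero_pos_part: "0 \<in> pos_part N"
  using pvm_pos_part[of "{}"] by (simp add: pvm_empty[OF E])

lemma trace_add: "A \<in> pos_part N \<Longrightarrow> B \<in> pos_part N \<Longrightarrow> \<tau> (A + B) = \<tau> A + \<tau> B"
  using trace by (simp add: trace_on_def)

lemma trace_scale: "A \<in> pos_part N \<Longrightarrow> 0 \<le> c \<Longrightarrow> \<tau> (c *\<^sub>R A) = ennreal c * \<tau> A"
  using trace by (simp add: trace_on_def)

lemma trace_0: "\<tau> 0 = 0"
  using trace_scale[OF zero_pos_part, of 0] by simp

text \<open>A weak limit of an increasing sequence of operators is its least upper bound.\<close>

lemma trace_increasing_limit:
  assumes S: "\<And>n. S n \<in> pos_part N" and A: "A \<in> pos_part N"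
    and mono: "\<And>x. incseq (\<lambda>n. x \<bullet> S n x)" and lim: "\<And>x. (\<lambda>n. x \<bullet> S n x) \<longlonglongrightarrow> x \<bullet> A x"
  shows "\<tau> A = (SUP n. \<tau> (S n))"
proof -
  have le: "op_le B C \<longleftrightarrow> (\<forall>x. x \<bullet> B x \<le> x \<bullet> C x)" if "B \<in> pos_part N" "C \<in> pos_part N" for B C
    using that by (auto simp: op_le_def pos_part_def sa_op_pos_iff sa_op_diff blinfun.diff_left inner_diff)
  have "range S \<subseteq> pos_part N \<and> range S \<noteq> {} \<and> (\<forall>B\<in>range S. \<forall>C\<in>range S. \<exists>D\<in>range S. op_le B D \<and> op_le C D) \<and>
      A \<in> pos_part N \<and> (\<forall>B\<in>range S. op_le B A) \<and>
      (\<forall>R\<in>pos_part N. (\<forall>B\<in>range S. op_le B R) \<longrightarrow> op_le A R)"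
  proof (intro conjI ballI impI A)
    show "range S \<subseteq> pos_part N" using S by blast
    fix B C assume "B \<in> range S" "C \<in> range S"
    then obtain m n where mn: "B = S m" "C = S n" by blast
    have "op_le (S k) (S (max m n))" if "k \<le> max m n" for k
      using mono that by (simp add: le S incseq_def)
    then show "\<exists>D\<in>range S. op_le B D \<and> op_le C D"
      unfolding mn by (meson max.cobounded1 max.cobounded2 rangeI)
  next
    fix B assume "B \<in> range S"
    then obtain n where "B = S n" by blast
    then show "op_le B A" using incseq_le[OF mono lim] by (simp add: le S A)
  next
    fix R assume R: "R \<in> pos_part N" "\<forall>B\<in>range S. op_le B R"
    then have "x \<bullet> S n x \<le> x \<bullet> R x" for n x using S by (simp add: le)
    then show "op_le A R" using R by (auto simp: le A intro!: LIMSEQ_le_const2[OF lim])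
  qed auto
  with normal have "\<tau> A = (SUP B\<in>range S. \<tau> B)" unfolding normal_trace_def by blast
  then show ?thesis by (simp add: image_image)
qed

lemma trace_sum:
  assumes "finite I" "\<And>i. i \<in> I \<Longrightarrow> B i \<in> sets borel"
  shows "(\<Sum>i\<in>I. E (B i)) \<in> pos_part N \<and> \<tau> (\<Sum>i\<in>I. E (B i)) = (\<Sum>i\<in>I. \<tau> (E (B i)))"
  using assms
proof induction
  case (insert i I)
  have "op_integral E (\<lambda>t. \<Sum>j\<in>insert i I. indicator (B j) t) (\<Sum>j\<in>insert i I. E (B j))"
    using insert by (intro op_integral_sum E op_integral_indicator) auto
  then have "(\<Sum>j\<in>insert i I. E (B j)) \<in> pos_part N"
    by (rule op_integral_pos_part) (simp add: sum_nonneg)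
  then show ?case using insert by (simp add: trace_add pvm_pos_part)
qed (simp_all add: zero_pos_part trace_0)

lemma trace_pvm_suminf:
  fixes B :: "nat \<Rightarrow> real set"
  assumes B: "range B \<subseteq> sets borel" "disjoint_family B"
  shows "(\<Sum>i. \<tau> (E (B i))) = \<tau> (E (\<Union>i. B i))"
proof -
  have Bi: "B i \<in> sets borel" for i using B by auto
  have "\<tau> (E (\<Union>i. B i)) = (SUP n. \<tau> (\<Sum>i<n. E (B i)))"
  proof (rule trace_increasing_limit)
    show "(\<Sum>i<n. E (B i)) \<in> pos_part N" for n using trace_sum[of "{..<n}" B] Bi by simp
    show "E (\<Union>i. B i) \<in> pos_part N" using Bi by (intro pvm_pos_part) auto
    fix x
    have s: "x \<bullet> (\<Sum>i<n. E (B i)) x = (\<Sum>i<n. x \<bullet> E (B i) x)" for n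
      by (simp add: blinfun.sum_left inner_sum_right)
    show "incseq (\<lambda>n. x \<bullet> (\<Sum>i<n. E (B i)) x)"
      unfolding s by (rule incseq_SucI) (simp add: pvm_nonneg[OF E Bi])
    have "(\<lambda>i. x \<bullet> E (B i) x) sums (x \<bullet> E (\<Union>i. B i) x)"
      by (intro bounded_linear.sums[OF bounded_linear_inner_right] pvm_sums E B)
    then show "(\<lambda>n. x \<bullet> (\<Sum>i<n. E (B i)) x) \<longlonglongrightarrow> x \<bullet> E (\<Union>i. B i) x"
      unfolding s sums_def .
  qed
  also have "\<dots> = (SUP n. \<Sum>i<n. \<tau> (E (B i)))" using trace_sum[of "{..<_}" B] Bi by simp
  also have "\<dots> = (\<Sum>i. \<tau> (E (B i)))" by (rule suminf_eq_SUP[symmetric])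
  finally show ?thesis by simp
qed

lemma emeasure_trace_measure:
  assumes "B \<in> sets borel"
  shows "emeasure (trace_measure \<tau> E) B = \<tau> (E (B \<inter> {0<..}))"
  unfolding trace_measure_def
proof (rule emeasure_measure_of_sigma)
  show "sigma_algebra UNIV (sets (borel :: real measure))"
    using sets.sigma_algebra_axioms[of "borel :: real measure"] by simp
  show "positive (sets borel) (\<lambda>B. \<tau> (E (B \<inter> {0<..})))"
    by (simp add: positive_def pvm_empty[OF E] trace_0)
  show "countably_additive (sets borel) (\<lambda>B. \<tau> (E (B \<inter> {0<..})))"
  proof (rule countably_additiveI)
    fix B :: "nat \<Rightarrow> real set"
    assume B: "range B \<subseteq> sets borel" "disjoint_family B"
    have "(\<Sum>i. \<tau> (E (B i \<inter> {0<..}))) = \<tau> (E (\<Union>i. B i \<inter> {0<..}))"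
      using B by (intro trace_pvm_suminf) (auto simp: disjoint_family_on_def)
    also have "(\<Union>i. B i \<inter> {0<..}) = (\<Union>i. B i) \<inter> {0<..}" by auto
    finally show "(\<Sum>i. \<tau> (E (B i \<inter> {0<..}))) = \<tau> (E ((\<Union>i. B i) \<inter> {0<..}))" .
  qed
qed (rule assms)

lemma op_integral_eqI: "op_integral E f S \<Longrightarrow> op_integral E f R \<Longrightarrow> S = R"
  using op_integral_form[OF E] op_integral_sa_op[OF _ E] by (intro sa_op_eqI) auto

lemma trace_op_integral:
  assumes u: "u \<in> borel_measurable borel" "\<And>t. 0 \<le> u t" and K: "\<And>t. u t \<le> K"
    and S: "op_integral E (\<lambda>t. u t * indicator {0<..} t) S"
  shows "\<tau> S = (\<integral>\<^sup>+t. ennreal (u t) \<partial>trace_measure \<tau> E)"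
proof -
  define P where "P v \<longleftrightarrow> (\<forall>K S. (\<forall>t. v t \<le> K) \<longrightarrow> op_integral E (\<lambda>t. v t * indicator {0<..} t) S \<longrightarrow>
    \<tau> S = (\<integral>\<^sup>+t. ennreal (v t) \<partial>trace_measure \<tau> E))" for v :: "real \<Rightarrow> real"
  have ex: "\<exists>S. op_integral E (\<lambda>t. v t * indicator {0<..} t) S"
    if v: "v \<in> borel_measurable borel" "\<And>t. 0 \<le> v t" "\<And>t. v t \<le> K" for v :: "real \<Rightarrow> real" and K
  proof (rule op_integral_ex[OF E])
    have "0 \<le> K" using v(2)[of 0] v(3)[of 0] by linarith
    then show "\<bar>v t * indicator {0<..} t\<bar> \<le> K" for t using v(2,3)[of t] by (simp add: indicator_def)
  qed (use v in auto)
  have "P u"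
    using u
  proof (induction u rule: borel_measurable_induct_real)
    case (set A)
    show ?case unfolding P_def
    proof (intro allI impI)
      fix K S assume S: "op_integral E (\<lambda>t. indicator A t * indicator {0<..} t) S"
      have "op_integral E (indicator (A \<inter> {0<..})) (E (A \<inter> {0<..}))"
        using set by (intro op_integral_indicator) auto
      also have "indicator (A \<inter> {0<..}) = (\<lambda>t. indicator A t * indicator {0<..} t :: real)"
        by (rule ext) (simp add: indicator_inter_arith)
      finally have "S = E (A \<inter> {0<..})" using S by (rule op_integral_eqI[rotated])
      then show "\<tau> S = (\<integral>\<^sup>+t. ennreal (indicator A t) \<partial>trace_measure \<tau> E)"
        using set by (simp add: ennreal_indicator emeasure_trace_measure)
    qed
  next
    case (mult u c)
    show ?case unfolding P_def
    proof (intro allI impI)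
      fix K S assume K: "\<forall>t. c * u t \<le> K" and S: "op_integral E (\<lambda>t. c * u t * indicator {0<..} t) S"
      show "\<tau> S = (\<integral>\<^sup>+t. ennreal (c * u t) \<partial>trace_measure \<tau> E)"
      proof (cases "c = 0")
        case True
        have "op_integral E (\<lambda>t. c * u t * indicator {0<..} t) 0"
          using op_integral_scale[OF op_integral_UNIV[OF E], of 0] True by simp
        then have "S = 0" using S op_integral_eqI by blast
        then show ?thesis using True by (simp add: trace_0)
      next
        case False
        then have b: "u t \<le> K / c" for t using K mult(1) by (simp add: field_simps)
        then obtain R where R: "op_integral E (\<lambda>t. u t * indicator {0<..} t) R" using ex mult by blast
        have "op_integral E (\<lambda>t. c * (u t * indicator {0<..} t)) (c *\<^sub>R R)"
          by (rule op_integral_scale[OF R])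
        then have "S = c *\<^sub>R R" using S op_integral_eqI by (simp add: mult.assoc)
        moreover have "R \<in> pos_part N" by (rule op_integral_pos_part[OF R]) (simp add: mult)
        moreover have "\<tau> R = (\<integral>\<^sup>+t. ennreal (u t) \<partial>trace_measure \<tau> E)"
          using mult b R unfolding P_def by blast
        ultimately show ?thesis
          using mult by (simp add: trace_scale ennreal_mult nn_integral_cmult)
      qed
    qed
  next
    case (add u v)
    show ?case unfolding P_def
    proof (intro allI impI)
      fix K S assume K: "\<forall>t. v t + u t \<le> K" and S: "op_integral E (\<lambda>t. (v t + u t) * indicator {0<..} t) S"
      have b: "u t \<le> K" "v t \<le> K" for t using K[rule_format, of t] add(2)[of t] add(4)[of t] by linarith+
      obtain R Q where R: "op_integral E (\<lambda>t. u t * indicator {0<..} t) R"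
        and Q: "op_integral E (\<lambda>t. v t * indicator {0<..} t) Q" using ex add b by metis
      have "op_integral E (\<lambda>t. v t * indicator {0<..} t + u t * indicator {0<..} t) (Q + R)"
        by (rule op_integral_add[OF Q R])
      then have "S = Q + R" using S op_integral_eqI by (simp add: distrib_right)
      moreover have "R \<in> pos_part N" by (rule op_integral_pos_part[OF R]) (simp add: add)
      moreover have "Q \<in> pos_part N" by (rule op_integral_pos_part[OF Q]) (simp add: add)
      moreover have "\<tau> R = (\<integral>\<^sup>+t. ennreal (u t) \<partial>trace_measure \<tau> E)"
        using add b R unfolding P_def by blast
      moreover have "\<tau> Q = (\<integral>\<^sup>+t. ennreal (v t) \<partial>trace_measure \<tau> E)"
        using add b Q unfolding P_def by blast
      ultimately show "\<tau> S = (\<integral>\<^sup>+t. ennreal (v t + u t) \<partial>trace_measure \<tau> E)"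
        using add by (simp add: trace_add nn_integral_add)
    qed
  next
    case (seq U)
    show ?case unfolding P_def
    proof (intro allI impI)
      fix K S assume K: "\<forall>t. u t \<le> K" and S: "op_integral E (\<lambda>t. u t * indicator {0<..} t) S"
      have inc: "incseq (\<lambda>i. U i t)" for t using seq(3) by (auto simp: incseq_def le_fun_def)
      have lim: "(\<lambda>i. U i t) \<longlonglongrightarrow> u t" for t using seq(4) by simp
      have Uu: "U i t \<le> u t" for i t by (rule incseq_le[OF inc lim])
      then have b: "U i t \<le> K" for i t using K order_trans by blast
      have u0: "0 \<le> u t" for t using Uu[of 0 t] seq(2)[of 0 t] by linarith
      have "\<exists>S. op_integral E (\<lambda>t. U i t * indicator {0<..} t) S" for i
        by (rule ex[OF seq(1,2) b])
      then obtain R where R: "\<And>i. op_integral E (\<lambda>t. U i t * indicator {0<..} t) (R i)" by metis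
      have \<tau>R: "\<tau> (R i) = (\<integral>\<^sup>+t. ennreal (U i t) \<partial>trace_measure \<tau> E)" for i
        using seq.IH[of i] b R unfolding P_def by blast
      have "\<tau> S = (SUP i. \<tau> (R i))"
      proof (rule trace_increasing_limit)
        show "R i \<in> pos_part N" for i by (rule op_integral_pos_part[OF R]) (simp add: seq)
        show "S \<in> pos_part N" by (rule op_integral_pos_part[OF S]) (simp add: u0)
        fix x
        have int: "integrable (scalar_measure E x) (\<lambda>t. U i t * indicator {0<..} t)" for i
          by (intro integrable_bounded_scalar_measure[OF E] op_integralD[OF R])
        show "incseq (\<lambda>n. x \<bullet> R n x)"
          unfolding op_integral_form[OF E R]
          using inc by (auto simp: incseq_def intro!: integral_mono int mult_right_mono)
        show "(\<lambda>n. x \<bullet> R n x) \<longlonglongrightarrow> x \<bullet> S x"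
          unfolding op_integral_form[OF E R] op_integral_form[OF E S]
        proof (rule integral_dominated_convergence[where w="\<lambda>t. u t * indicator {0<..} t"])
          show "integrable (scalar_measure E x) (\<lambda>t. u t * indicator {0<..} t)"
            by (intro integrable_bounded_scalar_measure[OF E] op_integralD[OF S])
          show "AE t in scalar_measure E x. (\<lambda>i. U i t * indicator {0<..} t) \<longlonglongrightarrow> u t * indicator {0<..} t"
            by (intro AE_I2 tendsto_intros lim)
          show "AE t in scalar_measure E x. norm (U i t * indicator {0<..} t) \<le> u t * indicator {0<..} t" for i
            using Uu seq(2) by (intro AE_I2) (simp add: indicator_def)
        qed (use op_integralD(1)[OF R] op_integralD(1)[OF S] in auto)
      qed
      also have "\<dots> = (\<integral>\<^sup>+t. (SUP i. ennreal (U i t)) \<partial>trace_measure \<tau> E)"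
        unfolding \<tau>R using seq(1) inc
        by (intro nn_integral_monotone_convergence_SUP[symmetric]) (auto simp: incseq_def le_fun_def intro!: ennreal_leI)
      also have "\<dots> = (\<integral>\<^sup>+t. ennreal (u t) \<partial>trace_measure \<tau> E)"
      proof (rule nn_integral_cong)
        fix t
        have "(\<lambda>i. ennreal (U i t)) \<longlonglongrightarrow> ennreal (u t)" by (intro tendsto_ennrealI lim)
        moreover have "incseq (\<lambda>i. ennreal (U i t))"
          using inc[of t] by (auto simp: incseq_def intro!: ennreal_leI)
        ultimately show "(SUP i. ennreal (U i t)) = ennreal (u t)" using LIMSEQ_SUP LIMSEQ_unique by blast
      qed
      finally show "\<tau> S = (\<integral>\<^sup>+t. ennreal (u t) \<partial>trace_measure \<tau> E)" .
    qed
  qed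
  then show ?thesis using K S unfolding P_def by blast
qed

end

lemma von_neumann_bicommutant:
  assumes "von_neumann_algebra N" "T \<in> N" shows "commutant (commutant {T}) \<subseteq> N"
  using bicommutant_mono[of "{T}" N] assms by (auto simp: von_neumann_algebra_def)

theorem trace_measure_op_pos:
  fixes N :: "('h::complex_hilbert \<Rightarrow>\<^sub>L 'h) set"
  assumes vN: "von_neumann_algebra N" and trace: "trace_on N \<tau>" "normal_trace N \<tau>"
    and T: "T \<in> N" "op_pos T"
  obtains r m where "0 < r" "sets m = sets borel" "AE l in m. l \<in> {0<..r}"
    "\<And>(f :: real \<Rightarrow> real) K. f \<in> borel_measurable borel \<Longrightarrow> f 0 = 0 \<Longrightarrow> (\<And>t. t \<in> {0..r} \<Longrightarrow> 0 \<le> f t \<and> f t \<le> K) \<Longrightarrow>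
       \<tau> (fun_calc f T) = (\<integral>\<^sup>+t. ennreal (f t) \<partial>m)"
    "\<And>(f :: real \<Rightarrow> real) K s. f \<in> borel_measurable borel \<Longrightarrow> f 0 = 0 \<Longrightarrow> (\<And>t. t \<in> {0..r} \<Longrightarrow> 0 \<le> f t \<and> f t \<le> K) \<Longrightarrow>
       0 \<le> s \<Longrightarrow> \<tau> (spectral_measure (op_abs (fun_calc f T)) {s<..}) = emeasure m {l. s < f l}"
proof -
  obtain r where r: "0 < r" and spec: "is_spectral T (spectral_measure T)"
    and D: "spectral_measure T {0..r} = id_blinfun"
    and W: "\<And>B. B \<in> sets borel \<Longrightarrow> spectral_measure T B \<in> commutant (commutant {T})"
    using spectral_measure_op_pos[OF T(2)] by metis
  define E where "E = spectral_measure T"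
  have Tb: "T \<in> bop" using T(2) by (simp add: op_pos_def)
  have E: "pvm E" using spec by (simp add: E_def is_spectral_def)
  have EN: "E B \<in> N" if "B \<in> sets borel" for B
    using W[OF that] von_neumann_bicommutant[OF vN T(1)] by (auto simp: E_def)
  note ctx = vN trace E EN
  have Dm: "{0..r} \<in> sets borel" by simp
  define m where "m = trace_measure \<tau> E"
  have em: "emeasure m B = \<tau> (E (B \<inter> {0<..}))" if "B \<in> sets borel" for B
    unfolding m_def by (rule emeasure_trace_measure[OF ctx that])
  have restr: "E B = E (B \<inter> {0..r})" if "B \<in> sets borel" for B
    using pvm_Int[OF E that Dm] D by (intro blinfun_eqI) (simp add: E_def)
  have "emeasure m (- {0<..r}) = 0"
  proof -
    have "(- {0<..r} \<inter> {0<..}) \<inter> {0..r} = {}" by auto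
    then have "E (- {0<..r} \<inter> {0<..}) = 0"
      using restr[of "- {0<..r} \<inter> {0<..}"] pvm_empty[OF E] by simp
    then show ?thesis using trace_0[OF ctx] by (simp add: em)
  qed
  then have "- {0<..r} \<in> null_sets m" by (auto simp: m_def)
  from AE_not_in[OF this] have AE: "AE l in m. l \<in> {0<..r}" by eventually_elim auto
  show thesis
  proof (rule that[OF r _ AE])
    fix f :: "real \<Rightarrow> real" and K assume f: "f \<in> borel_measurable borel" "f 0 = 0" and K: "\<And>t. t \<in> {0..r} \<Longrightarrow> 0 \<le> f t \<and> f t \<le> K"
    have [measurable]: "f \<in> borel_measurable borel" by (rule f)
    have absK: "\<bar>f t\<bar> \<le> K" if "t \<in> {0..r}" for t using K[OF that] by simp
    define g where "g t = f t * indicator {0..r} t" for t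
    have [measurable]: "g \<in> borel_measurable borel" unfolding g_def[abs_def] by measurable
    have K0: "0 \<le> K" using K[of 0] r f by auto
    have g: "0 \<le> g t" "g t \<le> K" for t using K[of t] K0 by (auto simp: g_def indicator_def)
    have "op_integral E (\<lambda>t. f t * indicator {0..r} t) (fun_calc f T)"
      unfolding E_def by (rule fun_calc_op_integral(1)[OF Tb spec Dm D f(1) absK])
    moreover have "(\<lambda>t. f t * indicator {0..r} t) = (\<lambda>t. g t * indicator {0<..} t)"
      using f(2) by (auto simp: g_def indicator_def fun_eq_iff)
    ultimately have "op_integral E (\<lambda>t. g t * indicator {0<..} t) (fun_calc f T)" by simp
    then have "\<tau> (fun_calc f T) = (\<integral>\<^sup>+t. ennreal (g t) \<partial>m)"
      unfolding m_def by (intro trace_op_integral[OF ctx _ g]) auto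
    also have "\<dots> = (\<integral>\<^sup>+t. ennreal (f t) \<partial>m)"
      by (rule nn_integral_cong_AE) (use AE in eventually_elim, auto simp: g_def)
    finally show "\<tau> (fun_calc f T) = (\<integral>\<^sup>+t. ennreal (f t) \<partial>m)" .
    fix s :: real assume s: "0 \<le> s"
    have pre: "f -` {s<..} \<in> sets borel" using measurable_sets_borel[OF f(1), of "{s<..}"] by simp
    have "op_abs (fun_calc f T) = fun_calc f T"
      by (rule op_abs_fun_calc[OF Tb spec Dm D f(1) absK]) (use K in auto)
    moreover have "spectral_measure (fun_calc f T) = (\<lambda>B. if B \<in> sets borel then spectral_measure T (f -` B) else 0)"
      by (rule spectral_measure_fun_calc(1)[OF Tb spec Dm D f(1) absK])
    ultimately have "spectral_measure (op_abs (fun_calc f T)) {s<..} = E (f -` {s<..})"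
      by (simp add: E_def)
    also have "\<dots> = E (f -` {s<..} \<inter> {0..r})" by (rule restr[OF pre])
    also have "f -` {s<..} \<inter> {0..r} = (f -` {s<..} \<inter> {0<..}) \<inter> {0..r}"
      using f(2) s by (auto simp: less_le)
    also have "E \<dots> = E (f -` {s<..} \<inter> {0<..})" using pre by (intro restr[symmetric]) auto
    finally have "\<tau> (spectral_measure (op_abs (fun_calc f T)) {s<..}) = emeasure m (f -` {s<..})"
      by (simp add: em[OF pre])
    also have "f -` {s<..} = {l. s < f l}" by auto
    finally show "\<tau> (spectral_measure (op_abs (fun_calc f T)) {s<..}) = emeasure m {l. s < f l}" .
  qed (simp add: m_def)
qed

section \<open>Karamata's Tauberian theorem\<close>

lemma weak_conv_moments:
  assumes M: "\<And>n. real_distribution (M n)" "\<And>n. AE t in M n. t \<in> {0..1}"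
    and L: "real_distribution L" "AE t in L. t \<in> {0..1}"
    and lim: "\<And>k. (\<lambda>n. \<integral>t. t ^ k \<partial>M n) \<longlonglongrightarrow> (\<integral>t. t ^ k \<partial>L)"
  shows "weak_conv_m M L"
proof (rule integral_cts_step_conv_imp_weak_conv[OF M(1) L(1)])
  fix x y :: real assume xy: "x < y"
  let ?f = "cts_step x y"
  have cont: "continuous_on UNIV ?f"
    by (rule uniformly_continuous_imp_continuous[OF cts_step_uniformly_continuous[OF xy]])
  then have [measurable]: "?f \<in> borel_measurable borel" by (rule borel_measurable_continuous_onI)
  show "(\<lambda>n. \<integral>t. ?f t \<partial>M n) \<longlonglongrightarrow> (\<integral>t. ?f t \<partial>L)"
  proof (rule LIMSEQ_I)
    fix e :: real assume e: "0 < e"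
    obtain g where g: "real_polynomial_function g" "\<And>t. t \<in> {0..1} \<Longrightarrow> \<bar>?f t - g t\<bar> < e / 3"
      using Stone_Weierstrass_real_polynomial_function[of "{0..1::real}" ?f "e / 3"] e
        continuous_on_subset[OF cont] by auto
    have [measurable]: "g \<in> borel_measurable borel" by (rule borel_measurable_real_polynomial_function[OF g(1)])
    obtain c d where gc: "g = (\<lambda>t. \<Sum>i\<le>d. c i * t ^ i)"
      using g(1) unfolding real_polynomial_function_iff_sum by metis
    have P: "\<bar>(\<integral>t. ?f t \<partial>P) - (\<integral>t. g t \<partial>P)\<bar> \<le> e / 3" "(\<integral>t. g t \<partial>P) = (\<Sum>i\<le>d. c i * (\<integral>t. t ^ i \<partial>P))"
      if P: "real_distribution P" "AE t in P. t \<in> {0..1}" for P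
    proof -
      interpret real_distribution P by fact
      have AE1: "AE t in P. t \<in> {-1..1}" using P(2) by eventually_elim auto
      have pow: "integrable P (\<lambda>t. t ^ i)" for i
        by (rule integrable_power_AE[OF _ _ AE1]) (auto intro: finite_measure_axioms)
      show "(\<integral>t. g t \<partial>P) = (\<Sum>i\<le>d. c i * (\<integral>t. t ^ i \<partial>P))"
        by (simp add: gc pow)
      have ig: "integrable P g" by (simp add: gc pow)
      have "\<bar>(\<integral>t. ?f t \<partial>P) - (\<integral>t. g t \<partial>P)\<bar> = \<bar>\<integral>t. ?f t - g t \<partial>P\<bar>"
        by (simp add: integrable_cts_step[OF xy] ig)
      also have "\<dots> \<le> (\<integral>t. \<bar>?f t - g t\<bar> \<partial>P)" by (rule integral_abs_bound)
      also have "\<dots> \<le> (\<integral>t. e / 3 \<partial>P)"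
      proof (rule integral_mono_AE)
        show "AE t in P. \<bar>?f t - g t\<bar> \<le> e / 3"
          using P(2) by eventually_elim (use g(2) in \<open>auto intro: less_imp_le\<close>)
        show "integrable P (\<lambda>t. \<bar>?f t - g t\<bar>)" using integrable_cts_step[OF xy] ig by simp
      qed simp
      also have "\<dots> = e / 3" using prob_space by simp
      finally show "\<bar>(\<integral>t. ?f t \<partial>P) - (\<integral>t. g t \<partial>P)\<bar> \<le> e / 3" .
    qed
    have "(\<lambda>n. \<integral>t. g t \<partial>M n) \<longlonglongrightarrow> (\<integral>t. g t \<partial>L)"
      unfolding P(2)[OF M] P(2)[OF L] by (intro tendsto_intros lim)
    then obtain N where N: "\<And>n. n \<ge> N \<Longrightarrow> norm ((\<integral>t. g t \<partial>M n) - (\<integral>t. g t \<partial>L)) < e / 3"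
      using LIMSEQ_D[of _ _ "e / 3"] e by force
    have "norm ((\<integral>t. ?f t \<partial>M n) - (\<integral>t. ?f t \<partial>L)) < e" if "n \<ge> N" for n
      using N[OF that] P(1)[OF M, of n] P(1)[OF L] unfolding real_norm_def by argo
    then show "\<exists>N. \<forall>n\<ge>N. norm ((\<integral>t. ?f t \<partial>M n) - (\<integral>t. ?f t \<partial>L)) < e"
      by blast
  qed
qed

lemma Gamma_nn_integral_scaled:
  assumes q: "0 < (q :: real)" and c: "0 < c"
  shows "(\<integral>\<^sup>+x. ennreal (indicator {0..} x * x powr (q - 1) / exp (c * x)) \<partial>lborel) = ennreal (Gamma q * c powr (- q))"
proof -
  let ?J = "\<integral>\<^sup>+x. ennreal (indicator {0..} x * x powr (q - 1) / exp (c * x)) \<partial>lborel"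
  have "ennreal (Gamma q) = (\<integral>\<^sup>+x. ennreal (indicator {0..} x * x powr (q - 1) / exp x) \<partial>lborel)"
    by (rule Gamma_conv_nn_integral_real[OF q])
  also have "\<dots> = c * (\<integral>\<^sup>+x. ennreal (indicator {0..} (c * x) * (c * x) powr (q - 1) / exp (c * x)) \<partial>lborel)"
    using nn_integral_real_affine[of "\<lambda>x. ennreal (indicator {0..} x * x powr (q - 1) / exp x)" c 0] c by simp
  also have "(\<integral>\<^sup>+x. ennreal (indicator {0..} (c * x) * (c * x) powr (q - 1) / exp (c * x)) \<partial>lborel) =
      (\<integral>\<^sup>+x. ennreal (c powr (q - 1)) * ennreal (indicator {0..} x * x powr (q - 1) / exp (c * x)) \<partial>lborel)"
    using c by (intro nn_integral_cong)
      (auto simp: indicator_def zero_le_mult_iff powr_mult simp flip: ennreal_mult)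
  also have "\<dots> = ennreal (c powr (q - 1)) * ?J" by (rule nn_integral_cmult) measurable
  also have "ennreal c * (ennreal (c powr (q - 1)) * ?J) = ennreal (c powr q) * ?J"
    using c by (simp add: powr_diff mult.assoc[symmetric] flip: ennreal_mult)
  finally have "ennreal (c powr (- q)) * ennreal (Gamma q) = ennreal (c powr (- q)) * (ennreal (c powr q) * ?J)"
    by simp
  also have "\<dots> = ?J"
    using c by (simp add: mult.assoc[symmetric] powr_minus flip: ennreal_mult)
  finally show ?thesis using Gamma_real_pos[OF q] by (simp add: ennreal_mult mult.commute)
qed

text \<open>The law of \<open>exp (- x)\<close> for a Gamma-distributed \<open>x\<close>.\<close>

lemma exp_gamma_law:
  assumes q: "0 < (q :: real)"
  obtains L where "real_distribution L" "AE t in L. t \<in> {0..1}" "\<And>y. emeasure L {y} = 0"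
    "\<And>k. (\<integral>t. t ^ k \<partial>L) = real (Suc k) powr (- q)"
proof -
  define d where "d x = indicator {0..} x * x powr (q - 1) / exp x / Gamma q" for x
  have G: "0 < Gamma q" using q by (rule Gamma_real_pos)
  have d0: "0 \<le> d x" for x using G by (auto simp: d_def indicator_def)
  have [measurable]: "d \<in> borel_measurable borel" unfolding d_def[abs_def] by measurable
  have dk: "(\<integral>\<^sup>+x. ennreal (d x * exp (- x) ^ k) \<partial>lborel) = ennreal (real (Suc k) powr (- q))" for k
  proof -
    have "(\<integral>\<^sup>+x. ennreal (d x * exp (- x) ^ k) \<partial>lborel) =
      (\<integral>\<^sup>+x. ennreal (1 / Gamma q) * ennreal (indicator {0..} x * x powr (q - 1) / exp (real (Suc k) * x)) \<partial>lborel)"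
    proof (rule nn_integral_cong)
      fix x
      have "exp (- x) ^ k = exp (- (real k * x))" by (simp flip: exp_of_nat_mult)
      then have "d x * exp (- x) ^ k = 1 / Gamma q * (indicator {0..} x * x powr (q - 1) / exp (real (Suc k) * x))"
        by (simp add: d_def exp_minus exp_add distrib_right field_simps)
      then show "ennreal (d x * exp (- x) ^ k) =
          ennreal (1 / Gamma q) * ennreal (indicator {0..} x * x powr (q - 1) / exp (real (Suc k) * x))"
        using G by (simp only:) (subst ennreal_mult, auto)
    qed
    also have "\<dots> = ennreal (1 / Gamma q) * ennreal (Gamma q * real (Suc k) powr (- q))"
      by (subst nn_integral_cmult, measurable) (simp only: Gamma_nn_integral_scaled[OF q, of "real (Suc k)"] of_nat_0_less_iff zero_less_Suc)
    also have "\<dots> = ennreal (real (Suc k) powr (- q))"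
      using G by (simp flip: ennreal_mult)
    finally show ?thesis .
  qed
  define D where "D = density lborel (\<lambda>x. ennreal (d x))"
  have "prob_space D"
    by (rule prob_spaceI) (use dk[of 0] in \<open>simp add: D_def emeasure_density\<close>)
  then interpret D: prob_space D .
  define L where "L = distr D borel (\<lambda>x. exp (- x))"
  have meas: "(\<lambda>x. exp (- x)) \<in> borel_measurable D" by (simp add: D_def)
  show thesis
  proof (rule that)
    show "real_distribution L" unfolding L_def by (rule D.real_distribution_distr[OF meas])
    have "AE x in D. 0 \<le> x"
      unfolding D_def by (subst AE_density) (auto simp: d_def indicator_def)
    then have "AE x in D. exp (- x) \<in> {0..1::real}" by eventually_elim simp
    then show "AE t in L. t \<in> {0..1}" unfolding L_def by (subst AE_distr_iff[OF meas]) auto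
    show "emeasure L {y} = 0" for y
    proof -
      have "emeasure L {y} = emeasure D ((\<lambda>x. exp (- x)) -` {y} \<inter> space D)"
        unfolding L_def by (rule emeasure_distr[OF meas]) simp
      also have "\<dots> \<le> emeasure D {- ln y}"
        by (rule emeasure_mono) (auto simp: D_def)
      also have "\<dots> = 0"
      proof -
        have "AE x in lborel. ennreal (d x) * indicator {- ln y} x = 0"
          using AE_lborel_singleton[of "- ln y"] by eventually_elim (simp add: indicator_def)
        then have "(\<integral>\<^sup>+x. ennreal (d x) * indicator {- ln y} x \<partial>lborel) = 0"
          by (subst nn_integral_0_iff_AE) auto
        then show ?thesis unfolding D_def by (subst emeasure_density) auto
      qed
      finally show ?thesis by simp
    qed
    fix k
    have "(\<integral>t. t ^ k \<partial>L) = (\<integral>x. exp (- x) ^ k \<partial>D)"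
      unfolding L_def by (subst integral_distr[OF meas]) auto
    also have "\<dots> = (\<integral>x. d x * exp (- x) ^ k \<partial>lborel)"
      unfolding D_def by (subst integral_density) (auto simp: d0)
    also have "\<dots> = enn2real (\<integral>\<^sup>+x. ennreal (d x * exp (- x) ^ k) \<partial>lborel)"
      by (rule integral_eq_nn_integral) (auto simp: d0)
    also have "\<dots> = real (Suc k) powr (- q)" by (simp add: dk del: of_nat_Suc)
    finally show "(\<integral>t. t ^ k \<partial>L) = real (Suc k) powr (- q)" .
  qed
qed

theorem karamata_tauberian:
  fixes M :: "'a measure" and X :: "'a \<Rightarrow> real" and q C :: real
  defines "H \<equiv> \<lambda>t. \<integral>x. exp (- (t * X x)) \<partial>M"
  assumes X: "X \<in> borel_measurable M" "\<And>x. x \<in> space M \<Longrightarrow> 0 \<le> X x" and q: "0 < q"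
    and int: "\<And>t. 0 < t \<Longrightarrow> integrable M (\<lambda>x. exp (- (t * X x)))"
    and lim: "((\<lambda>t. t powr q * H t) \<longlongrightarrow> C) (at_right 0)"
  obtains K where "0 \<le> K" "((\<lambda>t. t powr q * measure M {x \<in> space M. t * X x < 1}) \<longlongrightarrow> K) (at_right 0)"
proof -
  note [measurable] = X(1)
  have H0: "0 \<le> H t" for t by (simp add: H_def)
  define m where "m t = measure M {x \<in> space M. t * X x < 1}" for t
  have ind_int: "integrable M (indicator {x \<in> space M. t * X x < 1} :: _ \<Rightarrow> real)"
    and m_le: "m t \<le> exp 1 * H t" if t: "0 < t" for t
  proof -
    have le: "indicator {x \<in> space M. t * X x < 1} x \<le> exp 1 * exp (- (t * X x))" if "x \<in> space M" for x
      by (auto simp: indicator_def simp flip: exp_add)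
    show int_i: "integrable M (indicator {x \<in> space M. t * X x < 1} :: _ \<Rightarrow> real)"
      by (rule Bochner_Integration.integrable_bound[OF integrable_mult_right[OF int[OF t], of "exp 1"]])
        (use le in \<open>auto intro!: AE_I2\<close>)
    have "m t = (\<integral>x. indicator {x \<in> space M. t * X x < 1} x \<partial>M)" by (simp add: m_def)
    also have "\<dots> \<le> (\<integral>x. exp 1 * exp (- (t * X x)) \<partial>M)"
      using int_i le by (intro integral_mono integrable_mult_right int t)
    finally show "m t \<le> exp 1 * H t" by (simp add: H_def)
  qed
  have m0: "0 \<le> m t" for t by (simp add: m_def)
  have "0 \<le> C"
    by (rule tendsto_lowerbound[OF lim]) (auto simp: H0 intro!: always_eventually)
  show thesis
  proof (cases "C = 0")
    case True
    have "((\<lambda>t. t powr q * m t) \<longlongrightarrow> 0) (at_right 0)"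
    proof (rule Lim_null_comparison)
      show "\<forall>\<^sub>F t in at_right 0. norm (t powr q * m t) \<le> exp 1 * (t powr q * H t)"
        using eventually_at_right_less[of 0]
      proof eventually_elim
        case (elim t)
        have "t powr q * m t \<le> t powr q * (exp 1 * H t)" by (intro mult_left_mono m_le elim) simp
        then show ?case by (simp add: m0 mult_ac)
      qed
      show "((\<lambda>t. exp 1 * (t powr q * H t)) \<longlongrightarrow> 0) (at_right 0)"
        using tendsto_mult_right_zero[OF lim[unfolded True], of "exp 1"] by simp
    qed
    then show thesis using that[of 0] by (simp add: m_def)
  next
    case False
    then have C: "0 < C" using \<open>0 \<le> C\<close> by simp
    obtain L where L: "real_distribution L" "AE t in L. t \<in> {0..1}" "\<And>y. emeasure L {y} = 0"
      "\<And>k. (\<integral>t. t ^ k \<partial>L) = real (Suc k) powr (- q)" by (rule exp_gamma_law[OF q]) blast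
    define \<phi> where "\<phi> y = (if exp (-1) < y then 1 / y else 0)" for y :: real
    have [measurable]: "\<phi> \<in> borel_measurable borel" unfolding \<phi>_def[abs_def] by measurable
    have \<phi>0: "0 \<le> \<phi> y" for y
    proof -
      have "0 < y" if "exp (-1) < y" using that by (rule less_trans[OF exp_gt_zero])
      then show ?thesis by (auto simp: \<phi>_def intro: less_imp_le)
    qed
    have \<phi>_le: "norm (\<phi> y) \<le> exp 1" for y
    proof (cases "exp (-1) < y")
      case True
      then have "0 < y" by (rule less_trans[OF exp_gt_zero])
      moreover have "1 \<le> exp 1 * y" using True by (simp add: exp_minus field_simps)
      ultimately show ?thesis using True by (simp add: \<phi>_def field_simps)
    qed (simp add: \<phi>_def)
    have \<phi>_cont: "isCont \<phi> y" if "y \<noteq> exp (-1)" for y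
    proof (cases "exp (-1) < y")
      case True
      then have y: "y \<noteq> 0" using less_trans[OF exp_gt_zero True] by simp
      have "\<forall>\<^sub>F z in nhds y. z \<in> {exp (-1)<..}" using True by (intro eventually_nhds_in_open) auto
      then have "\<forall>\<^sub>F z in nhds y. \<phi> z = 1 / z" by eventually_elim (simp add: \<phi>_def)
      moreover have "isCont (\<lambda>z. 1 / z) y" using y by (intro continuous_intros)
      ultimately show ?thesis by (simp add: isCont_cong)
    next
      case False
      then have "\<forall>\<^sub>F z in nhds y. z \<in> {..<exp (-1)}"
        using that by (intro eventually_nhds_in_open) auto
      then have "\<forall>\<^sub>F z in nhds y. \<phi> z = 0" by eventually_elim (simp add: \<phi>_def)
      then show ?thesis by (simp add: isCont_cong)
    qed
    define \<kappa> where "\<kappa> = (\<integral>y. \<phi> y \<partial>L)"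
    have "\<forall>\<^sub>F t in at_right 0. 0 < t powr q * H t" using lim C by (rule order_tendstoD)
    then obtain b where b: "0 < b" "\<And>t. 0 < t \<Longrightarrow> t < b \<Longrightarrow> 0 < t powr q * H t"
      unfolding eventually_at_right_field by auto
    have "((\<lambda>t. t powr q * m t) \<longlongrightarrow> C * \<kappa>) (at_right 0)"
    proof (rule tendsto_at_right_sequentially[OF b(1)])
      fix S :: "nat \<Rightarrow> real" assume S: "\<And>n. 0 < S n" "\<And>n. S n < b" "S \<longlonglongrightarrow> 0"
      have HS: "0 < H (S n)" for n using b(2)[OF S(1,2), of n] S(1)[of n] by (simp add: zero_less_mult_iff)
      have S_at: "filterlim S (at_right 0) sequentially"
        using S by (intro tendsto_imp_filterlim_at_right) auto
      have limS: "(\<lambda>n. S n powr q * H (S n)) \<longlonglongrightarrow> C"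
        by (rule filterlim_compose[OF lim S_at])
      define \<delta> where "\<delta> n x = exp (- (S n * X x)) / H (S n)" for n x
      have \<delta>0: "0 \<le> \<delta> n x" for n x using HS[of n] by (simp add: \<delta>_def)
      have [measurable]: "\<delta> n \<in> borel_measurable M" for n unfolding \<delta>_def[abs_def] by measurable
      define P where "P n = density M (\<lambda>x. ennreal (\<delta> n x))" for n
      have "prob_space (P n)" for n
      proof (rule prob_spaceI)
        have "(\<integral>\<^sup>+x. ennreal (\<delta> n x) \<partial>M) = ennreal (\<integral>x. \<delta> n x \<partial>M)"
          unfolding \<delta>_def using HS[of n] by (intro nn_integral_eq_integral integrable_divide_zero int S) auto
        also have "(\<integral>x. \<delta> n x \<partial>M) = 1" using HS[of n] by (simp add: \<delta>_def H_def)
        finally show "emeasure (P n) (space (P n)) = 1" by (simp add: P_def emeasure_density cong: nn_integral_cong)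
      qed
      then have Pn: "prob_space (P n)" for n .
      define Y where "Y n x = exp (- (S n * X x))" for n x
      have Y: "Y n \<in> borel_measurable (P n)" for n unfolding Y_def[abs_def] P_def by measurable
      define Q where "Q n = distr (P n) borel (Y n)" for n
      have Qd: "real_distribution (Q n)" for n
        unfolding Q_def by (rule prob_space.real_distribution_distr[OF Pn Y])
      have Q01: "AE t in Q n. t \<in> {0..1}" for n
        unfolding Q_def
      proof (subst AE_distr_iff[OF Y])
        show "AE x in P n. Y n x \<in> {0..1}"
          using X(2) S(1)[of n] by (intro AE_I2) (auto simp: P_def Y_def)
      qed auto
      have Qint: "(\<integral>y. f y \<partial>Q n) = (\<integral>x. \<delta> n x * f (Y n x) \<partial>M)"
        if [measurable]: "f \<in> borel_measurable borel" for f :: "real \<Rightarrow> real" and n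
      proof -
        have [measurable]: "Y n \<in> borel_measurable M" using Y[of n] by (simp add: P_def)
        have "(\<integral>y. f y \<partial>Q n) = (\<integral>x. f (Y n x) \<partial>P n)"
          unfolding Q_def by (rule integral_distr[OF Y that])
        also have "\<dots> = (\<integral>x. \<delta> n x *\<^sub>R f (Y n x) \<partial>M)"
          unfolding P_def by (rule integral_density) (auto simp: \<delta>0)
        finally show ?thesis by simp
      qed
      have "weak_conv_m Q L"
      proof (rule weak_conv_moments[OF Qd Q01 L(1,2)])
        fix k
        have mom: "(\<integral>t. t ^ k \<partial>Q n) = real (Suc k) powr (- q) *
            (((real (Suc k) * S n) powr q * H (real (Suc k) * S n)) / (S n powr q * H (S n)))" for n
        proof -
          have "(\<integral>t. t ^ k \<partial>Q n) = (\<integral>x. \<delta> n x * Y n x ^ k \<partial>M)"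
            by (rule Qint) simp
          also have "\<dots> = (\<integral>x. exp (- (real (Suc k) * S n * X x)) / H (S n) \<partial>M)"
            by (intro Bochner_Integration.integral_cong refl)
              (simp add: \<delta>_def Y_def algebra_simps flip: exp_of_nat_mult exp_add)
          also have "\<dots> = H (real (Suc k) * S n) / H (S n)" by (simp add: H_def)
          also have "\<dots> = real (Suc k) powr (- q) *
              (((real (Suc k) * S n) powr q * H (real (Suc k) * S n)) / (S n powr q * H (S n)))"
            using S(1)[of n] by (simp add: powr_mult powr_minus field_simps del: of_nat_Suc)
          finally show ?thesis .
        qed
        have "filterlim (\<lambda>n. real (Suc k) * S n) (at_right 0) sequentially"
          using S tendsto_mult_right_zero[OF S(3), of "real (Suc k)"]
          by (intro tendsto_imp_filterlim_at_right always_eventually allI mult_pos_pos) auto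
        from filterlim_compose[OF lim this]
        have "(\<lambda>n. \<integral>t. t ^ k \<partial>Q n) \<longlonglongrightarrow> real (Suc k) powr (- q) * (C / C)"
          unfolding mom using C by (intro tendsto_intros limS) auto
        then show "(\<lambda>n. \<integral>t. t ^ k \<partial>Q n) \<longlonglongrightarrow> (\<integral>t. t ^ k \<partial>L)"
          using C by (simp add: L(4) del: of_nat_Suc)
      qed
      then have "(\<lambda>n. \<integral>y. \<phi> y \<partial>Q n) \<longlonglongrightarrow> \<kappa>"
        unfolding \<kappa>_def
      proof (rule weak_conv_imp_bdd_ae_continuous_conv[OF Qd L(1)])
        have "{y. \<not> isCont \<phi> y} \<subseteq> {exp (-1)}" using \<phi>_cont by auto
        then have "emeasure L {y. \<not> isCont \<phi> y} \<le> emeasure L {exp (-1)}"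
          using real_distribution.events_eq_borel[OF L(1)] by (intro emeasure_mono) auto
        then show "emeasure L {y. \<not> isCont \<phi> y} = 0" by (simp add: L(3))
      qed (rule \<phi>_le, measurable)
      moreover have "(\<integral>y. \<phi> y \<partial>Q n) = m (S n) / H (S n)" for n
      proof -
        have "(\<integral>y. \<phi> y \<partial>Q n) = (\<integral>x. \<delta> n x * \<phi> (Y n x) \<partial>M)"
          by (rule Qint) measurable
        also have "\<dots> = (\<integral>x. indicator {x \<in> space M. S n * X x < 1} x / H (S n) \<partial>M)"
          by (intro Bochner_Integration.integral_cong refl) (auto simp: \<delta>_def Y_def \<phi>_def indicator_def)
        also have "\<dots> = m (S n) / H (S n)" by (simp add: m_def)
        finally show ?thesis .
      qed
      ultimately have "(\<lambda>n. (S n powr q * H (S n)) * (m (S n) / H (S n))) \<longlonglongrightarrow> C * \<kappa>"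
        by (intro tendsto_mult limS) simp
      moreover have "(S n powr q * H (S n)) * (m (S n) / H (S n)) = S n powr q * m (S n)" for n
        using HS[of n] by simp
      ultimately show "(\<lambda>n. S n powr q * m (S n)) \<longlonglongrightarrow> C * \<kappa>" by simp
    qed
    moreover have "0 \<le> \<kappa>" unfolding \<kappa>_def by (simp add: \<phi>0)
    ultimately show thesis using that[of "C * \<kappa>"] C by (simp add: m_def)
  qed
qed

section \<open>The residue of the zeta function of a measure\<close>

lemma nn_integral_powr_from_0:
  assumes a: "-1 < (a :: real)" and c: "0 \<le> c"
  shows "(\<integral>\<^sup>+x. ennreal (indicator {0<..c} x * x powr a) \<partial>lborel) = ennreal (c powr (a + 1) / (a + 1))"
proof -
  have "((\<lambda>x. if x \<in> {0..c} then x powr a else 0) has_integral c powr (a + 1) / (a + 1)) UNIV"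
    using has_integral_powr_from_0[OF a c] by (simp only: has_integral_restrict_UNIV)
  also have "(\<lambda>x. if x \<in> {0..c} then x powr a else 0) = (\<lambda>x. indicator {0<..c} x * x powr a)"
    by (auto simp: indicator_def fun_eq_iff)
  finally show ?thesis by (intro nn_integral_has_integral_lborel) (auto simp: indicator_def)
qed

lemma nn_integral_powr_layer_cake:
  fixes m :: "real measure"
  assumes m: "sets m = sets borel" "AE l in m. 0 < l" and fin: "\<And>u. 0 < u \<Longrightarrow> emeasure m {u<..} < \<infinity>"
    and s: "0 < s"
  shows "(\<integral>\<^sup>+l. ennreal (l powr s) \<partial>m) = (\<integral>\<^sup>+u. ennreal (indicator {0<..} u * s * u powr (s - 1)) * emeasure m {u<..} \<partial>lborel)"
proof -
  note [measurable_cong] = m(1)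
  have sp: "space m = UNIV" using sets_eq_imp_space_eq[OF m(1)] by simp
  interpret m: sigma_finite_measure m
  proof
    let ?A = "insert {..0} (range (\<lambda>n. {1 / real (Suc n)<..}))"
    have "emeasure m {..0} = 0"
      using AE_iff_measurable[of "{..0}" m "\<lambda>l. 0 < l"] m by (auto simp: sp not_less)
    then have "emeasure m a \<noteq> \<infinity>" if "a \<in> ?A" for a
      using that fin by (auto simp: less_top)
    moreover have "\<Union>?A = space m"
    proof -
      have "x \<in> \<Union>?A" for x :: real
      proof (cases "x \<le> 0")
        case False
        then obtain n where "inverse (real (Suc n)) < x" using reals_Archimedean[of x] by auto
        then have "x \<in> {1 / real (Suc n)<..}" by (simp add: inverse_eq_divide)
        then show ?thesis by blast
      qed auto
      then show ?thesis by (auto simp: sp)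
    qed
    ultimately show "\<exists>A. countable A \<and> A \<subseteq> sets m \<and> \<Union>A = space m \<and> (\<forall>a\<in>A. emeasure m a \<noteq> \<infinity>)"
      by (intro exI[of _ ?A]) (auto simp: m(1))
  qed
  interpret pair_sigma_finite lborel m ..
  have "(\<integral>\<^sup>+l. ennreal (l powr s) \<partial>m) =
      (\<integral>\<^sup>+l. (\<integral>\<^sup>+u. ennreal (indicator {0<..} u * s * u powr (s - 1)) * indicator {u<..} l \<partial>lborel) \<partial>m)"
  proof (rule nn_integral_cong_AE)
    show "AE l in m. ennreal (l powr s) =
        (\<integral>\<^sup>+u. ennreal (indicator {0<..} u * s * u powr (s - 1)) * indicator {u<..} l \<partial>lborel)"
      using m(2)
    proof eventually_elim
      case (elim l)
      have "(\<integral>\<^sup>+u. ennreal (indicator {0<..} u * s * u powr (s - 1)) * indicator {u<..} l \<partial>lborel) =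
          (\<integral>\<^sup>+u. ennreal s * ennreal (indicator {0<..l} u * u powr (s - 1)) \<partial>lborel)"
      proof (rule nn_integral_cong_AE)
        show "AE u in lborel. ennreal (indicator {0<..} u * s * u powr (s - 1)) * indicator {u<..} l =
            ennreal s * ennreal (indicator {0<..l} u * u powr (s - 1))"
          using AE_lborel_singleton[of l]
          by eventually_elim (use s in \<open>auto simp: indicator_def simp flip: ennreal_mult\<close>)
      qed
      also have "\<dots> = ennreal s * ennreal (l powr s / s)"
        using nn_integral_powr_from_0[of "s - 1" l] s elim by (subst nn_integral_cmult) auto
      also have "\<dots> = ennreal (l powr s)" using s by (simp flip: ennreal_mult)
      finally show ?case by simp
    qed
  qed
  also have "\<dots> = (\<integral>\<^sup>+u. (\<integral>\<^sup>+l. ennreal (indicator {0<..} u * s * u powr (s - 1)) * indicator {u<..} l \<partial>m) \<partial>lborel)"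
  proof (rule Fubini')
    have [measurable]: "{x :: real \<times> real. fst x < snd x} \<in> sets (borel \<Otimes>\<^sub>M borel)"
      unfolding borel_prod by (intro borel_open open_Collect_less continuous_intros)
    have "(\<lambda>x. ennreal (indicator {0<..} (fst x) * s * fst x powr (s - 1)) * indicator {x. fst x < snd x} x)
        \<in> borel_measurable (borel \<Otimes>\<^sub>M (borel :: real measure))"
      by measurable
    also have "(\<lambda>x. ennreal (indicator {0<..} (fst x) * s * fst x powr (s - 1)) * indicator {x. fst x < snd x} x) =
        (\<lambda>(u, l). ennreal (indicator {0<..} u * s * u powr (s - 1)) * indicator {u<..} l)"
      by (auto simp: indicator_def fun_eq_iff)
    also have "borel_measurable (borel \<Otimes>\<^sub>M borel) = borel_measurable (lborel \<Otimes>\<^sub>M m)"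
      by (intro measurable_cong_sets sets_pair_measure_cong) (simp_all add: m(1))
    finally show "(\<lambda>(u, l). ennreal (indicator {0<..} u * s * u powr (s - 1)) * indicator {u<..} l)
        \<in> borel_measurable (lborel \<Otimes>\<^sub>M m)" .
  qed
  also have "\<dots> = (\<integral>\<^sup>+u. ennreal (indicator {0<..} u * s * u powr (s - 1)) * emeasure m {u<..} \<partial>lborel)"
    by (intro nn_integral_cong) (simp add: nn_integral_cmult m(1))
  finally show ?thesis .
qed

theorem zeta_residue:
  fixes m :: "real measure" and p K r :: real
  assumes m: "sets m = sets borel" "AE l in m. l \<in> {0<..r}" and r: "0 < r"
    and fin: "\<And>u. 0 < u \<Longrightarrow> emeasure m {u<..} < \<infinity>"
    and p: "0 < p" and lim: "((\<lambda>u. u powr p * measure m {u<..}) \<longlongrightarrow> K) (at_right 0)"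
  shows "\<And>s. p < s \<Longrightarrow> (\<integral>\<^sup>+l. ennreal (l powr s) \<partial>m) < \<infinity>"
    and "((\<lambda>s. (s - p) * enn2real (\<integral>\<^sup>+l. ennreal (l powr s) \<partial>m)) \<longlongrightarrow> p * K) (at_right p)"
proof -
  define I where "I s = (\<integral>\<^sup>+l. ennreal (l powr s) \<partial>m)" for s
  define n where "n u = measure m {u<..}" for u
  have pos: "AE l in m. 0 < l" using m(2) by eventually_elim simp
  have em: "emeasure m {u<..} = ennreal (n u)" if "0 < u" for u
    using fin[OF that] by (simp add: n_def emeasure_eq_ennreal_measure less_top)
  have n0: "0 \<le> n u" for u by (simp add: n_def)
  have n_anti: "n v \<le> n u" if "0 < u" "u \<le> v" for u v
  proof -
    have "emeasure m {v<..} \<le> emeasure m {u<..}" using that m(1) by (intro emeasure_mono) auto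
    then show ?thesis using that n0 by (simp add: em)
  qed
  have nr: "n u = 0" if "r \<le> u" for u
  proof -
    have "AE l in m. \<not> u < l" using m(2) by eventually_elim (use that in auto)
    then show ?thesis using m(1) r that sets_eq_imp_space_eq[OF m(1)] emeasure_eq_0_AE[of "\<lambda>l. u < l" m]
      by (simp add: n_def measure_def greaterThan_def)
  qed
  have I: "I s = (\<integral>\<^sup>+u. ennreal (indicator {0<..r} u * (s * u powr (s - 1) * n u)) \<partial>lborel)" if "0 < s" for s
  proof -
    have "I s = (\<integral>\<^sup>+u. ennreal (indicator {0<..} u * s * u powr (s - 1)) * emeasure m {u<..} \<partial>lborel)"
      unfolding I_def by (rule nn_integral_powr_layer_cake[OF m(1) pos fin that])
    also have "\<dots> = (\<integral>\<^sup>+u. ennreal (indicator {0<..r} u * (s * u powr (s - 1) * n u)) \<partial>lborel)"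
    proof (rule nn_integral_cong)
      fix u :: real
      show "ennreal (indicator {0<..} u * s * u powr (s - 1)) * emeasure m {u<..} =
          ennreal (indicator {0<..r} u * (s * u powr (s - 1) * n u))"
        using nr[of u] that by (cases "0 < u") (auto simp: em indicator_def n0 simp flip: ennreal_mult)
    qed
    finally show ?thesis .
  qed
  have split: "u powr (s - 1) = u powr (s - p - 1) * u powr p" if "0 < u" for u s
    using that by (simp flip: powr_add)
  have upper: "\<exists>\<delta>>0. \<forall>s>p. I s \<le> ennreal (s * c * (r powr (s - p) / (s - p)) + s * (n \<delta> * r powr p / \<delta>) * (r powr (s - p + 1) / (s - p + 1)))"
    if c: "K < c" "0 \<le> c" for c
  proof -
    obtain \<delta> where \<delta>: "0 < \<delta>" "\<And>u. 0 < u \<Longrightarrow> u < \<delta> \<Longrightarrow> u powr p * n u < c"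
      using order_tendstoD(2)[OF lim c(1)] unfolding n_def[symmetric] eventually_at_right_field by auto
    let ?G = "n \<delta> * r powr p / \<delta>"
    have "I s \<le> ennreal (s * c * (r powr (s - p) / (s - p)) + s * ?G * (r powr (s - p + 1) / (s - p + 1)))" if s: "p < s" for s
    proof -
      have s0: "0 < s" using s p by simp
      have "I s \<le> (\<integral>\<^sup>+u. ennreal (s * c) * ennreal (indicator {0<..r} u * u powr (s - p - 1)) +
          ennreal (s * ?G) * ennreal (indicator {0<..r} u * u powr (s - p)) \<partial>lborel)"
        unfolding I[OF s0]
      proof (rule nn_integral_mono)
        fix u
        have "indicator {0<..r} u * (s * u powr (s - 1) * n u) \<le>
            s * c * (indicator {0<..r} u * u powr (s - p - 1)) + s * ?G * (indicator {0<..r} u * u powr (s - p))"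
        proof (cases "u \<in> {0<..r}")
          case True
          then have u: "0 < u" "u \<le> r" by auto
          have "u powr p * n u \<le> c + ?G * u"
          proof (cases "u < \<delta>")
            case True
            have "u powr p * n u \<le> c" using \<delta>(2)[OF u(1) True] by simp
            moreover have "0 \<le> ?G * u" using u \<delta>(1) n0 by simp
            ultimately show ?thesis by linarith
          next
            case False
            then have "u powr p * n u \<le> r powr p * n \<delta>"
              using u p \<delta>(1) n0 by (intro mult_mono powr_mono2 n_anti) auto
            also have "\<dots> = ?G * \<delta>" using \<delta>(1) by simp
            also have "\<dots> \<le> ?G * u" using False \<delta>(1) n0 by (intro mult_left_mono) auto
            finally show ?thesis using c(2) by linarith
          qed
          then have "s * u powr (s - p - 1) * (u powr p * n u) \<le> s * u powr (s - p - 1) * (c + ?G * u)"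
            using s0 by (intro mult_left_mono) auto
          moreover have "u powr (s - p) = u powr (s - p - 1) * u"
            using u by (simp add: powr_diff)
          ultimately show ?thesis using True by (simp add: split[OF u(1), of s] algebra_simps)
        qed simp
        then show "ennreal (indicator {0<..r} u * (s * u powr (s - 1) * n u)) \<le>
            ennreal (s * c) * ennreal (indicator {0<..r} u * u powr (s - p - 1)) +
            ennreal (s * ?G) * ennreal (indicator {0<..r} u * u powr (s - p))"
          using s0 c(2) \<delta>(1) n0 by (simp add: ennreal_leI flip: ennreal_mult ennreal_plus)
      qed
      also have "\<dots> = ennreal (s * c) * ennreal (r powr (s - p) / (s - p)) + ennreal (s * ?G) * ennreal (r powr (s - p + 1) / (s - p + 1))"
        using nn_integral_powr_from_0[of "s - p - 1" r] nn_integral_powr_from_0[of "s - p" r] s r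
        by (simp add: nn_integral_add nn_integral_cmult)
      also have "\<dots> = ennreal (s * c * (r powr (s - p) / (s - p)) + s * ?G * (r powr (s - p + 1) / (s - p + 1)))"
        using s s0 c(2) \<delta>(1) n0 by (simp flip: ennreal_mult ennreal_plus)
      finally show ?thesis .
    qed
    with \<delta>(1) show ?thesis by blast
  qed
  have lower: "\<exists>\<delta>>0. \<forall>s>p. ennreal (s * c * (\<delta> powr (s - p) / (s - p))) \<le> I s" if c: "c < K" "0 \<le> c" for c
  proof -
    obtain d where d: "0 < d" "\<And>u. 0 < u \<Longrightarrow> u < d \<Longrightarrow> c < u powr p * n u"
      using order_tendstoD(1)[OF lim c(1)] unfolding n_def[symmetric] eventually_at_right_field by auto
    define \<delta> where "\<delta> = min (d / 2) r"
    have \<delta>: "0 < \<delta>" "\<delta> < d" "\<delta> \<le> r" using d(1) r by (auto simp: \<delta>_def)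
    have "ennreal (s * c * (\<delta> powr (s - p) / (s - p))) \<le> I s" if s: "p < s" for s
    proof -
      have s0: "0 < s" using s p by simp
      have "ennreal (s * c * (\<delta> powr (s - p) / (s - p))) = ennreal (s * c) * ennreal (\<delta> powr (s - p) / (s - p))"
        using s0 s c(2) by (intro ennreal_mult) auto
      also have "\<dots> = (\<integral>\<^sup>+u. ennreal (s * c) * ennreal (indicator {0<..\<delta>} u * u powr (s - p - 1)) \<partial>lborel)"
        using nn_integral_powr_from_0[of "s - p - 1" \<delta>] s \<delta>(1) by (simp add: nn_integral_cmult)
      also have "\<dots> \<le> I s"
        unfolding I[OF s0]
      proof (rule nn_integral_mono)
        fix u
        have "s * c * (indicator {0<..\<delta>} u * u powr (s - p - 1)) \<le> indicator {0<..r} u * (s * u powr (s - 1) * n u)"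
        proof (cases "u \<in> {0<..\<delta>}")
          case True
          then have u: "0 < u" "u < d" "u \<le> r" using \<delta> by auto
          have "s * u powr (s - p - 1) * c \<le> s * u powr (s - p - 1) * (u powr p * n u)"
            using d(2)[OF u(1,2)] s0 by (intro mult_left_mono) auto
          then show ?thesis using True u by (simp add: split[OF u(1), of s] mult_ac)
        next
          case False
          then show ?thesis using s0 n0 by simp
        qed
        then show "ennreal (s * c) * ennreal (indicator {0<..\<delta>} u * u powr (s - p - 1)) \<le>
            ennreal (indicator {0<..r} u * (s * u powr (s - 1) * n u))"
          using s0 c(2) by (simp add: ennreal_leI flip: ennreal_mult)
      qed
      finally show ?thesis .
    qed
    with \<delta>(1) show ?thesis by blast
  qed
  have K0: "0 \<le> K"
    by (rule tendsto_lowerbound[OF lim]) (auto intro!: always_eventually)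
  have finI: "I s < \<infinity>" if "p < s" for s
    using upper[of "K + 1"] K0 that by (auto intro: le_less_trans)
  then show "\<And>s. p < s \<Longrightarrow> (\<integral>\<^sup>+l. ennreal (l powr s) \<partial>m) < \<infinity>"
    by (simp add: I_def)
  have "((\<lambda>s. (s - p) * enn2real (I s)) \<longlongrightarrow> p * K) (at_right p)"
  proof (rule order_tendstoI)
    fix a assume a: "a < p * K"
    show "\<forall>\<^sub>F s in at_right p. a < (s - p) * enn2real (I s)"
    proof (cases "a < 0")
      case True
      show ?thesis using eventually_at_right_less[of p]
        by eventually_elim (use True in \<open>auto intro: less_le_trans\<close>)
    next
      case False
      then have "a / p < K" "0 \<le> a / p" using a p by (auto simp: field_simps)
      then obtain c where c: "a / p < c" "c < K" "0 \<le> c" using dense[of "a / p" K] by auto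
      obtain \<delta> where \<delta>: "0 < \<delta>" "\<And>s. p < s \<Longrightarrow> ennreal (s * c * (\<delta> powr (s - p) / (s - p))) \<le> I s"
        using lower[OF c(2,3)] by blast
      have "((\<lambda>s. s * c * \<delta> powr (s - p)) \<longlongrightarrow> p * c * \<delta> powr (p - p)) (at_right p)"
        using \<delta>(1) by (intro tendsto_intros) auto
      moreover have "a < p * c * \<delta> powr (p - p)" using c(1) p \<delta>(1) by (simp add: field_simps)
      ultimately have "\<forall>\<^sub>F s in at_right p. a < s * c * \<delta> powr (s - p)" by (rule order_tendstoD)
      then show ?thesis using eventually_at_right_less[of p]
      proof eventually_elim
        case (elim s)
        have "s * c * (\<delta> powr (s - p) / (s - p)) \<le> enn2real (I s)"
          using enn2real_mono[OF \<delta>(2)[OF elim(2)]] finI[OF elim(2)] elim p c(3)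
          by simp
        then have "(s - p) * (s * c * (\<delta> powr (s - p) / (s - p))) \<le> (s - p) * enn2real (I s)"
          using elim by (intro mult_left_mono) auto
        moreover have "(s - p) * (s * c * (\<delta> powr (s - p) / (s - p))) = s * c * \<delta> powr (s - p)"
          using elim by simp
        ultimately show ?case using elim by linarith
      qed
    qed
  next
    fix a assume a: "p * K < a"
    then have "K < a / p" using p by (simp add: field_simps)
    then obtain c where c: "K < c" "c < a / p" using dense by blast
    have c0: "0 \<le> c" using K0 c by simp
    obtain \<delta> where \<delta>: "0 < \<delta>" "\<And>s. p < s \<Longrightarrow> I s \<le> ennreal (s * c * (r powr (s - p) / (s - p)) + s * (n \<delta> * r powr p / \<delta>) * (r powr (s - p + 1) / (s - p + 1)))"
      using upper[OF c(1) c0] by blast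
    define G where "G = n \<delta> * r powr p / \<delta>"
    have G: "0 \<le> G" using \<delta>(1) n0 by (simp add: G_def)
    have "((\<lambda>s. s * c * r powr (s - p) + (s - p) * (s * G * (r powr (s - p + 1) / (s - p + 1)))) \<longlongrightarrow>
        p * c * r powr (p - p) + (p - p) * (p * G * (r powr (p - p + 1) / (p - p + 1)))) (at_right p)"
      using r by (intro tendsto_intros) auto
    moreover have "p * c * r powr (p - p) + (p - p) * (p * G * (r powr (p - p + 1) / (p - p + 1))) < a"
      using c(2) p r by (simp add: field_simps)
    ultimately have "\<forall>\<^sub>F s in at_right p. s * c * r powr (s - p) + (s - p) * (s * G * (r powr (s - p + 1) / (s - p + 1))) < a"
      by (rule order_tendstoD)
    then show "\<forall>\<^sub>F s in at_right p. (s - p) * enn2real (I s) < a" using eventually_at_right_less[of p]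
    proof eventually_elim
      case (elim s)
      have nn: "0 \<le> s * c * (r powr (s - p) / (s - p)) + s * G * (r powr (s - p + 1) / (s - p + 1))"
        using elim p c0 G by (intro add_nonneg_nonneg mult_nonneg_nonneg divide_nonneg_pos) auto
      have "enn2real (I s) \<le> s * c * (r powr (s - p) / (s - p)) + s * G * (r powr (s - p + 1) / (s - p + 1))"
        using enn2real_mono[OF \<delta>(2)[OF elim(2)]] nn by (simp add: G_def)
      then have "(s - p) * enn2real (I s) \<le> (s - p) * (s * c * (r powr (s - p) / (s - p)) + s * G * (r powr (s - p + 1) / (s - p + 1)))"
        using elim by (intro mult_left_mono) auto
      also have "\<dots> = s * c * r powr (s - p) + (s - p) * (s * G * (r powr (s - p + 1) / (s - p + 1)))"
        using elim by (simp add: distrib_left)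
      finally show ?case using elim by linarith
    qed
  qed
  then show "((\<lambda>s. (s - p) * enn2real (\<integral>\<^sup>+l. ennreal (l powr s) \<partial>m)) \<longlongrightarrow> p * K) (at_right p)"
    by (simp add: I_def)
qed

section \<open>Generalised inverses and logarithmic means\<close>

context
  fixes N :: "real \<Rightarrow> ennreal" and b :: real and \<mu> :: "real \<Rightarrow> real"
  assumes anti: "\<And>s s'. 0 \<le> s \<Longrightarrow> s \<le> s' \<Longrightarrow> N s' \<le> N s" and b: "0 \<le> b" "N b = 0"
  defines "\<mu> \<equiv> \<lambda>t. Inf {s. 0 \<le> s \<and> N s \<le> ennreal t}"
begin

lemma generalised_inverse_bdd: "bdd_below {s. 0 \<le> s \<and> N s \<le> ennreal t}"
  by (rule bdd_belowI[of _ 0]) auto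

lemma generalised_inverse_le: "0 \<le> s \<Longrightarrow> N s \<le> ennreal t \<Longrightarrow> \<mu> t \<le> s"
  unfolding \<mu>_def by (intro cInf_lower generalised_inverse_bdd) auto

lemma generalised_inverse_ge: "(\<And>s. 0 \<le> s \<Longrightarrow> N s \<le> ennreal t \<Longrightarrow> a \<le> s) \<Longrightarrow> a \<le> \<mu> t"
  unfolding \<mu>_def using b by (intro cInf_greatest) auto

lemma generalised_inverse_nonneg: "0 \<le> \<mu> t"
  by (rule generalised_inverse_ge)

lemma generalised_inverse_le_bound: "\<mu> t \<le> b"
  using b by (intro generalised_inverse_le) auto

lemma antimono_generalised_inverse: "antimono \<mu>"
proof (rule antimonoI)
  fix t t' :: real assume "t \<le> t'"
  then show "\<mu> t' \<le> \<mu> t"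
    by (intro generalised_inverse_ge generalised_inverse_le) (auto intro: order_trans ennreal_leI)
qed

lemma generalised_inverse_asymptotics:
  assumes fin: "\<And>s. 0 < s \<Longrightarrow> N s < \<infinity>" and lim: "((\<lambda>s. s * enn2real (N s)) \<longlongrightarrow> K) (at_right 0)"
  shows "((\<lambda>t. t * \<mu> t) \<longlongrightarrow> K) at_top"
proof -
  have N: "N s = ennreal (enn2real (N s))" if "0 < s" for s using fin[OF that] by simp
  have at: "filterlim (\<lambda>t. c / t) (at_right 0) at_top" if "0 < c" for c :: real
    using that by real_asymp
  have K0: "0 \<le> K"
    by (rule tendsto_lowerbound[OF lim]) (use eventually_at_right_less[of 0] in \<open>auto elim!: eventually_mono\<close>)
  show ?thesis
  proof (rule order_tendstoI)
    fix a assume a: "a < K"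
    show "\<forall>\<^sub>F t in at_top. a < t * \<mu> t"
    proof (cases "a < 0")
      case True
      show ?thesis using eventually_gt_at_top[of 0]
        by eventually_elim (use True generalised_inverse_nonneg in \<open>auto intro: less_le_trans\<close>)
    next
      case False
      obtain c where c: "a < c" "c < K" using dense[OF a] by blast
      then have c0: "0 < c" using False by simp
      have "\<forall>\<^sub>F t in at_top. c < c / t * enn2real (N (c / t))"
        using order_tendstoD(1)[OF filterlim_compose[OF lim at[OF c0]] c(2)] .
      then show ?thesis using eventually_gt_at_top[of 0]
      proof eventually_elim
        case (elim t)
        have s: "0 < c / t" using c0 elim by simp
        have t: "t < enn2real (N (c / t))" using elim c0 by (simp add: field_simps)
        have "c / t \<le> \<mu> t"
        proof (rule generalised_inverse_ge)
          fix s assume s': "0 \<le> s" "N s \<le> ennreal t"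
          show "c / t \<le> s"
          proof (rule ccontr)
            assume "\<not> c / t \<le> s"
            then have "N (c / t) \<le> ennreal t" using anti[of s "c / t"] s' by auto
            then have "enn2real (N (c / t)) \<le> t" using enn2real_mono[of "N (c / t)" "ennreal t"] elim by simp
            then show False using t by simp
          qed
        qed
        then have "c \<le> t * \<mu> t" using elim by (simp add: field_simps)
        then show ?case using c by simp
      qed
    qed
  next
    fix a assume a: "K < a"
    obtain c where c: "K < c" "c < a" using dense[OF a] by blast
    then have c0: "0 < c" using K0 by simp
    have "\<forall>\<^sub>F t in at_top. c / t * enn2real (N (c / t)) < c"
      using order_tendstoD(2)[OF filterlim_compose[OF lim at[OF c0]] c(1)] .
    then show "\<forall>\<^sub>F t in at_top. t * \<mu> t < a" using eventually_gt_at_top[of 0]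
    proof eventually_elim
      case (elim t)
      have s: "0 < c / t" using c0 elim by simp
      have "enn2real (N (c / t)) \<le> t" using elim c0 by (simp add: field_simps)
      then have "N (c / t) \<le> ennreal t" by (subst N[OF s]) (rule ennreal_leI)
      then have "\<mu> t \<le> c / t" using s by (intro generalised_inverse_le) auto
      then have "t * \<mu> t \<le> c" using elim by (simp add: field_simps)
      then show ?case using c by simp
    qed
  qed
qed

end

lemma logarithmic_mean:
  fixes \<mu> :: "real \<Rightarrow> real" and b K :: real
  defines "I \<equiv> \<lambda>t. LBINT s=ereal 0..ereal t. \<mu> s"
  assumes anti: "antimono \<mu>" and \<mu>: "\<And>t. 0 \<le> \<mu> t" "\<And>t. \<mu> t \<le> b" and lim: "((\<lambda>t. t * \<mu> t) \<longlongrightarrow> K) at_top"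
  shows "((\<lambda>t. 1 / ln (1 + t) * I t) \<longlongrightarrow> K) at_top"
    and "\<And>t. 0 < t \<Longrightarrow> 0 \<le> I t" and "\<And>t. 0 < t \<Longrightarrow> I t \<le> b * t"
    and "mono_on {0<..} I"
proof -
  have [measurable]: "\<mu> \<in> borel_measurable borel"
  proof -
    have "mono (\<lambda>t. - \<mu> t)" using anti by (auto simp: antimono_def mono_def)
    then have "(\<lambda>t. - \<mu> t) \<in> borel_measurable borel" by (rule borel_measurable_mono)
    then have "(\<lambda>t. - (- \<mu> t)) \<in> borel_measurable borel" by (rule borel_measurable_uminus)
    then show ?thesis by simp
  qed
  have ib: "integrable lborel (\<lambda>s. b * indicator {0<..<t} s)" for t :: real
    by (intro integrable_mult_right integrable_real_indicator) (cases "0 \<le> t"; simp)+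
  have int: "integrable lborel (\<lambda>s. indicator {0<..<t} s * \<mu> s)" for t
  proof (rule Bochner_Integration.integrable_bound)
    show "integrable lborel (\<lambda>s. b * indicator {0<..<t} s)" by (rule ib)
    show "AE s in lborel. norm (indicator {0<..<t} s * \<mu> s) \<le> norm (b * indicator {0<..<t} s)"
      using \<mu> order_trans[OF \<mu>] by (intro AE_I2) (auto simp: indicator_def)
  qed measurable
  have I: "I t = (\<integral>s. indicator {0<..<t} s * \<mu> s \<partial>lborel)" if "0 < t" for t
    using that by (simp add: I_def interval_lebesgue_integral_def set_lebesgue_integral_def)
  show I0: "0 \<le> I t" if "0 < t" for t
    unfolding I[OF that] using \<mu> by simp
  show I_le: "I t \<le> b * t" if t: "0 < t" for t
  proof -
    have "I t \<le> (\<integral>s. b * indicator {0<..<t} s \<partial>lborel)"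
      unfolding I[OF t] using \<mu> by (intro integral_mono int ib) (auto simp: indicator_def)
    then show ?thesis using t by simp
  qed
  show "mono_on {0<..} I"
  proof (rule mono_onI)
    fix t t' :: real assume "t \<in> {0<..}" "t' \<in> {0<..}" "t \<le> t'"
    then have t: "0 < t" "0 < t'" "t \<le> t'" by auto
    show "I t \<le> I t'"
      unfolding I[OF t(1)] I[OF t(2)] by (rule integral_mono[OF int int]) (use \<mu>(1) t in \<open>auto simp: indicator_def\<close>)
  qed
  have b0: "0 \<le> b" using \<mu>[of 0] by linarith
  have FTC: "has_bochner_integral lborel (\<lambda>s. 1 / s * indicator {a..t} s) (ln t - ln a)" if "0 < a" "a \<le> t" for a t :: real
    using that by (intro has_bochner_integral_FTC_Icc_real) (auto intro!: derivative_eq_intros continuous_intros)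
  have bounds: "\<exists>a. 0 < a \<and> (\<forall>t\<ge>a. d * (ln t - ln a) \<le> I t \<and> I t \<le> b * a + c * (ln t - ln a))"
    if dc: "d < K" "K < c" for d c
  proof -
    have "\<forall>\<^sub>F s in at_top. d < s * \<mu> s \<and> s * \<mu> s < c"
      using order_tendstoD[OF lim] dc by (auto intro: eventually_conj)
    then obtain a where a: "\<And>s. s \<ge> a \<Longrightarrow> d < s * \<mu> s \<and> s * \<mu> s < c"
      unfolding eventually_at_top_linorder by blast
    define a' where "a' = max a 1"
    have a': "0 < a'" "\<And>s. s \<ge> a' \<Longrightarrow> d \<le> s * \<mu> s \<and> s * \<mu> s \<le> c"
      using a by (auto simp: a'_def intro: less_imp_le)
    have "d * (ln t - ln a') \<le> I t \<and> I t \<le> b * a' + c * (ln t - ln a')" if t: "a' \<le> t" for t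
    proof
      have t0: "0 < t" using a' t by simp
      note F = FTC[OF a'(1) t]
      have Fi: "integrable lborel (\<lambda>s. 1 / s * indicator {a'..t} s)" and Fe: "(\<integral>s. 1 / s * indicator {a'..t} s \<partial>lborel) = ln t - ln a'"
        using F by (auto simp: has_bochner_integral_iff)
      have "d * (ln t - ln a') = (\<integral>s. d * (1 / s * indicator {a'..t} s) \<partial>lborel)"
        by (simp only: integral_mult_right_zero Fe)
      also have "\<dots> \<le> I t"
        unfolding I[OF t0]
      proof (rule integral_mono_AE)
        show "AE s in lborel. d * (1 / s * indicator {a'..t} s) \<le> indicator {0<..<t} s * \<mu> s"
          using AE_lborel_singleton[of t]
        proof eventually_elim
          case (elim s)
          show ?case
          proof (cases "s \<in> {a'..t}")
            case True
            then have "0 < s" "s < t" using a' elim by auto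
            then show ?thesis using a'(2)[of s] True by (simp add: field_simps)
          next
            case False
            then show ?thesis using \<mu>(1)[of s] by simp
          qed
        qed
      qed (intro integrable_mult_right Fi int)+
      finally show "d * (ln t - ln a') \<le> I t" .
      have "I t \<le> (\<integral>s. b * indicator {0<..<a'} s + c * (1 / s * indicator {a'..t} s) \<partial>lborel)"
        unfolding I[OF t0]
      proof (rule integral_mono)
        show "integrable lborel (\<lambda>s. b * indicator {0<..<a'} s + c * (1 / s * indicator {a'..t} s))"
          by (intro Bochner_Integration.integrable_add ib integrable_mult_right Fi)
        fix s
        consider "s \<le> 0" | "0 < s" "s < a'" | "a' \<le> s" "s \<le> t" | "t < s" by linarith
        then show "indicator {0<..<t} s * \<mu> s \<le> b * indicator {0<..<a'} s + c * (1 / s * indicator {a'..t} s)"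
        proof cases
          case 1
          then show ?thesis using a' by simp
        next
          case 2
          then show ?thesis using \<mu>[of s] t by (simp add: indicator_def)
        next
          case 3
          then have s: "0 < s" using a'(1) by simp
          then have le: "\<mu> s \<le> c / s" using a'(2)[of s] 3 by (simp add: pos_le_divide_eq mult.commute)
          then have "0 \<le> c / s" using \<mu>(1)[of s] by (rule order_trans[rotated])
          then show ?thesis using 3 s le by (cases "s = t") simp_all
        next
          case 4
          then show ?thesis using t by simp
        qed
      qed (rule int)
      also have "\<dots> = (\<integral>s. b * indicator {0<..<a'} s \<partial>lborel) + (\<integral>s. c * (1 / s * indicator {a'..t} s) \<partial>lborel)"
        by (intro Bochner_Integration.integral_add ib integrable_mult_right Fi)
      also have "\<dots> = b * a' + c * (ln t - ln a')" using a' by (simp only: integral_mult_right_zero Fe) simp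
      finally show "I t \<le> b * a' + c * (ln t - ln a')" .
    qed
    with a'(1) show ?thesis by blast
  qed
  have lim_aux: "((\<lambda>t. (e + c * (ln t - ln a)) / ln (1 + t)) \<longlongrightarrow> c) at_top" for a c e :: real
    by real_asymp
  show "((\<lambda>t. 1 / ln (1 + t) * I t) \<longlongrightarrow> K) at_top"
  proof (rule order_tendstoI)
    fix y assume "y < K"
    then obtain d where d: "y < d" "d < K" using dense by blast
    obtain a where a: "0 < a" "\<And>t. t \<ge> a \<Longrightarrow> d * (ln t - ln a) \<le> I t"
      using bounds[of d "K + 1"] d by auto
    have "\<forall>\<^sub>F t in at_top. y < (0 + d * (ln t - ln a)) / ln (1 + t)"
      using order_tendstoD(1)[OF lim_aux d(1)] .
    then show "\<forall>\<^sub>F t in at_top. y < 1 / ln (1 + t) * I t" using eventually_ge_at_top[of a]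
    proof eventually_elim
      case (elim t)
      have "0 < ln (1 + t)" using a elim by simp
      then have "(0 + d * (ln t - ln a)) / ln (1 + t) \<le> I t / ln (1 + t)"
        using a(2)[OF elim(2)] by (intro divide_right_mono) auto
      then show ?case using elim by simp
    qed
  next
    fix y assume "K < y"
    then obtain c where c: "K < c" "c < y" using dense by blast
    obtain a where a: "0 < a" "\<And>t. t \<ge> a \<Longrightarrow> I t \<le> b * a + c * (ln t - ln a)"
      using bounds[of "K - 1" c] c by auto
    have "\<forall>\<^sub>F t in at_top. (b * a + c * (ln t - ln a)) / ln (1 + t) < y"
      using order_tendstoD(2)[OF lim_aux c(2)] .
    then show "\<forall>\<^sub>F t in at_top. 1 / ln (1 + t) * I t < y" using eventually_ge_at_top[of a]
    proof eventually_elim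
      case (elim t)
      have "0 < ln (1 + t)" using a elim by simp
      then have "I t / ln (1 + t) \<le> (b * a + c * (ln t - ln a)) / ln (1 + t)"
        using a(2)[OF elim(2)] by (intro divide_right_mono) auto
      then show ?case using elim by simp
    qed
  qed
qed

section \<open>Admissible states extend the limit at infinity\<close>

lemma admissible_state_limit:
  fixes f :: "real \<Rightarrow> real"
  assumes \<omega>: "admissible_state \<omega>" and f: "(\<lambda>t. complex_of_real (f t)) \<in> Linf" "\<And>t. 0 < t \<Longrightarrow> 0 \<le> f t"
    and lim: "(f \<longlongrightarrow> K) at_top"
  shows "\<omega> (\<lambda>t. complex_of_real (f t)) = complex_of_real K"
proof -
  have m: "f \<in> borel_measurable (restrict_space lborel {a<..})" if "0 < a" for a
  proof -
    have "(\<lambda>t. complex_of_real (f t)) \<in> borel_measurable Rpos" using f(1) by (simp add: Linf_def)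
    then have "(\<lambda>t. Re (complex_of_real (f t))) \<in> borel_measurable Rpos"
      by (rule measurable_compose) measurable
    then have "f \<in> borel_measurable Rpos" by simp
    then show ?thesis by (rule measurable_restrict_mono) (use that in auto)
  qed
  have limsup: "ess_limsup g \<le> ereal L"
    if g: "(g \<longlongrightarrow> L) at_top" "\<And>a. 0 < a \<Longrightarrow> g \<in> borel_measurable (restrict_space lborel {a<..})"
    for g :: "real \<Rightarrow> real" and L
  proof (rule ereal_le_epsilon2)
    show "ess_limsup g \<le> ereal L + ereal e" if "0 < e" for e :: real
    proof -
      have "\<forall>\<^sub>F t in at_top. g t < L + e" using order_tendstoD(2)[OF g(1)] that by simp
      then obtain a where a: "\<And>t. t \<ge> a \<Longrightarrow> g t < L + e"
        unfolding eventually_at_top_linorder by blast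
      define a' where "a' = max a 1"
      have "ess_limsup g \<le> esssup (restrict_space lborel {a'<..}) (\<lambda>t. ereal (g t))"
        unfolding ess_limsup_def by (rule INF_lower) (simp add: a'_def)
      also have "\<dots> \<le> ereal (L + e)"
      proof (rule esssup_I)
        show "(\<lambda>t. ereal (g t)) \<in> borel_measurable (restrict_space lborel {a'<..})"
          using g(2)[of a'] by (intro borel_measurable_ereal) (simp add: a'_def)
        show "AE t in restrict_space lborel {a'<..}. ereal (g t) \<le> ereal (L + e)"
          by (rule AE_I2) (use a in \<open>auto simp: space_restrict_space a'_def intro: less_imp_le\<close>)
      qed
      finally show "ess_limsup g \<le> ereal L + ereal e" by simp
    qed
  qed
  let ?w = "\<omega> (\<lambda>t. complex_of_real (f t))"
  have st: "ess_liminf f \<le> ereal (Re ?w)" "ereal (Re ?w) \<le> ess_limsup f"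
    using \<omega> f(1) by (auto simp: admissible_state_def)
  have "ereal (Re ?w) \<le> ereal K" using st(2) limsup[OF lim m] by (rule order_trans)
  moreover have "ess_limsup (\<lambda>t. - f t) \<le> ereal (- K)"
    using m by (intro limsup tendsto_minus lim borel_measurable_uminus)
  then have "ereal K \<le> ess_liminf f" unfolding ess_liminf_def
    by (metis ereal_minus_le_minus ereal_uminus_uminus uminus_ereal.simps(1))
  then have "ereal K \<le> ereal (Re ?w)" using st(1) by (rule order_trans)
  ultimately have "Re ?w = K" by simp
  moreover have "?w \<in> \<real>\<^sub>\<ge>\<^sub>0"
  proof -
    have ae: "AE t in Rpos. complex_of_real (f t) \<in> \<real>\<^sub>\<ge>\<^sub>0"
      by (rule AE_I2) (use f(2) in \<open>auto simp: space_restrict_space\<close>)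
    have "\<forall>f\<in>Linf. (AE t in Rpos. f t \<in> \<real>\<^sub>\<ge>\<^sub>0) \<longrightarrow> \<omega> f \<in> \<real>\<^sub>\<ge>\<^sub>0"
      using \<omega> unfolding admissible_state_def state_Linf_def by (elim conjE)
    from this[rule_format, OF f(1) ae] show ?thesis .
  qed
  then have "Im ?w = 0" by (simp add: complex_nonneg_Reals_iff)
  ultimately show ?thesis by (simp add: complex_eq_iff)
qed

lemma Linf_logarithmic_mean:
  fixes I :: "real \<Rightarrow> real"
  assumes lim: "((\<lambda>t. 1 / ln (1 + t) * I t) \<longlongrightarrow> K) at_top"
    and I: "\<And>t. 0 < t \<Longrightarrow> 0 \<le> I t" "\<And>t. 0 < t \<Longrightarrow> I t \<le> b * t" "mono_on {0<..} I"
  shows "(\<lambda>t. complex_of_real (1 / ln (1 + t) * I t)) \<in> Linf"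
proof -
  have "sets Rpos = sets (restrict_space borel {0<..})" by (simp add: sets_restrict_space)
  then have "I \<in> borel_measurable Rpos"
    using borel_measurable_mono_on_fnc[OF I(3)] by (simp cong: measurable_cong_sets)
  moreover have "(\<lambda>t. 1 / ln (1 + t)) \<in> borel_measurable Rpos"
    by (rule measurable_restrict_space1) measurable
  ultimately have "(\<lambda>t. complex_of_real (1 / ln (1 + t) * I t)) \<in> borel_measurable Rpos" by measurable
  moreover have "\<forall>\<^sub>F t in at_top. 1 / ln (1 + t) * I t < K + 1" by (rule order_tendstoD(2)[OF lim]) simp
  then obtain a where a: "\<And>t. t \<ge> a \<Longrightarrow> 1 / ln (1 + t) * I t < K + 1"
    unfolding eventually_at_top_linorder by blast
  define a' where "a' = max a 1"
  have b: "0 \<le> b" using I(1)[of 1] I(2)[of 1] by simp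
  have "norm (complex_of_real (1 / ln (1 + t) * I t)) \<le> max (K + 1) (b * (1 + a'))" if t: "0 < t" for t
  proof -
    have ln: "0 < ln (1 + t)" using t by simp
    have "1 / ln (1 + t) * I t \<le> max (K + 1) (b * (1 + a'))"
    proof (cases "t \<ge> a'")
      case True
      then show ?thesis using a[of t] by (simp add: a'_def)
    next
      case False
      have "t / (1 + t) \<le> ln (1 + t)"
        using ln_one_minus_pos_upper_bound[of "t / (1 + t)"] ln_inverse[of "1 + t"] t
        by (simp add: field_simps)
      then have "t \<le> ln (1 + t) * (1 + t)" using t by (simp add: field_simps)
      have "I t \<le> b * t" using I(2) t by simp
      also have "\<dots> \<le> b * (ln (1 + t) * (1 + t))"
        using \<open>t \<le> ln (1 + t) * (1 + t)\<close> b by (rule mult_left_mono)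
      also have "\<dots> \<le> b * (ln (1 + t) * (1 + a'))" using False b ln by (intro mult_left_mono) auto
      finally have "1 / ln (1 + t) * I t \<le> b * (1 + a')" using ln by (simp add: field_simps)
      then show ?thesis by simp
    qed
    moreover have "0 \<le> 1 / ln (1 + t) * I t" using ln I(1)[OF t] by simp
    ultimately show ?thesis by (simp del: of_real_mult of_real_divide)
  qed
  then have "AE t in Rpos. norm (complex_of_real (1 / ln (1 + t) * I t)) \<le> max (K + 1) (b * (1 + a'))"
    by (intro AE_I2) (simp add: space_restrict_space del: of_real_mult of_real_divide)
  ultimately show ?thesis unfolding Linf_def by blast
qed

section \<open>The residue formula\<close>

lemma inv_power_expansion_leading:
  assumes "inv_power_expansion h C q"
  shows "((\<lambda>t. t powr q * h t) \<longlongrightarrow> C) (at_right 0)"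
  using assms unfolding inv_power_expansion_def
proof (elim exE conjE)
  fix a c :: "nat \<Rightarrow> real"
  assume a: "a 1 < q" and o: "\<forall>n\<ge>1. (\<lambda>t. h t - (C * t powr (- q) + (\<Sum>k=1..n. c k * t powr (- a k))))
      \<in> o[at_right 0](\<lambda>t. t powr (- a n))"
  define d where "d t = h t - (C * t powr (- q) + c 1 * t powr (- a 1))" for t
  have "d \<in> o[at_right 0](\<lambda>t. t powr (- a 1))"
    using o[rule_format, of 1] by (simp add: d_def[abs_def])
  then have d: "((\<lambda>t. d t / t powr (- a 1)) \<longlongrightarrow> 0) (at_right 0)" by (rule smalloD_tendsto)
  have z: "((\<lambda>t. t powr (q - a 1)) \<longlongrightarrow> 0) (at_right 0)"
    using a eventually_at_right_less[of 0]
    by (intro tendsto_zero_powrI[where b="q - a 1"] tendsto_intros) (auto elim!: eventually_mono)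
  have "((\<lambda>t. C + c 1 * t powr (q - a 1) + d t / t powr (- a 1) * t powr (q - a 1)) \<longlongrightarrow> C + c 1 * 0 + 0 * 0) (at_right 0)"
    by (intro tendsto_intros d z)
  then have "((\<lambda>t. C + c 1 * t powr (q - a 1) + d t / t powr (- a 1) * t powr (q - a 1)) \<longlongrightarrow> C) (at_right 0)"
    by simp
  moreover have "\<forall>\<^sub>F t in at_right 0. C + c 1 * t powr (q - a 1) + d t / t powr (- a 1) * t powr (q - a 1) = t powr q * h t"
    using eventually_at_right_less[of 0]
  proof eventually_elim
    case (elim t)
    have "t powr q * h t = t powr q * (C * t powr (- q) + c 1 * t powr (- a 1) + d t)" by (simp add: d_def)
    also have "\<dots> = C * (t powr q * t powr (- q)) + c 1 * (t powr q * t powr (- a 1)) + d t * t powr q"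
      by (simp add: algebra_simps)
    also have "\<dots> = C + c 1 * t powr (q - a 1) + d t / t powr (- a 1) * t powr (q - a 1)"
      using elim by (simp add: powr_diff powr_minus field_simps)
    finally show ?case by simp
  qed
  ultimately show ?thesis by (rule Lim_transform_eventually)
qed

theorem heat_asymptotics_counting:
  fixes m :: "real measure" and p C :: real
  assumes m: "sets m = sets borel" "AE l in m. 0 < l" and p: "0 < p"
    and fin: "\<And>t. 0 < t \<Longrightarrow> (\<integral>\<^sup>+l. ennreal (exp (- (t * inverse (l\<^sup>2)))) \<partial>m) < \<infinity>"
    and lim: "((\<lambda>t. t powr (p / 2) * enn2real (\<integral>\<^sup>+l. ennreal (exp (- (t * inverse (l\<^sup>2)))) \<partial>m)) \<longlongrightarrow> C) (at_right 0)"
  obtains K where "0 \<le> K" "((\<lambda>u. u powr p * measure m {u<..}) \<longlongrightarrow> K) (at_right 0)"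
    "\<forall>u>0. emeasure m {u<..} < \<infinity>"
proof -
  note [measurable_cong] = m(1)
  have sp: "space m = UNIV" using sets_eq_imp_space_eq[OF m(1)] by simp
  let ?X = "\<lambda>l :: real. inverse (l\<^sup>2)"
  have X: "?X \<in> borel_measurable m" by measurable
  have int: "integrable m (\<lambda>l. exp (- (t * ?X l)))" if "0 < t" for t
    using fin[OF that] X by (intro integrableI_nonneg) (auto intro!: borel_measurable_exp borel_measurable_uminus borel_measurable_times)
  have H: "(\<integral>l. exp (- (t * ?X l)) \<partial>m) = enn2real (\<integral>\<^sup>+l. ennreal (exp (- (t * ?X l))) \<partial>m)" for t
    by (rule integral_eq_nn_integral) measurable
  obtain K where K: "0 \<le> K" "((\<lambda>t. t powr (p / 2) * measure m {l \<in> space m. t * ?X l < 1}) \<longlongrightarrow> K) (at_right 0)"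
    by (rule karamata_tauberian[OF X _ _ int, of "p / 2" C]) (use p lim in \<open>auto simp: H\<close>)
  have iff: "u\<^sup>2 * ?X l < 1 \<longleftrightarrow> u < l" if "0 < u" "0 < l" for u l :: real
  proof -
    have "u\<^sup>2 * ?X l < 1 \<longleftrightarrow> u\<^sup>2 < l\<^sup>2" using that by (simp add: field_simps)
    also have "\<dots> \<longleftrightarrow> u < l"
      using that by (auto intro: power_strict_mono dest: power_less_imp_less_base)
    finally show ?thesis .
  qed
  have sq: "filterlim (\<lambda>u :: real. u\<^sup>2) (at_right 0) (at_right 0)" by real_asymp
  have "((\<lambda>u. u powr p * measure m {u<..}) \<longlongrightarrow> K) (at_right 0)"
  proof (rule Lim_transform_eventually[OF filterlim_compose[OF K(2) sq]])
    show "\<forall>\<^sub>F u in at_right 0. (u\<^sup>2) powr (p / 2) * measure m {l \<in> space m. u\<^sup>2 * ?X l < 1} = u powr p * measure m {u<..}"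
      using eventually_at_right_less[of 0]
    proof eventually_elim
      case (elim u)
      have "measure m {l \<in> space m. u\<^sup>2 * ?X l < 1} = measure m {u<..}"
      proof (rule measure_eq_AE)
        show "AE l in m. (l \<in> {l \<in> space m. u\<^sup>2 * ?X l < 1}) = (l \<in> {u<..})"
          using m(2) by eventually_elim (simp add: iff[OF elim] sp)
        show "{l \<in> space m. u\<^sup>2 * ?X l < 1} \<in> sets m" by measurable
      qed (simp add: m(1))
      moreover have "(u\<^sup>2) powr (p / 2) = u powr p"
        using elim by (simp add: powr_powr flip: powr_numeral)
      ultimately show ?case by simp
    qed
  qed
  moreover have "emeasure m {u<..} < \<infinity>" if u: "0 < u" for u
  proof -
    have "emeasure m {u<..} = (\<integral>\<^sup>+l. indicator {u<..} l \<partial>m)" by (simp add: m(1))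
    also have "\<dots> \<le> (\<integral>\<^sup>+l. ennreal (exp 1) * ennreal (exp (- (u\<^sup>2 * ?X l))) \<partial>m)"
    proof (rule nn_integral_mono_AE)
      show "AE l in m. indicator {u<..} l \<le> ennreal (exp 1) * ennreal (exp (- (u\<^sup>2 * ?X l)))"
        using m(2)
      proof eventually_elim
        case (elim l)
        have "ennreal (exp 1) * ennreal (exp (- (u\<^sup>2 * ?X l))) = ennreal (exp (1 - u\<^sup>2 * ?X l))"
          by (simp add: exp_diff exp_minus divide_inverse flip: ennreal_mult)
        moreover have "1 \<le> ennreal (exp (1 - u\<^sup>2 * ?X l))" if "u < l"
          using iff[OF u elim] that by (simp flip: ennreal_1)
        ultimately show ?case by (simp add: indicator_def)
      qed
    qed
    also have "\<dots> = ennreal (exp 1) * (\<integral>\<^sup>+l. ennreal (exp (- (u\<^sup>2 * ?X l))) \<partial>m)"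
      by (rule nn_integral_cmult) measurable
    also have "\<dots> < \<infinity>" using fin[of "u\<^sup>2"] u by (simp add: ennreal_mult_less_top)
    finally show ?thesis .
  qed
  ultimately show thesis using that K(1) by blast
qed

theorem proposition5p2:
  fixes N :: "('h::complex_hilbert \<Rightarrow>\<^sub>L 'h) set"
    and \<tau> :: "('h \<Rightarrow>\<^sub>L 'h) \<Rightarrow> ennreal"
    and T :: "'h \<Rightarrow>\<^sub>L 'h"
    and p C :: real
  assumes separable: "\<exists>D::'h set. countable D \<and> closure D = UNIV"
    and vN: "von_neumann_algebra N"
    and trace: "trace_on N \<tau>" "faithful_trace N \<tau>" "normal_trace N \<tau>" "semifinite_trace N \<tau>"
    and T: "T \<in> N" "op_pos T"
    and p: "p \<ge> 1"
    and heat_finite: "\<And>t. t > 0 \<Longrightarrow> \<tau> (heat_op T t) < \<infinity>"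
    and expansion: "inv_power_expansion (\<lambda>t. enn2real (\<tau> (heat_op T t))) C (p / 2)"
  shows "T \<in> Zp N \<tau> p \<and>
    (\<forall>\<omega>. admissible_state \<omega> \<and> invariant_under D2 \<omega> \<and> invariant_under Mmean \<omega> \<longrightarrow>
       ((\<lambda>s. complex_of_real ((s - p) * enn2real (\<tau> (op_powr T s))))
          \<longlongrightarrow> complex_of_real p * dixmier \<tau> \<omega> (op_powr T p)) (at_right p))"
proof (rule trace_measure_op_pos[OF vN trace(1,3) T])
  fix r :: real and m :: "real measure"
  assume r: "0 < r" and m: "sets m = sets borel" "AE l in m. l \<in> {0<..r}"
    and \<tau>f: "\<And>(f :: real \<Rightarrow> real) K. f \<in> borel_measurable borel \<Longrightarrow> f 0 = 0 \<Longrightarrow> (\<And>t. t \<in> {0..r} \<Longrightarrow> 0 \<le> f t \<and> f t \<le> K) \<Longrightarrow>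
       \<tau> (fun_calc f T) = (\<integral>\<^sup>+t. ennreal (f t) \<partial>m)"
    and \<tau>E: "\<And>(f :: real \<Rightarrow> real) K s. f \<in> borel_measurable borel \<Longrightarrow> f 0 = 0 \<Longrightarrow> (\<And>t. t \<in> {0..r} \<Longrightarrow> 0 \<le> f t \<and> f t \<le> K) \<Longrightarrow>
       0 \<le> s \<Longrightarrow> \<tau> (spectral_measure (op_abs (fun_calc f T)) {s<..}) = emeasure m {l. s < f l}"
  have p0: "0 < p" using p by simp
  note [measurable_cong] = m(1)
  have pos: "AE l in m. 0 < l" using m(2) by eventually_elim simp
  have powr_r: "0 \<le> t powr s \<and> t powr s \<le> r powr s" if "t \<in> {0..r}" "0 < s" for t s
    using that by (auto intro: powr_mono2)
  have \<tau>_powr: "\<tau> (op_powr T s) = (\<integral>\<^sup>+l. ennreal (l powr s) \<partial>m)" if "0 < s" for s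
    unfolding op_powr_def using powr_r[OF _ that] by (intro \<tau>f[where K="r powr s"]) auto
  have heat: "\<tau> (heat_op T t) = (\<integral>\<^sup>+l. ennreal (exp (- (t * inverse (l\<^sup>2)))) \<partial>m)" if t: "0 < t" for t
  proof -
    have eq: "(\<lambda>l. if l = 0 then 0 else exp (- t * l powi (-2))) = (\<lambda>l. if l = 0 then 0 else exp (- (t * inverse (l\<^sup>2))))"
      by (auto simp: fun_eq_iff power_int_minus)
    have "\<tau> (heat_op T t) = (\<integral>\<^sup>+l. ennreal (if l = 0 then 0 else exp (- (t * inverse (l\<^sup>2)))) \<partial>m)"
      unfolding heat_op_def eq using t by (intro \<tau>f[where K=1]) auto
    also have "\<dots> = (\<integral>\<^sup>+l. ennreal (exp (- (t * inverse (l\<^sup>2)))) \<partial>m)"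
      by (rule nn_integral_cong_AE) (use pos in eventually_elim, auto)
    finally show ?thesis .
  qed
  have lim: "((\<lambda>t. t powr (p / 2) * enn2real (\<integral>\<^sup>+l. ennreal (exp (- (t * inverse (l\<^sup>2)))) \<partial>m)) \<longlongrightarrow> C) (at_right 0)"
  proof (rule Lim_transform_eventually[OF inv_power_expansion_leading[OF expansion]])
    show "\<forall>\<^sub>F t in at_right 0. t powr (p / 2) * enn2real (\<tau> (heat_op T t)) =
        t powr (p / 2) * enn2real (\<integral>\<^sup>+l. ennreal (exp (- (t * inverse (l\<^sup>2)))) \<partial>m)"
      using eventually_at_right_less[of 0] by eventually_elim (simp add: heat)
  qed
  have heat_fin: "(\<integral>\<^sup>+l. ennreal (exp (- (t * inverse (l\<^sup>2)))) \<partial>m) < \<infinity>" if "0 < t" for t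
    using heat_finite[OF that] by (simp add: heat[OF that])
  obtain K where K: "0 \<le> K" "((\<lambda>u. u powr p * measure m {u<..}) \<longlongrightarrow> K) (at_right 0)"
    and fin': "\<forall>u>0. emeasure m {u<..} < \<infinity>"
    by (rule heat_asymptotics_counting[OF m(1) pos p0 heat_fin lim])
  have fin: "emeasure m {u<..} < \<infinity>" if "0 < u" for u using fin' that by blast
  note zeta = zeta_residue[OF m r fin p0 K(2)]
  have \<tau>_fin: "\<tau> (op_powr T s) < \<infinity>" if "p < s" for s
    using zeta(1)[OF _ that] p0 that by (simp add: \<tau>_powr)
  have residue: "((\<lambda>s. (s - p) * enn2real (\<tau> (op_powr T s))) \<longlongrightarrow> p * K) (at_right p)"
  proof (rule Lim_transform_eventually[OF zeta(2)])
    show "\<forall>\<^sub>F s in at_right p. (s - p) * enn2real (\<integral>\<^sup>+l. ennreal (l powr s) \<partial>m) = (s - p) * enn2real (\<tau> (op_powr T s))"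
      using eventually_at_right_less[of p] by eventually_elim (use p0 in \<open>simp add: \<tau>_powr\<close>)
  qed
  have "T \<in> Zp N \<tau> p"
  proof -
    let ?B = "p * K + 1"
    have B: "1 \<le> ?B" using p0 K(1) by simp
    have "\<forall>\<^sub>F s in at_right p. (s - p) * enn2real (\<tau> (op_powr T s)) < ?B"
      by (rule order_tendstoD(2)[OF residue]) simp
    then have "\<forall>\<^sub>F s in at_right p. ennreal_powr (ennreal (s - p) * \<tau> (op_powr T s)) (1 / s) \<le> ennreal ?B"
      using eventually_at_right_less[of p]
    proof eventually_elim
      case (elim s)
      have "ennreal (s - p) * \<tau> (op_powr T s) = ennreal ((s - p) * enn2real (\<tau> (op_powr T s)))"
        using \<tau>_fin[OF elim(2)] elim by (simp add: ennreal_mult)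
      then have "ennreal_powr (ennreal (s - p) * \<tau> (op_powr T s)) (1 / s) =
          ennreal (((s - p) * enn2real (\<tau> (op_powr T s))) powr (1 / s))"
        using elim by (simp add: ennreal_powr_def)
      also have "\<dots> \<le> ennreal (?B powr (1 / s))"
        using elim p by (intro ennreal_leI powr_mono2) auto
      also have "\<dots> \<le> ennreal (?B powr 1)"
        using B elim p by (intro ennreal_leI powr_mono) auto
      finally show ?case using B by simp
    qed
    then have "Limsup (at_right p) (\<lambda>s. ennreal_powr (ennreal (s - p) * \<tau> (op_powr T s)) (1 / s)) \<le> ennreal ?B"
      by (rule Limsup_bounded)
    then have "Limsup (at_right p) (\<lambda>s. ennreal_powr (ennreal (s - p) * \<tau> (op_powr T s)) (1 / s)) < \<infinity>"
      by (rule le_less_trans) simp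
    with T show ?thesis by (simp add: Zp_def pos_part_def)
  qed
  moreover have "((\<lambda>s. complex_of_real ((s - p) * enn2real (\<tau> (op_powr T s))))
      \<longlongrightarrow> complex_of_real p * dixmier \<tau> \<omega> (op_powr T p)) (at_right p)" if \<omega>: "admissible_state \<omega>" for \<omega>
  proof -
    define n where "n s = emeasure m {l. s < l powr p}" for s
    define b where "b = r powr p"
    define \<mu> where "\<mu> t = Inf {s. 0 \<le> s \<and> n s \<le> ennreal t}" for t
    have sing: "sing_val \<tau> (op_powr T p) = \<mu>"
    proof
      fix t
      have "\<tau> (spectral_measure (op_abs (op_powr T p)) {s<..}) = n s" if "0 \<le> s" for s
        unfolding op_powr_def n_def using powr_r[OF _ p0] that by (intro \<tau>E[where K="r powr p"]) auto
      then have "{s. 0 \<le> s \<and> \<tau> (spectral_measure (op_abs (op_powr T p)) {s<..}) \<le> ennreal t} =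
          {s. 0 \<le> s \<and> n s \<le> ennreal t}" by auto
      then show "sing_val \<tau> (op_powr T p) t = \<mu> t" by (simp add: sing_val_def \<mu>_def)
    qed
    have meas: "{l. s < l powr p} \<in> sets m" for s
      by (simp add: m(1))
    have anti: "n s' \<le> n s" if "0 \<le> s" "s \<le> s'" for s s'
      unfolding n_def using that meas by (intro emeasure_mono) auto
    have b: "0 \<le> b" "n b = 0"
    proof -
      have "AE l in m. \<not> b < l powr p"
        using m(2) by eventually_elim (use p0 in \<open>auto simp: b_def not_less intro: powr_mono2\<close>)
      then show "n b = 0"
        using meas[of b] AE_iff_measurable[of "{l. b < l powr p}" m "\<lambda>l. \<not> b < l powr p"] sets_eq_imp_space_eq[OF m(1)]
        by (simp add: n_def)
    qed (simp add: b_def)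
    have n_eq: "n s = emeasure m {s powr (1 / p)<..}" if "0 < s" for s
      unfolding n_def
    proof (rule emeasure_eq_AE)
      show "AE l in m. (l \<in> {l. s < l powr p}) = (l \<in> {s powr (1 / p)<..})"
        using pos
      proof eventually_elim
        case (elim l)
        have "s < l powr p \<longleftrightarrow> (s powr (1 / p)) powr p < l powr p"
          using that p0 by (simp add: powr_powr)
        also have "\<dots> \<longleftrightarrow> s powr (1 / p) < l"
          using elim p0 powr_less_cancel_iff by (metis powr_ge_zero powr_less_mono2 less_imp_le not_less_iff_gr_or_eq linorder_not_le)
        finally show ?case by simp
      qed
    qed (use meas m(1) in auto)
    have n_fin: "n s < \<infinity>" if "0 < s" for s
      unfolding n_eq[OF that] using that by (intro fin) simp
    have root: "filterlim (\<lambda>s. s powr (1 / p)) (at_right 0) (at_right 0)"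
    proof (rule tendsto_imp_filterlim_at_right)
      show "((\<lambda>s. s powr (1 / p)) \<longlongrightarrow> 0) (at_right 0)"
        using p0 eventually_at_right_less[of 0]
        by (intro tendsto_zero_powrI[where b="1 / p"] tendsto_intros) (auto elim!: eventually_mono)
      show "\<forall>\<^sub>F s in at_right 0. 0 < s powr (1 / p)"
        using eventually_at_right_less[of 0] by eventually_elim simp
    qed
    have n_lim: "((\<lambda>s. s * enn2real (n s)) \<longlongrightarrow> K) (at_right 0)"
    proof (rule Lim_transform_eventually[OF filterlim_compose[OF K(2) root]])
      show "\<forall>\<^sub>F s in at_right 0. (s powr (1 / p)) powr p * measure m {s powr (1 / p)<..} = s * enn2real (n s)"
        using eventually_at_right_less[of 0]
        by eventually_elim (use p0 in \<open>simp add: powr_powr n_eq measure_def\<close>)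
    qed
    have \<mu>_lim: "((\<lambda>t. t * \<mu> t) \<longlongrightarrow> K) at_top"
      unfolding \<mu>_def by (rule generalised_inverse_asymptotics[where N=n, OF anti b n_fin n_lim])
    have \<mu>_anti: "antimono \<mu>"
      unfolding \<mu>_def[abs_def] by (rule antimono_generalised_inverse[where N=n, OF anti b])
    have \<mu>_nonneg: "0 \<le> \<mu> t" for t
      unfolding \<mu>_def by (rule generalised_inverse_nonneg[where N=n, OF anti b])
    have \<mu>_le: "\<mu> t \<le> b" for t
      unfolding \<mu>_def by (rule generalised_inverse_le_bound[where N=n, OF anti b])
    define I where "I t = (LBINT s=ereal 0..ereal t. \<mu> s)" for t
    note mean = logarithmic_mean[OF \<mu>_anti \<mu>_nonneg \<mu>_le \<mu>_lim, folded I_def]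
    have Linf: "(\<lambda>t. complex_of_real (1 / ln (1 + t) * I t)) \<in> Linf"
      by (rule Linf_logarithmic_mean[OF mean])
    have "dixmier \<tau> \<omega> (op_powr T p) = \<omega> (\<lambda>t. complex_of_real (1 / ln (1 + t) * I t))"
      by (simp only: dixmier_def sing I_def)
    also have "\<dots> = complex_of_real K"
      by (rule admissible_state_limit[OF \<omega> Linf _ mean(1)]) (simp add: mean(2))
    finally have "dixmier \<tau> \<omega> (op_powr T p) = complex_of_real K" .
    then show ?thesis using tendsto_of_real[OF residue, where 'a=complex] by simp
  qed
  ultimately show ?thesis by blast
qed

end
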